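(* Let $p\ge 1$ be fixed and consider, for each $n>p+1$, random data $(\mathbf Y,\mathbf X,\mathbf Z)\in\mathbb{R}^n\times\mathbb{R}^n\times\mathbb{R}^{n\times p}$, where the joint distribution may depend on $n$. Let $\tilde{\mathbf Z}=(\mathbf X,\mathbf Z)\in\mathbb{R}^{n\times(p+1)}$, let $(\hat\theta,\hat\beta^Y)\in\mathbb{R}\times\mathbb{R}^p$ be the OLS coefficient vector from regressing $\mathbf Y$ on $\tilde{\mathbf Z}$, let $\tilde{\mathbf P}$ and $\mathbf P$ be the orthogonal projections onto the column spaces of $\tilde{\mathbf Z}$ and $\mathbf Z$ respectively, let $\tilde\sigma^2=\|\mathbf Y-\tilde{\mathbf P}\mathbf Y\|_2^2/(n-p-1)$, and define the $t$-statistic $$T_{\mathrm{OLS}}=\frac{\hat\theta}{\sqrt{\{(\tilde{\mathbf Z}^T\tilde{\mathbf Z})^{-1}\}_{11}\,\tilde\sigma^2}}.$$ Assume: (A1) $\mathbf Z^T\mathbf Z/n\to\Sigma$ in probability, where $\Sigma$ is a positive definite $p\times p$ matrix, and moreover $\mathbb{E}(\mathbf Z^T\mathbf Z/n)\to\Sigma$. Assume further that either (Y1) and (Y2) hold, or (X1) and (X2) hold, where: (Y1) $\mathbf Y=\mathbf Z\beta^Y+\boldsymbol\varepsilon$ for some $\beta^Y\in\mathbb{R}^p$, with $\mathbb{E}(\varepsilon_i\mid\mathbf Z)=0$, $\mathbb{E}(\varepsilon_i^2\mid\mathbf Z)=\sigma^2>0$, $\mathbb{E}(|\varepsilon_i|^3\mid\mathbf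 Z)<M$ for a constant $M$ (not depending on $n$), and $\varepsilon_1,\dots,\varepsilon_n$ independent conditional on $\mathbf Z$; (Y2) writing $\mathbf R=(\mathbf I-\mathbf P)\mathbf X$, $$\frac{1}{\sqrt n}\,\mathbb{E}\left(\frac{\frac1n\sum_{i=1}^n|R_i|^3}{\big(\frac1n\sum_{i=1}^nR_i^2\big)^{3/2}}\mathbb 1_{\{\mathbf R\neq\mathbf 0\}}\right)\to0\quad\text{and}\quad\mathbb{P}(\mathbf R=\mathbf 0)\to0;$$ (X1),(X2) are the same as (Y1),(Y2) with the roles of $\mathbf X$ and $\mathbf Y$ interchanged (i.e. $\mathbf X=\mathbf Z\beta^X+\boldsymbol\varepsilon$ with the stated conditional moment properties, and (Y2) with $\mathbf R=(\mathbf I-\mathbf P)\mathbf Y$). Then, under the null hypothesis that $\mathbf X$ and $\mathbf Y$ are conditionally independent given $\mathbf Z$, $T_{\mathrm{OLS}}\to\mathcal N(0,1)$ in distribution as $n\to\infty$.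
   Context: Convergence is as $n\to\infty$ with $p$ fixed. $\{(\tilde{\mathbf Z}^T\tilde{\mathbf Z})^{-1}\}_{11}$ denotes the $(1,1)$ entry (the entry corresponding to the column $\mathbf X$). *)

theory Defs
  imports "HOL-Probability.Probability"
begin

(* Vectors in R^n are represented as functions nat => real (only indices i < n matter);
   n x k matrices as functions nat => nat => real (only indices i < n, j < k matter). *)

definition colspace :: "nat \<Rightarrow> nat \<Rightarrow> (nat \<Rightarrow> nat \<Rightarrow> real) \<Rightarrow> (nat \<Rightarrow> real) set" where
  "colspace n k A = {(\<lambda>i. if i < n then (\<Sum>j<k. A i j * c j) else 0) | c. True}"

definition oproj :: "nat \<Rightarrow> nat \<Rightarrow> (nat \<Rightarrow> nat \<Rightarrow> real) \<Rightarrow> (nat \<Rightarrow> real) \<Rightarrow> (nat \<Rightarrow> real)" where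
  "oproj n k A v = (THE w. w \<in> colspace n k A \<and>
      (\<forall>u \<in> colspace n k A. (\<Sum>i<n. (v i - w i) * u i) = 0))"

definition is_inverse :: "nat \<Rightarrow> (nat \<Rightarrow> nat \<Rightarrow> real) \<Rightarrow> (nat \<Rightarrow> nat \<Rightarrow> real) \<Rightarrow> bool" where
  "is_inverse k G H \<longleftrightarrow>
     (\<forall>i<k. \<forall>j<k. (\<Sum>l<k. G i l * H l j) = (if i = j then 1 else 0)) \<and>
     (\<forall>i<k. \<forall>j<k. (\<Sum>l<k. H i l * G l j) = (if i = j then 1 else 0)) \<and>
     (\<forall>i j. (k \<le> i \<or> k \<le> j) \<longrightarrow> H i j = 0)"

definition invertible_k :: "nat \<Rightarrow> (nat \<Rightarrow> nat \<Rightarrow> real) \<Rightarrow> bool" where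
  "invertible_k k G \<longleftrightarrow> (\<exists>H. is_inverse k G H)"

definition inv_k :: "nat \<Rightarrow> (nat \<Rightarrow> nat \<Rightarrow> real) \<Rightarrow> (nat \<Rightarrow> nat \<Rightarrow> real)" where
  "inv_k k G = (THE H. is_inverse k G H)"

definition gram :: "nat \<Rightarrow> (nat \<Rightarrow> nat \<Rightarrow> real) \<Rightarrow> (nat \<Rightarrow> nat \<Rightarrow> real)" where
  "gram n A = (\<lambda>j l. \<Sum>i<n. A i j * A i l)"

definition design :: "(nat \<Rightarrow> real) \<Rightarrow> (nat \<Rightarrow> nat \<Rightarrow> real) \<Rightarrow> (nat \<Rightarrow> nat \<Rightarrow> real)" where
  "design x z = (\<lambda>i j. if j = 0 then x i else z i (j - 1))"

(* OLS t-statistic for the coefficient of X when regressing Y on (X, Z).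
   Convention: if Ztilde^T Ztilde is singular the statistic is set to 0
   (and x/0 = 0 in Isabelle, e.g. when the residual variance estimate vanishes). *)
definition T_OLS :: "nat \<Rightarrow> nat \<Rightarrow> (nat \<Rightarrow> real) \<Rightarrow> (nat \<Rightarrow> real) \<Rightarrow> (nat \<Rightarrow> nat \<Rightarrow> real) \<Rightarrow> real" where
  "T_OLS n p y x z =
    (let Zt = design x z; G = gram n Zt in
     if invertible_k (p + 1) G then
       (let Gi = inv_k (p + 1) G;
            coef = (\<lambda>j. \<Sum>l<p+1. Gi j l * (\<Sum>i<n. Zt i l * y i));
            theta = coef 0;
            res = (\<lambda>i. y i - oproj n (p + 1) Zt y i);
            s2 = (\<Sum>i<n. (res i)\<^sup>2) / (real n - real p - 1)
        in theta / sqrt (Gi 0 0 * s2))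
     else 0)"

definition gen_sigma :: "'a measure \<Rightarrow> ('i \<Rightarrow> 'a \<Rightarrow> real) \<Rightarrow> 'i set \<Rightarrow> 'a measure" where
  "gen_sigma M f I = sigma (space M) {f i -` B \<inter> space M | i B. i \<in> I \<and> B \<in> sets borel}"

definition cond_indep_alg :: "'a measure \<Rightarrow> 'a measure \<Rightarrow> 'a measure \<Rightarrow> 'a measure \<Rightarrow> bool" where
  "cond_indep_alg M F A B \<longleftrightarrow>
    (\<forall>a \<in> sets A. \<forall>b \<in> sets B. AE \<omega> in M.
       real_cond_exp M F (indicator (a \<inter> b)) \<omega> =
       real_cond_exp M F (indicator a) \<omega> * real_cond_exp M F (indicator b) \<omega>)"

definition cond_indep_vars :: "'a measure \<Rightarrow> 'a measure \<Rightarrow> ('i \<Rightarrow> 'a \<Rightarrow> real) \<Rightarrow> 'i set \<Rightarrow> bool" where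
  "cond_indep_vars M F X I \<longleftrightarrow>
    (\<forall>J A. J \<subseteq> I \<longrightarrow> finite J \<longrightarrow> (\<forall>i\<in>J. A i \<in> sets borel) \<longrightarrow>
      (AE \<omega> in M. real_cond_exp M F (\<lambda>\<omega>. \<Prod>i\<in>J. indicator (A i) (X i \<omega>)) \<omega> =
                   (\<Prod>i\<in>J. real_cond_exp M F (\<lambda>\<omega>. indicator (A i) (X i \<omega>)) \<omega>)))"

definition conv_prob_const :: "(nat \<Rightarrow> 'a measure) \<Rightarrow> (nat \<Rightarrow> 'a \<Rightarrow> real) \<Rightarrow> real \<Rightarrow> bool" where
  "conv_prob_const M f c \<longleftrightarrow>
    (\<forall>e>0. (\<lambda>n. measure (M n) {\<omega> \<in> space (M n). \<bar>f n \<omega> - c\<bar> > e}) \<longlonglongrightarrow> 0)"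

definition pos_def :: "nat \<Rightarrow> (nat \<Rightarrow> nat \<Rightarrow> real) \<Rightarrow> bool" where
  "pos_def p S \<longleftrightarrow> (\<forall>j<p. \<forall>l<p. S j l = S l j) \<and>
     (\<forall>v. (\<exists>j<p. v j \<noteq> 0) \<longrightarrow> (\<Sum>j<p. \<Sum>l<p. v j * S j l * v l) > 0)"

definition lin_model :: "'a measure \<Rightarrow> nat \<Rightarrow> nat \<Rightarrow> ('a \<Rightarrow> nat \<Rightarrow> real) \<Rightarrow>
    ('a \<Rightarrow> nat \<Rightarrow> nat \<Rightarrow> real) \<Rightarrow> real \<Rightarrow> real \<Rightarrow> bool" where
  "lin_model M n p V Z \<sigma>2 Mb \<longleftrightarrow>
    (\<exists>\<beta> :: nat \<Rightarrow> real.
      let eps = (\<lambda>i \<omega>. V \<omega> i - (\<Sum>j<p. Z \<omega> i j * \<beta> j));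
          F = gen_sigma M (\<lambda>(i, j) \<omega>. Z \<omega> i j) ({..<n} \<times> {..<p})
      in (\<forall>i<n. integrable M (eps i) \<and> integrable M (\<lambda>\<omega>. (eps i \<omega>)\<^sup>2) \<and>
                integrable M (\<lambda>\<omega>. \<bar>eps i \<omega>\<bar> ^ 3) \<and>
                (AE \<omega> in M. real_cond_exp M F (eps i) \<omega> = 0) \<and>
                (AE \<omega> in M. real_cond_exp M F (\<lambda>\<omega>. (eps i \<omega>)\<^sup>2) \<omega> = \<sigma>2) \<and>
                (AE \<omega> in M. real_cond_exp M F (\<lambda>\<omega>. \<bar>eps i \<omega>\<bar> ^ 3) \<omega> < Mb)) \<and>
         cond_indep_vars M F eps {..<n})"

definition resid :: "nat \<Rightarrow> nat \<Rightarrow> (nat \<Rightarrow> nat \<Rightarrow> real) \<Rightarrow> (nat \<Rightarrow> real) \<Rightarrow> (nat \<Rightarrow> real)" where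
  "resid n p z w = (\<lambda>i. if i < n then w i - oproj n p z w i else 0)"

definition lyapunov_cond :: "(nat \<Rightarrow> 'a measure) \<Rightarrow> nat \<Rightarrow> (nat \<Rightarrow> 'a \<Rightarrow> nat \<Rightarrow> real) \<Rightarrow>
    (nat \<Rightarrow> 'a \<Rightarrow> nat \<Rightarrow> nat \<Rightarrow> real) \<Rightarrow> bool" where
  "lyapunov_cond M p W Z \<longleftrightarrow>
    ((\<lambda>n. (1 / sqrt (real n)) *
        (\<integral>\<omega>. (let R = resid n p (Z n \<omega>) (W n \<omega>) in
               if (\<forall>i<n. R i = 0) then 0
               else ((\<Sum>i<n. \<bar>R i\<bar> ^ 3) / real n) / ((\<Sum>i<n. (R i)\<^sup>2) / real n) powr (3 / 2))
          \<partial>M n)) \<longlonglongrightarrow> 0) \<and>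
    ((\<lambda>n. measure (M n) {\<omega> \<in> space (M n). \<forall>i<n. resid n p (Z n \<omega>) (W n \<omega>) i = 0}) \<longlonglongrightarrow> 0)"

end

theory Submission
  imports Defs "Jordan_Normal_Form.Determinant" "HOL-Real_Asymp.Real_Asymp"
begin

text \<open>By Frisch--Waugh--Lovell the t-statistic is a function of the residuals \<open>r\<close> and \<open>s\<close> of \<open>X\<close> and
  \<open>Y\<close> after regression on \<open>Z\<close>, and this function is symmetric, so it suffices to treat the case in which
  the response \<open>Y\<close> follows the linear model. Under the null hypothesis the errors \<open>\<epsilon>\<^sub>k\<close> have, given
  \<open>X\<close>, \<open>Z\<close> and \<open>\<epsilon>\<^sub>1, \<dots>, \<epsilon>\<^bsub>k-1\<^esub>\<close>, the same conditional moments as given \<open>Z\<close> alone: they are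
  martingale differences for a filtration that contains the whole of \<open>X\<close> and \<open>Z\<close> from the start. Hence
  \<open>r \<bullet> \<epsilon> / (\<sigma> |r|)\<close> is a sum of martingale differences with predictable weights and
  deterministic conditional variance, to which Lindeberg replacement and Levy's theorem apply; the
  Lyapunov condition bounds the error. The squared norm of \<open>s\<close> divided by \<open>n\<close> converges to \<open>\<sigma>\<^sup>2\<close> in
  probability, since the projection of \<open>\<epsilon>\<close> onto the columns of \<open>Z\<close> has second moment at most \<open>p \<sigma>\<^sup>2\<close>.\<close>

section \<open>Projections, Gram--Schmidt and the t-statistic\<close>

text \<open>The weights \<open>r i / |r|\<close> depend on all of \<open>X\<close> and
  \<open>Z\<close>, while the hypotheses speak only of conditional expectations given
  \<open>Z\<close>. Freezing \<open>(X, Z)\<close> and applying a classical central limit theorem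
  would need regular conditional distributions; putting \<open>X\<close> and \<open>Z\<close> into
  every sigma-algebra of the filtration makes the weights predictable instead, and only three
  conditional moments have to be carried over. Dividing by \<open>|r|\<close> makes the conditional
  variance constant off \<open>r = 0\<close>, so the Gaussian end of the replacement is
  \<open>exp (- t\<^sup>2 / 2)\<close> up to the probability of \<open>r = 0\<close>. The law of
  large numbers for the squared errors has to work without fourth moments, which explains its
  bounded test function. Studentisation is treated as a factor: the score equals the t-statistic
  times the ratio of estimated to true standard deviation, and this ratio is near 1 off an event of
  vanishing probability. Assumption (A1) enters through the openness of invertibility: it makes
  \<open>Z\<^sup>T Z\<close> nonsingular with probability tending to 1. Rank defects at finite
  \<open>n\<close> are absorbed by \<open>x / 0 = 0\<close>, so residuals and weights are defined
  and measurable for every outcome.\<close>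

definition ip :: "nat \<Rightarrow> (nat \<Rightarrow> real) \<Rightarrow> (nat \<Rightarrow> real) \<Rightarrow> real" where
  "ip n u v = (\<Sum>i<n. u i * v i)"

lemma ip_commute: "ip n u v = ip n v u"
  by (simp add: ip_def mult.commute)

lemma ip_cong: "(\<And>i. i < n \<Longrightarrow> u i = u' i) \<Longrightarrow> (\<And>i. i < n \<Longrightarrow> v i = v' i) \<Longrightarrow> ip n u v = ip n u' v'"
  by (simp add: ip_def)

lemma ip_diff_left: "ip n (\<lambda>i. u i - v i) w = ip n u w - ip n v w"
  by (simp add: ip_def left_diff_distrib sum_subtractf)

lemma ip_diff_right: "ip n w (\<lambda>i. u i - v i) = ip n w u - ip n w v"
  by (simp add: ip_def right_diff_distrib sum_subtractf)

lemma ip_sum_left: "ip n (\<lambda>i. \<Sum>j\<in>J. f j i) w = (\<Sum>j\<in>J. ip n (f j) w)"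
  by (simp add: ip_def sum_distrib_right) (rule sum.swap)

lemma ip_scale_left: "ip n (\<lambda>i. c * u i) w = c * ip n u w"
  by (simp add: ip_def sum_distrib_left mult.assoc)

lemma ip_comb_left: "ip n (\<lambda>i. \<Sum>j\<in>J. c j * f j i) w = (\<Sum>j\<in>J. c j * ip n (f j) w)"
  using ip_sum_left[of n "\<lambda>j i. c j * f j i" J w] by (simp add: ip_scale_left)

lemma ip_nonneg: "0 \<le> ip n u u"
  by (simp add: ip_def sum_nonneg)

lemma ip_eq_0_iff: "ip n u u = 0 \<longleftrightarrow> (\<forall>i<n. u i = 0)"
  by (auto simp: ip_def sum_nonneg_eq_0_iff)

section \<open>Determinants and invertibility of matrices given as functions\<close>

definition kdet :: "nat \<Rightarrow> (nat \<Rightarrow> nat \<Rightarrow> real) \<Rightarrow> real" where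
  "kdet k G = det (mat k k (\<lambda>(i, j). G i j))"

text \<open>The Leibniz expansion exhibits the determinant as a polynomial in the entries; this is
  what makes the event of a singular Gram matrix measurable.\<close>

lemma kdet_altdef:
  "kdet k G = (\<Sum>\<pi> \<in> {\<pi>. \<pi> permutes {0..<k}}. signof \<pi> * (\<Prod>i = 0..<k. G i (\<pi> i)))"
proof -
  have "\<pi> i < k" if "\<pi> permutes {0..<k}" "i < k" for \<pi> i
    using permutes_in_image[OF that(1), of i] that(2) by simp
  then show ?thesis 
    unfolding kdet_def det_def by (auto intro!: sum.cong arg_cong2[where f="(*)"] prod.cong)
qed

lemma kdet_eq_0_iff:
  "kdet k G = 0 \<longleftrightarrow> (\<exists>v. (\<exists>j<k. v j \<noteq> 0) \<and> (\<forall>i<k. (\<Sum>j<k. G i j * v j) = 0))"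
proof -
  let ?A = "mat k k (\<lambda>(i, j). G i j)"
  have mult: "(?A *\<^sub>v w) $ i = (\<Sum>j<k. G i j * w $ j)" if "i < k" "w \<in> carrier_vec k" for w i
    using that by (auto simp: scalar_prod_def atLeast0LessThan intro!: sum.cong)
  have A: "?A \<in> carrier_mat k k" by simp
  show ?thesis
    unfolding kdet_def det_0_iff_vec_prod_zero[OF A]
  proof safe
    fix w :: "real vec" assume w: "w \<in> carrier_vec k" "w \<noteq> 0\<^sub>v k" "?A *\<^sub>v w = 0\<^sub>v k"
    have "\<exists>j<k. w $ j \<noteq> 0" using w by (auto intro!: eq_vecI)
    moreover have "\<forall>i<k. (\<Sum>j<k. G i j * w $ j) = 0"
      using mult[OF _ w(1)] w(3) by (metis index_zero_vec(1))
    ultimately show "\<exists>v. (\<exists>j<k. v j \<noteq> 0) \<and> (\<forall>i<k. (\<Sum>j<k. G i j * v j) = 0)"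
      by (intro exI[of _ "\<lambda>j. w $ j"]) auto
  next
    fix v j assume v: "\<forall>i<k. (\<Sum>j<k. G i j * v j) = 0" and j: "j < k" "v j \<noteq> 0"
    let ?w = "vec k v"
    have "?A *\<^sub>v ?w = 0\<^sub>v k"
    proof (rule eq_vecI)
      fix i assume i: "i < dim_vec (0\<^sub>v k :: real vec)"
      have "(\<Sum>j<k. G i j * ?w $ j) = (\<Sum>j<k. G i j * v j)" by (rule sum.cong) auto
      then show "(?A *\<^sub>v ?w) $ i = 0\<^sub>v k $ i" using mult[of i ?w] v i by simp
    qed simp
    moreover have "?w \<noteq> 0\<^sub>v k" using j by (metis index_vec index_zero_vec(1))
    ultimately show "\<exists>v. v \<in> carrier_vec k \<and> v \<noteq> 0\<^sub>v k \<and> ?A *\<^sub>v v = 0\<^sub>v k"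
      by (intro exI[of _ ?w]) auto
  qed
qed

lemma invertible_k_iff_kdet: "invertible_k k G \<longleftrightarrow> kdet k G \<noteq> 0"
proof
  assume "invertible_k k G"
  then obtain H where H: "is_inverse k G H" by (auto simp: invertible_k_def)
  show "kdet k G \<noteq> 0"
  proof
    assume "kdet k G = 0"
    then obtain v j where v: "\<forall>i<k. (\<Sum>j<k. G i j * v j) = 0" and j: "j < k" "v j \<noteq> 0"
      by (auto simp: kdet_eq_0_iff)
    have "0 = (\<Sum>l<k. H j l * (\<Sum>i<k. G l i * v i))" using v by simp
    also have "\<dots> = (\<Sum>i<k. (\<Sum>l<k. H j l * G l i) * v i)"
      by (simp add: sum_distrib_left sum_distrib_right mult.assoc) (rule sum.swap)
    also have "\<dots> = (\<Sum>i<k. (if j = i then 1 else 0) * v i)"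
      using H j by (auto simp: is_inverse_def intro!: sum.cong)
    also have "\<dots> = (\<Sum>i<k. if j = i then v i else 0)" by (rule sum.cong) auto
    also have "\<dots> = v j" using j by simp
    finally show False using j by simp
  qed
next
  assume nz: "kdet k G \<noteq> 0"
  let ?A = "mat k k (\<lambda>(i, j). G i j)"
  have "?A \<in> Units (ring_mat TYPE(real) k ())"
    using nz by (intro det_non_zero_imp_unit) (auto simp: kdet_def)
  then obtain B where B: "B \<in> carrier_mat k k" "?A * B = 1\<^sub>m k" "B * ?A = 1\<^sub>m k"
    by (auto simp: Units_def ring_mat_def)
  \<comment> \<open>The padding by zero is forced by the last clause of \<open>is_inverse\<close>,
    which pins the inverse down as a function on all indices.\<close>
  let ?H = "\<lambda>i j. if i < k \<and> j < k then B $$ (i, j) else 0"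
  have *: "(\<Sum>l<k. G i l * ?H l j) = (if i = j then 1 else 0)"
    "(\<Sum>l<k. ?H i l * G l j) = (if i = j then 1 else 0)" if ij: "i < k" "j < k" for i j
  proof -
    have "(\<Sum>l<k. G i l * ?H l j) = (?A * B) $$ (i, j)"
      using ij B(1) by (auto simp: scalar_prod_def atLeast0LessThan intro!: sum.cong)
    then show "(\<Sum>l<k. G i l * ?H l j) = (if i = j then 1 else 0)" using B ij by simp
    have "(\<Sum>l<k. ?H i l * G l j) = (B * ?A) $$ (i, j)"
      using ij B(1) by (auto simp: scalar_prod_def atLeast0LessThan intro!: sum.cong)
    then show "(\<Sum>l<k. ?H i l * G l j) = (if i = j then 1 else 0)" using B ij by simp
  qed
  show "invertible_k k G"
    unfolding invertible_k_def is_inverse_def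
    using * by (intro exI[of _ ?H]) auto
qed

text \<open>\<open>H = H (G H') = (H G) H'\<close> inside the block, and both vanish outside; this
  justifies the \<open>THE\<close> in \<open>inv_k\<close>.\<close>

lemma is_inverse_unique:
  assumes "is_inverse k G H" "is_inverse k G H'"
  shows "H = H'"
proof (intro ext)
  fix i j
  show "H i j = H' i j"
  proof (cases "i < k \<and> j < k")
    case True
    have "H i j = (\<Sum>l<k. H i l * (if l = j then 1 else 0))"
      using True by (simp add: if_distrib cong: if_cong)
    also have "\<dots> = (\<Sum>l<k. H i l * (\<Sum>m<k. G l m * H' m j))"
      using assms(2) True by (auto simp: is_inverse_def intro!: sum.cong)
    also have "\<dots> = (\<Sum>m<k. (\<Sum>l<k. H i l * G l m) * H' m j)"
      by (simp add: sum_distrib_left sum_distrib_right mult.assoc) (rule sum.swap)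
    also have "\<dots> = (\<Sum>m<k. (if i = m then 1 else 0) * H' m j)"
      using assms(1) True by (auto simp: is_inverse_def intro!: sum.cong)
    also have "\<dots> = (\<Sum>m<k. if i = m then H' m j else 0)" by (rule sum.cong) auto
    also have "\<dots> = H' i j" using True by simp
    finally show ?thesis .
  next
    case False
    then show ?thesis using assms by (auto simp: is_inverse_def not_less)
  qed
qed

lemma is_inverse_inv_k:
  assumes "invertible_k k G"
  shows "is_inverse k G (inv_k k G)"
proof -
  obtain H where H: "is_inverse k G H" using assms by (auto simp: invertible_k_def)
  then have "inv_k k G = H" unfolding inv_k_def by (auto intro: is_inverse_unique)
  then show ?thesis using H by simp
qed

section \<open>Gram matrices and orthogonal projection\<close>

lemma sum_gram_mult: "(\<Sum>j<k. gram n A i j * v j) = ip n (\<lambda>r. A r i) (\<lambda>r. \<Sum>j<k. A r j * v j)"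
  by (simp add: gram_def ip_def sum_distrib_left sum_distrib_right mult.assoc) (rule sum.swap)

text \<open>The quadratic form of the Gram matrix at \<open>v\<close> is the squared norm of
  \<open>A v\<close>, so the Gram matrix and \<open>A\<close> have the same kernel.\<close>

lemma invertible_gram_iff:
  "invertible_k k (gram n A) \<longleftrightarrow> (\<forall>v. (\<forall>i<n. (\<Sum>j<k. A i j * v j) = 0) \<longrightarrow> (\<forall>j<k. v j = 0))"
proof -
  have "(\<forall>i<k. (\<Sum>j<k. gram n A i j * v j) = 0) \<longleftrightarrow> (\<forall>i<n. (\<Sum>j<k. A i j * v j) = 0)" for v
  proof
    assume *: "\<forall>i<k. (\<Sum>j<k. gram n A i j * v j) = 0"
    let ?w = "\<lambda>r. \<Sum>j<k. A r j * v j"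
    have "ip n ?w ?w = (\<Sum>j<k. v j * ip n (\<lambda>r. A r j) ?w)"
      using ip_comb_left[of n v "\<lambda>j r. A r j" "{..<k}" ?w] by (simp add: mult.commute)
    also have "\<dots> = 0" using * by (simp add: sum_gram_mult)
    finally show "\<forall>i<n. ?w i = 0" by (simp only: ip_eq_0_iff)
  next
    assume "\<forall>i<n. (\<Sum>j<k. A i j * v j) = 0"
    then show "\<forall>i<k. (\<Sum>j<k. gram n A i j * v j) = 0" by (simp add: sum_gram_mult ip_def)
  qed
  then show ?thesis unfolding invertible_k_iff_kdet kdet_eq_0_iff by blast
qed

text \<open>The difference of two candidates lies in the column space and is orthogonal to itself,
  hence zero on the first \<open>n\<close> indices; beyond them all members of
  \<open>colspace\<close> vanish, so the candidates agree as functions.\<close>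

lemma oproj_eqI:
  assumes w: "w \<in> colspace n k A" and orth: "\<And>u. u \<in> colspace n k A \<Longrightarrow> ip n (\<lambda>i. v i - w i) u = 0"
  shows "oproj n k A v = w"
  unfolding oproj_def
proof (rule the_equality)
  show "w \<in> colspace n k A \<and> (\<forall>u\<in>colspace n k A. (\<Sum>i<n. (v i - w i) * u i) = 0)"
    using w orth by (simp add: ip_def)
  fix w' assume w': "w' \<in> colspace n k A \<and> (\<forall>u\<in>colspace n k A. (\<Sum>i<n. (v i - w' i) * u i) = 0)"
  obtain c where c: "w = (\<lambda>i. if i < n then (\<Sum>j<k. A i j * c j) else 0)"
    using w by (auto simp: colspace_def)
  obtain c' where c': "w' = (\<lambda>i. if i < n then (\<Sum>j<k. A i j * c' j) else 0)"
    using w' by (auto simp: colspace_def)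
  define d where "d = (\<lambda>i. w i - w' i)"
  have "d = (\<lambda>i. if i < n then (\<Sum>j<k. A i j * (c j - c' j)) else 0)"
    by (auto simp: d_def c c' right_diff_distrib sum_subtractf)
  then have d: "d \<in> colspace n k A" by (auto simp: colspace_def)
  have "ip n d d = ip n (\<lambda>i. (v i - w' i) - (v i - w i)) d"
    by (rule ip_cong) (auto simp: d_def)
  also have "\<dots> = 0" using orth[OF d] w' d by (simp only: ip_diff_left) (simp add: ip_def left_diff_distrib sum_subtractf)
  finally have "\<forall>i<n. d i = 0" by (simp only: ip_eq_0_iff)
  then show "w' = w" by (auto simp: d_def c c' fun_eq_iff)
qed

text \<open>Gram--Schmidt without a full-rank hypothesis: on linearly dependent columns the residual
  vanishes and \<open>0 / 0 = 0\<close> makes the corresponding basis vector zero. Unlike the inverse Gram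
  matrix this yields the projection as a measurable function of the matrix for every rank.\<close>

declare sum.cong [fundef_cong]

fun gs :: "nat \<Rightarrow> (nat \<Rightarrow> nat \<Rightarrow> real) \<Rightarrow> nat \<Rightarrow> nat \<Rightarrow> real" where
  "gs n z j = (let e = (\<lambda>i. z i j - (\<Sum>m<j. ip n (\<lambda>i. z i j) (gs n z m) * gs n z m i))
               in (\<lambda>i. e i / sqrt (ip n e e)))"

declare gs.simps [simp del]

section \<open>Gram-Schmidt vectors, their span and the residual map\<close>

definition gs_res :: "nat \<Rightarrow> (nat \<Rightarrow> nat \<Rightarrow> real) \<Rightarrow> nat \<Rightarrow> nat \<Rightarrow> real" where
  "gs_res n z j = (\<lambda>i. z i j - (\<Sum>m<j. ip n (\<lambda>i. z i j) (gs n z m) * gs n z m i))"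

lemma gs_eq: "gs n z j i = gs_res n z j i / sqrt (ip n (gs_res n z j) (gs_res n z j))"
  by (subst gs.simps) (simp add: gs_res_def Let_def)

lemma ip_gs_left: "ip n (gs n z j) u = ip n (gs_res n z j) u / sqrt (ip n (gs_res n z j) (gs_res n z j))"
  unfolding ip_def[of n "gs n z j"] ip_def[of n _ u] by (simp add: gs_eq sum_divide_distrib)

lemma ip_gs_self: "ip n (gs n z j) (gs n z j) = (if ip n (gs_res n z j) (gs_res n z j) = 0 then 0 else 1)"
  unfolding ip_gs_left ip_commute[of n _ "gs n z j"]
  using ip_nonneg[of n "gs_res n z j"] by simp

text \<open>Strong induction on the larger index: the earlier vectors are already pairwise
  orthogonal, so only the contribution along \<open>gs n z l\<close> survives in the subtracted
  sum.\<close>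

lemma ip_gs_orth: "l < j \<Longrightarrow> ip n (gs n z j) (gs n z l) = 0"
proof (induction j arbitrary: l rule: less_induct)
  case (less j)
  have orth: "ip n (gs n z m) (gs n z l) = 0" if "m < j" "m \<noteq> l" for m
    
    using less.IH[of m l] less.IH[of l m] less.prems that ip_commute[of n "gs n z m" "gs n z l"]
    by (cases "m < l") auto
  let ?c = "\<lambda>m. ip n (\<lambda>i. z i j) (gs n z m)"
  have "ip n (gs_res n z j) (gs n z l) = ?c l - (\<Sum>m<j. ?c m * ip n (gs n z m) (gs n z l))"
    unfolding gs_res_def by (simp add: ip_diff_left ip_comb_left)
  also have "(\<Sum>m<j. ?c m * ip n (gs n z m) (gs n z l)) = (\<Sum>m\<in>{l}. ?c m * ip n (gs n z m) (gs n z l))"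
    by (rule sum.mono_neutral_right) (use less.prems orth in auto)
  also have "?c l - \<dots> = 0"
  \<comment> \<open>A basis vector is a unit vector or zero; in the second case \<open>?c l\<close>
    is zero as well, so the cancellation survives linear dependence.\<close>
  proof (cases "ip n (gs n z l) (gs n z l) = 0")
    case True
    then have "?c l = 0" unfolding ip_eq_0_iff by (simp add: ip_def)
    then show ?thesis by simp
  next
    case False
    then have "ip n (gs n z l) (gs n z l) = 1" using ip_gs_self[of n z l] by presburger
    then show ?thesis by simp
  qed
  finally show ?case unfolding ip_gs_left by simp
qed

lemma ip_gs: "l \<noteq> j \<Longrightarrow> ip n (gs n z j) (gs n z l) = 0"
  using ip_gs_orth[of l j n z] ip_gs_orth[of j l n z] ip_commute[of n "gs n z j" "gs n z l"]
  by (cases "l < j") auto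

lemma ip_gs_le_1: "ip n (gs n z j) (gs n z j) \<le> 1"
  by (simp add: ip_gs_self)

lemma gs_res_eq_gs: "i < n \<Longrightarrow> gs_res n z j i = sqrt (ip n (gs_res n z j) (gs_res n z j)) * gs n z j i"
  using ip_eq_0_iff[of n "gs_res n z j"] by (auto simp: gs_eq)

lemma gs_in_span: "\<exists>c. \<forall>i<n. gs n z j i = (\<Sum>l\<le>j. z i l * c l)"
proof (induction j rule: less_induct)
  case (less j)
  then have "\<forall>m. \<exists>c. m < j \<longrightarrow> (\<forall>i<n. gs n z m i = (\<Sum>l\<le>m. z i l * c l))" by blast
  then obtain c where c: "\<And>m i. m < j \<Longrightarrow> i < n \<Longrightarrow> gs n z m i = (\<Sum>l\<le>m. z i l * c m l)"
    by metis
  \<comment> \<open>Padding the triangular coefficients with zeros gives all sums the common range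
    \<open>l < j\<close>, so that the summations can be exchanged.\<close>
  define d where "d = (\<lambda>m l. if l \<le> m then c m l else 0)"
  have d: "gs n z m i = (\<Sum>l<j. z i l * d m l)" if "m < j" "i < n" for m i
    unfolding c[OF that] using that by (intro sum.mono_neutral_cong_left) (auto simp: d_def)
  let ?c = "\<lambda>m. ip n (\<lambda>i. z i j) (gs n z m)"
  let ?s = "sqrt (ip n (gs_res n z j) (gs_res n z j))"
  let ?e = "\<lambda>l. if l = j then 1 / ?s else - (\<Sum>m<j. ?c m * d m l) / ?s"
  have "gs n z j i = (\<Sum>l\<le>j. z i l * ?e l)" if i: "i < n" for i
  proof -
    have "gs_res n z j i = z i j - (\<Sum>m<j. ?c m * (\<Sum>l<j. z i l * d m l))"
      unfolding gs_res_def using d i by (auto intro!: sum.cong)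
    also have "(\<Sum>m<j. ?c m * (\<Sum>l<j. z i l * d m l)) = (\<Sum>l<j. z i l * (\<Sum>m<j. ?c m * d m l))"
      by (simp add: sum_distrib_left mult_ac) (rule sum.swap)
    finally have "gs n z j i = (z i j - (\<Sum>l<j. z i l * (\<Sum>m<j. ?c m * d m l))) / ?s"
      by (simp add: gs_eq)
    moreover have "(\<Sum>l\<le>j. z i l * ?e l) = z i j / ?s + (\<Sum>l<j. z i l * ?e l)"
      by (simp add: lessThan_Suc_atMost[symmetric])
    moreover have "(\<Sum>l<j. z i l * ?e l) = - (\<Sum>l<j. z i l * (\<Sum>m<j. ?c m * d m l)) / ?s"
    proof -
      have "(\<Sum>l<j. z i l * ?e l) = (\<Sum>l<j. - (z i l * (\<Sum>m<j. ?c m * d m l) / ?s))"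
        by (rule sum.cong) auto
      also have "\<dots> = - (\<Sum>l<j. z i l * (\<Sum>m<j. ?c m * d m l)) / ?s"
        by (simp add: sum_negf sum_divide_distrib)
      finally show ?thesis .
    qed
    ultimately show ?thesis by (simp add: diff_divide_distrib)
  qed
  then show ?case by (intro exI[of _ ?e]) auto
qed

text \<open>This is \<open>v\<close> minus its orthogonal projection, by
  \<open>oproj_eq_pres\<close>. Written through \<open>gs\<close> it needs no inverse and stays
  measurable when columns are dependent.\<close>

definition pres :: "nat \<Rightarrow> nat \<Rightarrow> (nat \<Rightarrow> nat \<Rightarrow> real) \<Rightarrow> (nat \<Rightarrow> real) \<Rightarrow> nat \<Rightarrow> real" where
  "pres n k z v = (\<lambda>i. v i - (\<Sum>m<k. ip n v (gs n z m) * gs n z m i))"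

lemma ip_pres_gs: "m < k \<Longrightarrow> ip n (pres n k z v) (gs n z m) = 0"
proof -
  assume m: "m < k"
  have "ip n (pres n k z v) (gs n z m) = ip n v (gs n z m) - (\<Sum>l<k. ip n v (gs n z l) * ip n (gs n z l) (gs n z m))"
    unfolding pres_def by (simp add: ip_diff_left ip_comb_left)
  also have "(\<Sum>l<k. ip n v (gs n z l) * ip n (gs n z l) (gs n z m)) = (\<Sum>l\<in>{m}. ip n v (gs n z l) * ip n (gs n z l) (gs n z m))"
    by (rule sum.mono_neutral_right) (use m in \<open>auto simp: ip_gs\<close>)
  also have "ip n v (gs n z m) - \<dots> = 0"
  proof (cases "ip n (gs n z m) (gs n z m) = 0")
    case True
    then have "ip n v (gs n z m) = 0" unfolding ip_eq_0_iff by (simp add: ip_def)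
    then show ?thesis by simp
  next
    case False
    then have "ip n (gs n z m) (gs n z m) = 1" using ip_gs_self[of n z m] by presburger
    then show ?thesis by simp
  qed
  finally show ?thesis .
qed

text \<open>The earlier basis vectors are orthogonal to \<open>gs n z j\<close>, so the coefficient
  of column \<open>j\<close> along it is the norm of \<open>gs_res\<close>, exactly what the
  normalisation divided out.\<close>

lemma column_in_gs_span: "i < n \<Longrightarrow> z i j = (\<Sum>m\<le>j. ip n (\<lambda>i. z i j) (gs n z m) * gs n z m i)"
proof -
  assume i: "i < n"
  have res: "ip n (\<lambda>i. z i j) (gs n z j) = ip n (gs_res n z j) (gs n z j)"
    unfolding gs_res_def by (simp add: ip_diff_left ip_comb_left ip_gs)
  also have "\<dots> = sqrt (ip n (gs_res n z j) (gs_res n z j))"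
    unfolding ip_commute[of n "gs_res n z j" "gs n z j"] ip_gs_left
    by (simp add: ip_nonneg real_div_sqrt)
  finally have "gs_res n z j i = ip n (\<lambda>i. z i j) (gs n z j) * gs n z j i"
    using gs_res_eq_gs[OF i] by simp
  then have "z i j = (\<Sum>m<j. ip n (\<lambda>i. z i j) (gs n z m) * gs n z m i) + ip n (\<lambda>i. z i j) (gs n z j) * gs n z j i"
    unfolding gs_res_def by simp
  then show ?thesis by (simp add: lessThan_Suc_atMost[symmetric])
qed

lemma ip_pres_column: "j < k \<Longrightarrow> ip n (pres n k z v) (\<lambda>i. z i j) = 0"
proof -
  assume j: "j < k"
  have "ip n (\<lambda>i. z i j) (pres n k z v) = ip n (\<lambda>i. \<Sum>m\<le>j. ip n (\<lambda>i. z i j) (gs n z m) * gs n z m i) (pres n k z v)"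
    by (rule ip_cong[OF column_in_gs_span]) auto
  also have "\<dots> = 0"
    unfolding ip_comb_left using j by (intro sum.neutral) (auto simp: ip_commute[of n "gs n z _"] ip_pres_gs)
  finally show ?thesis by (simp add: ip_commute)
qed

lemma pres_decomp: "\<exists>c. \<forall>i<n. pres n k z v i = v i - (\<Sum>j<k. z i j * c j)"
proof -
  obtain c where c: "\<And>m i. i < n \<Longrightarrow> gs n z m i = (\<Sum>l\<le>m. z i l * c m l)"
    using gs_in_span[of n z] by metis
  define d where "d = (\<lambda>m l. if l \<le> m then c m l else 0)"
  have d: "gs n z m i = (\<Sum>l<k. z i l * d m l)" if "m < k" "i < n" for m i
    unfolding c[OF that(2)] using that by (intro sum.mono_neutral_cong_left) (auto simp: d_def)
  have "pres n k z v i = v i - (\<Sum>l<k. z i l * (\<Sum>m<k. ip n v (gs n z m) * d m l))" if i: "i < n" for i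
  proof -
    have "pres n k z v i = v i - (\<Sum>m<k. ip n v (gs n z m) * (\<Sum>l<k. z i l * d m l))"
      unfolding pres_def using d i by (auto intro!: sum.cong)
    also have "(\<Sum>m<k. ip n v (gs n z m) * (\<Sum>l<k. z i l * d m l)) = (\<Sum>l<k. z i l * (\<Sum>m<k. ip n v (gs n z m) * d m l))"
      by (simp add: sum_distrib_left mult_ac) (rule sum.swap)
    finally show ?thesis .
  qed
  then show ?thesis by (intro exI[of _ "\<lambda>l. \<Sum>m<k. ip n v (gs n z m) * d m l"]) auto
qed

lemma ip_comb_right: "ip n w (\<lambda>i. \<Sum>j\<in>J. f j i * c j) = (\<Sum>j\<in>J. c j * ip n w (f j))"
  using ip_comb_left[of n c f J w] by (simp only: ip_commute[of n w] mult.commute[of _ "c _"])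

text \<open>\<open>pres\<close> differs from \<open>v\<close> by a combination of columns and is
  orthogonal to every column, which characterises the projection at every rank.\<close>

lemma oproj_eq_pres: "i < n \<Longrightarrow> v i - oproj n k z v i = pres n k z v i"
proof -
  assume i: "i < n"
  obtain c where c: "\<And>i. i < n \<Longrightarrow> pres n k z v i = v i - (\<Sum>j<k. z i j * c j)"
    using pres_decomp by blast
  let ?w = "\<lambda>i. if i < n then (\<Sum>j<k. z i j * c j) else 0"
  have "oproj n k z v = ?w"
  proof (rule oproj_eqI)
    show "?w \<in> colspace n k z" by (auto simp: colspace_def)
    fix u assume "u \<in> colspace n k z"
    then obtain b where b: "u = (\<lambda>i. if i < n then (\<Sum>j<k. z i j * b j) else 0)"
      by (auto simp: colspace_def)
    have "ip n (\<lambda>i. v i - ?w i) u = ip n (pres n k z v) (\<lambda>i. \<Sum>j<k. z i j * b j)"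
      by (rule ip_cong) (auto simp: c b)
    also have "\<dots> = 0" unfolding ip_comb_right by (simp add: ip_pres_column)
    finally show "ip n (\<lambda>i. v i - ?w i) u = 0" .
  qed
  then show ?thesis using i c by simp
qed

lemma resid_eq_pres: "resid n p z w i = (if i < n then pres n p z w i else 0)"
  by (simp add: resid_def oproj_eq_pres)

text \<open>Projection fixes every combination of columns. Hence the response and its errors have
  the same residuals, and the unknown coefficients of the model drop out of the statistic.\<close>

lemma pres_diff_column_comb:
  assumes "\<And>i. i < n \<Longrightarrow> e i = v i - (\<Sum>j<k. z i j * b j)" and "i < n"
  shows "pres n k z v i = pres n k z e i"
proof -
  let ?s = "\<lambda>i. (\<Sum>j<k. z i j * b j)"
  have *: "ip n e (gs n z m) = ip n v (gs n z m) - ip n ?s (gs n z m)" for m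
    by (subst ip_diff_left[symmetric]) (rule ip_cong, auto simp: assms(1))
  have "?s i = (\<Sum>m<k. ip n ?s (gs n z m) * gs n z m i)"
  proof -
    have col: "z i j = (\<Sum>m<k. ip n (\<lambda>i. z i j) (gs n z m) * gs n z m i)" if j: "j < k" for j
    proof -
      have "ip n (\<lambda>i. z i j) (gs n z m) = 0" if "j < m" for m
      proof -
        have "ip n (\<lambda>i. z i j) (gs n z m) = ip n (\<lambda>i. \<Sum>l\<le>j. ip n (\<lambda>i. z i j) (gs n z l) * gs n z l i) (gs n z m)"
          by (rule ip_cong[OF column_in_gs_span]) auto
        also have "\<dots> = 0" unfolding ip_comb_left using that by (intro sum.neutral) (auto simp: ip_gs)
        finally show ?thesis .
      qed
      then have "(\<Sum>m\<le>j. ip n (\<lambda>i. z i j) (gs n z m) * gs n z m i) = (\<Sum>m<k. ip n (\<lambda>i. z i j) (gs n z m) * gs n z m i)"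
        using j by (intro sum.mono_neutral_left) auto
      then show ?thesis using column_in_gs_span[OF assms(2), of z j] by simp
    qed
    have "?s i = (\<Sum>j<k. (\<Sum>m<k. ip n (\<lambda>i. z i j) (gs n z m) * gs n z m i) * b j)"
      by (rule sum.cong) (auto simp: col[symmetric])
    also have "\<dots> = (\<Sum>m<k. (\<Sum>j<k. b j * ip n (\<lambda>i. z i j) (gs n z m)) * gs n z m i)"
      by (simp add: sum_distrib_left sum_distrib_right mult_ac) (rule sum.swap)
    also have "\<dots> = (\<Sum>m<k. ip n ?s (gs n z m) * gs n z m i)"
      using ip_comb_left[of n b "\<lambda>j i. z i j" "{..<k}"] by (simp add: mult.commute)
    finally show ?thesis .
  qed
  then show ?thesis
    by (simp add: pres_def * assms left_diff_distrib sum_subtractf)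
qed

text \<open>A residual is orthogonal to every fitted vector. In the limit argument this replaces the
  residuals of the response by the errors themselves in the numerator.\<close>

lemma ip_pres_pres: "ip n (pres n k z u) (pres n k z v) = ip n (pres n k z u) v"
proof -
  have "ip n (pres n k z v) (pres n k z u) = ip n v (pres n k z u)
    - (\<Sum>m<k. ip n v (gs n z m) * ip n (gs n z m) (pres n k z u))"
    by (subst (1) pres_def) (simp add: ip_diff_left ip_comb_left)
  also have "(\<Sum>m<k. ip n v (gs n z m) * ip n (gs n z m) (pres n k z u)) = 0"
    by (intro sum.neutral) (auto simp: ip_commute[of n "gs n z _"] ip_pres_gs)
  finally show ?thesis by (simp add: ip_commute)
qed

text \<open>Pythagoras: the nonzero \<open>gs\<close> vectors are orthonormal and the zero ones
  contribute zero coefficients.\<close>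

lemma ip_pres_self: "ip n (pres n k z v) (pres n k z v) = ip n v v - (\<Sum>m<k. (ip n v (gs n z m))\<^sup>2)"
  unfolding ip_pres_pres
  by (simp add: pres_def ip_diff_left ip_comb_left ip_commute[of n "gs n z _"] power2_eq_square)

section \<open>The design matrix and the t-statistic\<close>

lemma sum_design: "(\<Sum>j<p+1. design x z i j * v j) = x i * v 0 + (\<Sum>j<p. z i j * v (Suc j))"
  by (simp add: sum.lessThan_Suc_shift design_def del: sum.lessThan_Suc)

text \<open>The residual of \<open>x\<close> is a combination of the columns with coefficient 1 on
  \<open>x\<close>: if it vanishes it is a linear relation, and if not, pairing any relation with it
  isolates the coefficient of \<open>x\<close>.\<close>

lemma invertible_design_iff:
  "invertible_k (p + 1) (gram n (design x z)) \<longleftrightarrow>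
     invertible_k p (gram n z) \<and> ip n (pres n p z x) (pres n p z x) \<noteq> 0"
proof -
  let ?r = "pres n p z x"
  obtain c where c: "\<And>i. i < n \<Longrightarrow> ?r i = x i - (\<Sum>j<p. z i j * c j)"
    using pres_decomp by blast
  show ?thesis
  proof safe
    assume inv: "invertible_k (p + 1) (gram n (design x z))"
    show "invertible_k p (gram n z)"
      unfolding invertible_gram_iff
    proof (intro allI impI)
      fix v j assume v: "\<forall>i<n. (\<Sum>j<p. z i j * v j) = 0" and j: "j < p"
      let ?v = "\<lambda>j. if j = 0 then 0 else v (j - 1)"
      have *: "\<forall>i<n. (\<Sum>j<p+1. design x z i j * ?v j) = 0" unfolding sum_design using v by simp
      have "\<forall>j<p+1. ?v j = 0"
        by (rule mp[OF spec[OF inv[unfolded invertible_gram_iff], of ?v] *])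
      then have "?v (Suc j) = 0" using j by (metis Suc_eq_plus1 Suc_less_eq)
      then show "v j = 0" by simp
    qed
    assume "ip n ?r ?r = 0"
    then have r: "\<forall>i<n. ?r i = 0" by (simp only: ip_eq_0_iff)
    let ?v = "\<lambda>j. if j = 0 then 1 else - c (j - 1)"
    have *: "\<forall>i<n. (\<Sum>j<p+1. design x z i j * ?v j) = 0"
      unfolding sum_design using r c by (simp add: sum_negf)
    have "\<forall>j<p+1. ?v j = 0"
      by (rule mp[OF spec[OF inv[unfolded invertible_gram_iff], of ?v] *])
    then show False by (auto dest!: spec[of _ 0])
  next
    assume inv: "invertible_k p (gram n z)" and r: "ip n ?r ?r \<noteq> 0"
    show "invertible_k (p + 1) (gram n (design x z))"
      unfolding invertible_gram_iff
    proof (intro allI impI)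
      fix v j assume v: "\<forall>i<n. (\<Sum>j<p+1. design x z i j * v j) = 0" and j: "j < p + 1"
      have "0 = ip n ?r (\<lambda>i. x i * v 0 + (\<Sum>j<p. z i j * v (Suc j)))"
        using v unfolding sum_design by (simp add: ip_def)
      also have "\<dots> = v 0 * ip n ?r x + ip n ?r (\<lambda>i. \<Sum>j<p. z i j * v (Suc j))"
        by (simp add: ip_def distrib_left sum.distrib sum_distrib_left mult_ac)
      also have "\<dots> = v 0 * ip n ?r ?r"
        unfolding ip_comb_right by (simp add: ip_pres_column ip_pres_pres)
      finally have v0: "v 0 = 0" using r by simp
      then have *: "\<forall>i<n. (\<Sum>j<p. z i j * v (Suc j)) = 0" using v unfolding sum_design by simp
      have "\<forall>j<p. v (Suc j) = 0"
        by (rule mp[OF spec[OF inv[unfolded invertible_gram_iff], of "\<lambda>j. v (Suc j)"] *])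
      then show "v j = 0" using v0 j by (cases j) auto
    qed
  qed
qed

text \<open>For nonzero \<open>u\<close> and \<open>v\<close> with cosine \<open>\<rho>\<close> of
  their angle this is \<open>sqrt (n - p - 1) * \<rho> / sqrt (1 - \<rho>\<^sup>2)\<close>; for
  residuals, \<open>\<rho>\<close> is the uncentred sample partial correlation.\<close>

definition t_stat :: "nat \<Rightarrow> nat \<Rightarrow> (nat \<Rightarrow> real) \<Rightarrow> (nat \<Rightarrow> real) \<Rightarrow> real" where
  "t_stat n p u v = sqrt (real n - real p - 1) * ip n u v / sqrt (ip n u u * ip n v v - (ip n u v)\<^sup>2)"

lemma t_stat_commute: "t_stat n p u v = t_stat n p v u"
  by (simp add: t_stat_def ip_commute[of n v u] mult.commute)

text \<open>Frisch--Waugh--Lovell. The right-hand side is symmetric in \<open>x\<close> and \<open>y\<close>, so the two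
  alternative model assumptions of the theorem need only one proof.\<close>

lemma T_OLS_eq_t_stat:
  "T_OLS n p y x z =
    (if invertible_k p (gram n z) then t_stat n p (pres n p z x) (pres n p z y) else 0)"
proof (cases "invertible_k (p + 1) (gram n (design x z))")
  case False
  \<comment> \<open>\<open>T_OLS\<close> is 0 for a singular design. If \<open>z\<close> has full
    rank, the singularity comes from a zero residual of \<open>x\<close>, and then the numerator of
    \<open>t_stat\<close> is 0 too.\<close>
  have "t_stat n p (pres n p z x) (pres n p z y) = 0" if "invertible_k p (gram n z)"
  proof -
    have "ip n (pres n p z x) (pres n p z x) = 0"
      using False that unfolding invertible_design_iff by blast
    then have "ip n (pres n p z x) (pres n p z y) = 0" unfolding ip_eq_0_iff by (simp add: ip_def)
    then show ?thesis by (simp add: t_stat_def)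
  qed
  then show ?thesis using False by (simp add: T_OLS_def Let_def)
next
  case True
  let ?r = "pres n p z x" and ?s = "pres n p z y" and ?D = "design x z"
  let ?G = "gram n ?D"
  have invz: "invertible_k p (gram n z)" and rr: "ip n ?r ?r \<noteq> 0"
    using True unfolding invertible_design_iff by auto
  obtain c where c: "\<And>i. i < n \<Longrightarrow> ?r i = x i - (\<Sum>j<p. z i j * c j)"
    using pres_decomp by blast
  define v where "v = (\<lambda>j. if j = 0 then 1 else - c (j - 1))"
  have rv: "?r i = (\<Sum>j<p+1. ?D i j * v j)" if "i < n" for i
    unfolding sum_design using c[OF that] by (simp add: v_def sum_negf)
  \<comment> \<open>The residual \<open>?r\<close>, the design applied to \<open>v\<close>, is
    orthogonal to the columns of \<open>z\<close>, so the Gram matrix sends \<open>v\<close> to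
    \<open>|r|\<^sup>2\<close> times the first unit vector; by symmetry, row 0 of the inverse is
    \<open>v / |r|\<^sup>2\<close>.\<close>
  have Gv: "(\<Sum>j<p+1. ?G i j * v j) = (if i = 0 then ip n ?r ?r else 0)" if "i < p + 1" for i
  proof -
    have "(\<Sum>j<p+1. ?G i j * v j) = ip n (\<lambda>m. ?D m i) ?r"
      unfolding sum_gram_mult by (rule ip_cong) (auto simp: rv)
    also have "\<dots> = (if i = 0 then ip n ?r ?r else 0)"
      using that ip_pres_column[of "i - 1" p n z x]
      by (auto simp: design_def ip_pres_pres ip_commute)
    finally show ?thesis .
  qed
  define H where "H = inv_k (p + 1) ?G"
  have H: "is_inverse (p + 1) ?G H" unfolding H_def by (rule is_inverse_inv_k[OF True])
  have Gsym: "?G i j = ?G j i" for i j by (simp add: gram_def mult.commute)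
  have H0: "H 0 l = v l / ip n ?r ?r" if l: "l < p + 1" for l
  proof -
    have "v l = (\<Sum>j<p+1. v j * (if j = l then 1 else 0))"
      using l by (simp add: if_distrib cong: if_cong)
    also have "\<dots> = (\<Sum>j<p+1. v j * (\<Sum>m<p+1. ?G j m * H m l))"
      using H l unfolding is_inverse_def by (intro sum.cong) auto
    also have "\<dots> = (\<Sum>m<p+1. (\<Sum>j<p+1. ?G m j * v j) * H m l)"
      unfolding sum_distrib_left sum_distrib_right
      by (subst sum.swap) (simp add: Gsym mult_ac)
    also have "\<dots> = (\<Sum>m<p+1. (if m = 0 then ip n ?r ?r * H m l else 0))"
    proof (rule sum.cong)
      fix m assume "m \<in> {..<p + 1}"
      then have "m < p + 1" by simp
      then show "(\<Sum>j<p+1. ?G m j * v j) * H m l = (if m = 0 then ip n ?r ?r * H m l else 0)"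
        unfolding Gv[OF \<open>m < p + 1\<close>] by simp
    qed simp
    also have "\<dots> = ip n ?r ?r * H 0 l" by simp
    finally show ?thesis using rr by simp
  qed
  have H00: "H 0 0 = 1 / ip n ?r ?r" using H0[of 0] by (simp add: v_def)
  have theta: "(\<Sum>l<p+1. H 0 l * (\<Sum>i<n. ?D i l * y i)) = ip n ?r ?s / ip n ?r ?r"
  proof -
    have "(\<Sum>l<p+1. H 0 l * (\<Sum>i<n. ?D i l * y i)) = (\<Sum>l<p+1. v l * ip n (\<lambda>i. ?D i l) y) / ip n ?r ?r"
      by (simp add: H0 ip_def sum_divide_distrib del: sum.lessThan_Suc)
    also have "(\<Sum>l<p+1. v l * ip n (\<lambda>i. ?D i l) y) = ip n (\<lambda>i. \<Sum>l<p+1. v l * ?D i l) y"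
      by (rule ip_comb_left[symmetric])
    also have "\<dots> = ip n ?r y" by (rule ip_cong) (auto simp: rv mult.commute simp del: sum.lessThan_Suc)
    finally show ?thesis by (simp add: ip_pres_pres)
  qed
  \<comment> \<open>The coefficient found in \<open>theta\<close>; regressing \<open>?s\<close> on
    \<open>?r\<close> alone yields the residuals of the full regression.\<close>
  define t where "t = ip n ?r ?s / ip n ?r ?r"
  have res: "y i - oproj n (p + 1) ?D y i = ?s i - t * ?r i" if i: "i < n" for i
  proof -
    obtain d where d: "\<And>i. i < n \<Longrightarrow> ?s i = y i - (\<Sum>j<p. z i j * d j)"
      using pres_decomp by blast
    let ?w = "\<lambda>i. if i < n then y i - (?s i - t * ?r i) else 0"
    have "oproj n (p + 1) ?D y = ?w"
    proof (rule oproj_eqI)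
      have "?w i = (if i < n then (\<Sum>j<p+1. ?D i j * (if j = 0 then t else d (j - 1) - t * c (j - 1))) else 0)" for i
      proof -
        have "(\<Sum>j<p. z i j * (d j - t * c j)) = (\<Sum>j<p. z i j * d j) - t * (\<Sum>j<p. z i j * c j)"
          by (simp add: right_diff_distrib sum_subtractf sum_distrib_left mult.left_commute)
        then show ?thesis unfolding sum_design by (simp add: c d right_diff_distrib mult.commute)
      qed
      then show "?w \<in> colspace n (p + 1) ?D"
        unfolding colspace_def mem_Collect_eq
        by (intro exI[of _ "\<lambda>j. if j = 0 then t else d (j - 1) - t * c (j - 1)"] conjI ext TrueI)
    next
      fix u assume "u \<in> colspace n (p + 1) ?D"
      then obtain b where b: "u = (\<lambda>i. if i < n then (\<Sum>j<p+1. ?D i j * b j) else 0)"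
        unfolding colspace_def by fast
      have "ip n (\<lambda>i. y i - ?w i) u = ip n (\<lambda>i. ?s i - t * ?r i) (\<lambda>i. \<Sum>j<p+1. ?D i j * b j)"
        by (rule ip_cong) (auto simp: b)
      also have "\<dots> = (\<Sum>j<p+1. b j * ip n (\<lambda>i. ?s i - t * ?r i) (\<lambda>i. ?D i j))"
        by (rule ip_comb_right)
      also have "\<dots> = 0"
      proof (intro sum.neutral ballI)
        fix j assume j: "j \<in> {..<p+1}"
        have "ip n (\<lambda>i. ?s i - t * ?r i) (\<lambda>i. ?D i j) = ip n ?s (\<lambda>i. ?D i j) - t * ip n ?r (\<lambda>i. ?D i j)"
          by (simp add: ip_diff_left ip_scale_left)
        also have "\<dots> = 0"
        proof (cases "j = 0")
          case True
          have "ip n ?s x = ip n ?r ?s" "ip n ?r x = ip n ?r ?r"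
            using ip_pres_pres[of n p z y x] ip_pres_pres[of n p z x x] by (auto simp: ip_commute)
          then show ?thesis using True rr by (simp add: design_def t_def)
        next
          case False
          then show ?thesis using j by (simp add: design_def ip_pres_column)
        qed
        finally show "b j * ip n (\<lambda>i. ?s i - t * ?r i) (\<lambda>i. ?D i j) = 0" by simp
      qed
      finally show "ip n (\<lambda>i. y i - ?w i) u = 0" .
    qed
    then show ?thesis using i by simp
  qed
  have s2: "(\<Sum>i<n. (y i - oproj n (p + 1) ?D y i)\<^sup>2) = (ip n ?r ?r * ip n ?s ?s - (ip n ?r ?s)\<^sup>2) / ip n ?r ?r"
  proof -
    have "(\<Sum>i<n. (y i - oproj n (p + 1) ?D y i)\<^sup>2) = ip n (\<lambda>i. ?s i - t * ?r i) (\<lambda>i. ?s i - t * ?r i)"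
      unfolding ip_def power2_eq_square by (rule sum.cong) (simp_all only: res lessThan_iff)
    also have "\<dots> = ip n ?s ?s - 2 * t * ip n ?r ?s + t\<^sup>2 * ip n ?r ?r"
      unfolding ip_diff_left ip_diff_right ip_scale_left ip_commute[of n _ "\<lambda>i. t * ?r i"]
      by (simp add: ip_commute[of n ?s ?r] power2_eq_square algebra_simps)
    also have "\<dots> = (ip n ?r ?r * ip n ?s ?s - (ip n ?r ?s)\<^sup>2) / ip n ?r ?r"
      using rr by (simp add: t_def field_simps power2_eq_square)
    finally show ?thesis .
  qed
  let ?\<Delta> = "ip n ?r ?r * ip n ?s ?s - (ip n ?r ?s)\<^sup>2"
  have "T_OLS n p y x z = (ip n ?r ?s / ip n ?r ?r) / sqrt (1 / ip n ?r ?r * (?\<Delta> / ip n ?r ?r / (real n - real p - 1)))"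
    using True unfolding T_OLS_def Let_def H_def[symmetric] by (simp only: if_True theta s2 H00)
  also have "1 / ip n ?r ?r * (?\<Delta> / ip n ?r ?r / (real n - real p - 1)) = ?\<Delta> / ((ip n ?r ?r)\<^sup>2 * (real n - real p - 1))"
    by (simp add: power2_eq_square)
  also have "sqrt \<dots> = sqrt ?\<Delta> / (ip n ?r ?r * sqrt (real n - real p - 1))"
    using ip_nonneg[of n ?r] by (simp add: real_sqrt_divide real_sqrt_mult)
  also have "(ip n ?r ?s / ip n ?r ?r) / \<dots> = t_stat n p ?r ?s"
    using rr by (simp add: t_stat_def mult.commute)
  finally show ?thesis using invz by simp
qed

text \<open>If \<open>A v = 0\<close> then \<open>v = H (S - A) v\<close> with \<open>H\<close> the
  inverse of \<open>S\<close>; for \<open>A\<close> close to \<open>S\<close> the largest entry of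
  \<open>v\<close> would be at most half of itself in modulus.\<close>

lemma pos_def_perturb:
  assumes "pos_def p S"
  shows "\<exists>\<delta>>0. \<forall>A. (\<forall>i<p. \<forall>j<p. \<bar>A i j - S i j\<bar> \<le> \<delta>) \<longrightarrow> invertible_k p A"
proof -
  have "kdet p S \<noteq> 0"
  proof
    assume "kdet p S = 0"
    then obtain v where v: "\<exists>j<p. v j \<noteq> 0" "\<forall>i<p. (\<Sum>j<p. S i j * v j) = 0"
      by (auto simp: kdet_eq_0_iff)
    have "(\<Sum>j<p. \<Sum>l<p. v j * S j l * v l) = (\<Sum>j<p. v j * (\<Sum>l<p. S j l * v l))"
      by (simp add: sum_distrib_left mult.assoc)
    also have "\<dots> = 0" using v(2) by simp
    finally show False using assms v(1) unfolding pos_def_def by fastforce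
  qed
  then obtain H where H: "is_inverse p S H" using invertible_k_iff_kdet invertible_k_def by blast
  define C where "C = (\<Sum>i<p. \<Sum>j<p. \<bar>H i j\<bar>) + 1"
  have C: "\<bar>H i j\<bar> \<le> C" if "i < p" "j < p" for i j
  proof -
    have "\<bar>H i j\<bar> \<le> (\<Sum>j<p. \<bar>H i j\<bar>)" using that by (intro member_le_sum) auto
    also have "\<dots> \<le> (\<Sum>i<p. \<Sum>j<p. \<bar>H i j\<bar>)"
      using that by (intro member_le_sum[where f="\<lambda>i. \<Sum>j<p. \<bar>H i j\<bar>"]) (auto intro: sum_nonneg)
    finally show ?thesis by (simp add: C_def)
  qed
  have C1: "C \<ge> 1" unfolding C_def by (simp add: sum_nonneg)
  \<comment> \<open>There are \<open>p\<^sup>2\<close> terms of size at most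
    \<open>C * \<delta>\<close> times the largest entry; this choice bounds their sum by half of
    that entry.\<close>
  define \<delta> where "\<delta> = 1 / (2 * C * (real p + 1)\<^sup>2)"
  have \<delta>: "\<delta> > 0" using C1 by (simp add: \<delta>_def)
  have "invertible_k p A" if A: "\<forall>i<p. \<forall>j<p. \<bar>A i j - S i j\<bar> \<le> \<delta>" for A
    unfolding invertible_k_iff_kdet
  proof
    assume "kdet p A = 0"
    then obtain v where v: "\<exists>j<p. v j \<noteq> 0" "\<forall>i<p. (\<Sum>j<p. A i j * v j) = 0"
      by (auto simp: kdet_eq_0_iff)
    define m where "m = Max ((\<lambda>j. \<bar>v j\<bar>) ` {..<p})"
    have fin: "finite ((\<lambda>j. \<bar>v j\<bar>) ` {..<p})" "(\<lambda>j. \<bar>v j\<bar>) ` {..<p} \<noteq> {}" using v(1) by auto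
    have m: "\<bar>v j\<bar> \<le> m" if "j < p" for j unfolding m_def using that fin by (intro Max_ge) auto
    obtain k where k: "k < p" "\<bar>v k\<bar> = m" using Max_in[OF fin] unfolding m_def by auto
    have mpos: "m > 0" using v(1) m by (metis abs_le_zero_iff not_le order.trans)
    have "v k = (\<Sum>i<p. if k = i then v i else 0)" using k by simp
    also have "\<dots> = (\<Sum>i<p. (if k = i then 1 else 0) * v i)" by (rule sum.cong) auto
    also have "\<dots> = (\<Sum>i<p. (\<Sum>l<p. H k l * S l i) * v i)"
      using H k by (auto simp: is_inverse_def intro!: sum.cong)
    also have "\<dots> = (\<Sum>l<p. H k l * (\<Sum>i<p. S l i * v i))"
      by (simp add: sum_distrib_left sum_distrib_right mult.assoc) (rule sum.swap)
    also have "\<dots> = (\<Sum>l<p. H k l * (\<Sum>i<p. (S l i - A l i) * v i))"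
      using v(2) by (auto simp: left_diff_distrib sum_subtractf intro!: sum.cong)
    finally have "m = \<bar>\<Sum>l<p. H k l * (\<Sum>i<p. (S l i - A l i) * v i)\<bar>" using k by simp
    also have "\<dots> \<le> (\<Sum>l<p. \<bar>H k l\<bar> * (\<Sum>i<p. \<bar>S l i - A l i\<bar> * \<bar>v i\<bar>))"
      by (auto simp: abs_mult[symmetric] intro!: order.trans[OF sum_abs] sum_mono)
        (auto simp: abs_mult intro!: mult_left_mono order.trans[OF sum_abs])
    also have "\<dots> \<le> (\<Sum>l<p. C * (\<Sum>i<p. \<delta> * m))"
      using C k A m \<delta> C1 by (intro sum_mono mult_mono) (auto simp: abs_minus_commute intro!: sum_nonneg)
    also have "\<dots> = (real p)\<^sup>2 * C * \<delta> * m" by (simp add: power2_eq_square)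
    also have "\<dots> \<le> (real p + 1)\<^sup>2 * C * \<delta> * m"
      using C1 \<delta> mpos by (intro mult_right_mono power_mono) auto
    also have "\<dots> = m / 2" using C1 by (simp add: \<delta>_def)
    finally show False using mpos by simp
  qed
  then show ?thesis using \<delta> by blast
qed

section \<open>Errors as martingale differences under conditional independence\<close>

lemma (in prob_space) subalgebra_sigma: "E \<subseteq> sets M \<Longrightarrow> subalgebra M (sigma (space M) E)"
  using sets.space_closed[of M] by (auto simp: subalgebra_def intro: sets.sigma_sets_subset[THEN subsetD])

lemma (in prob_space) sigma_finite_subalgebraI: "subalgebra M F \<Longrightarrow> sigma_finite_subalgebra M F"
  by (intro finite_measure_subalgebra_is_sigma_finite) (unfold_locales, auto)

text \<open>Dynkin's argument: the sets on which the integrals agree contain the \<pi>-system and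
  are closed under complements, where \<open>space M \<in> E\<close> supplies the total, and under
  countable disjoint unions.\<close>

lemma (in prob_space) set_integral_eq_sigma_sets:
  fixes f g :: "'a \<Rightarrow> real"
  assumes E: "Int_stable E" "E \<subseteq> sets M" "space M \<in> E"
    and f: "integrable M f" and g: "integrable M g"
    and eq: "\<And>D. D \<in> E \<Longrightarrow> (LINT x:D|M. f x) = (LINT x:D|M. g x)"
    and A: "A \<in> sigma_sets (space M) E"
  shows "(LINT x:A|M. f x) = (LINT x:A|M. g x)"
proof -
  have E': "E \<subseteq> Pow (space M)" using E(2) sets.space_closed by blast
  have sets: "B \<in> sets M" if "B \<in> sigma_sets (space M) E" for B
    using sets.sigma_sets_subset[OF E(2)] that by blast
  have int: "set_integrable M B f" "set_integrable M B g" if "B \<in> sets M" for B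
    unfolding set_integrable_def using integrable_mult_indicator[OF that f] integrable_mult_indicator[OF that g]
    by auto
  have whole: "(LINT x:space M|M. f x) = (LINT x:space M|M. g x)" by (rule eq[OF E(3)])
  show ?thesis
    using E(1) E' A
  proof (induction rule: sigma_sets_induct_disjoint)
    case (basic B)
    then show ?case by (rule eq)
  next
    case empty
    then show ?case by (simp add: set_lebesgue_integral_def)
  next
    case (compl B)
    have B: "B \<in> sets M" using sets compl by blast
    have *: "(LINT x:space M|M. h x) = (LINT x:space M - B|M. h x) + (LINT x:B|M. h x)"
      if "integrable M h" for h :: "'a \<Rightarrow> real"
    proof -
      have i: "set_integrable M C h" if "C \<in> sets M" for C
        unfolding set_integrable_def using integrable_mult_indicator[OF that \<open>integrable M h\<close>] .
      have "(LINT x:(space M - B) \<union> B|M. h x) = (LINT x:space M - B|M. h x) + (LINT x:B|M. h x)"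
        by (rule set_integral_Un) (use B i in auto)
      moreover have "(space M - B) \<union> B = space M" using sets.sets_into_space[OF B] by auto
      ultimately show ?thesis by simp
    qed
    show ?case using *[OF f] *[OF g] whole compl by simp
  next
    case (union B)
    have B: "B i \<in> sets M" for i using sets union by auto
    have disj: "B i \<inter> B j = {}" if "i \<noteq> j" for i j
      using union(1) that by (auto simp: disjoint_family_on_def)
    have "(LINT x:(\<Union>i. B i)|M. f x) = (\<Sum>i. LINT x:B i|M. f x)"
      by (rule lebesgue_integral_countable_add[OF B disj]) (use B int in auto)
    moreover have "(LINT x:(\<Union>i. B i)|M. g x) = (\<Sum>i. LINT x:B i|M. g x)"
      by (rule lebesgue_integral_countable_add[OF B disj]) (use B int in auto)
    ultimately show ?case using union by simp
  qed
qed

text \<open>It allows conditional expectations to be identified by testing rectangles only, first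
  for the join of response and covariates and again for the enlarged past.\<close>

lemma (in prob_space) real_cond_exp_sigma_eqI:
  fixes f h :: "'a \<Rightarrow> real"
  assumes E: "Int_stable E" "E \<subseteq> sets M" "space M \<in> E"
    and f: "integrable M f" and h: "integrable M h" "h \<in> borel_measurable (sigma (space M) E)"
    and eq: "\<And>D. D \<in> E \<Longrightarrow> (LINT x:D|M. f x) = (LINT x:D|M. h x)"
  shows "AE x in M. real_cond_exp M (sigma (space M) E) f x = h x"
proof -
  interpret S: sigma_finite_subalgebra M "sigma (space M) E"
    by (intro sigma_finite_subalgebraI subalgebra_sigma E)
  have E': "E \<subseteq> Pow (space M)" using E(2) sets.space_closed by blast
  show ?thesis
    by (rule S.real_cond_exp_charact[OF _ f h])
      (rule set_integral_eq_sigma_sets[OF E f h(1) eq], use E' in auto)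
qed

lemma (in prob_space) integral_mult_real_cond_exp:
  fixes u f g :: "'a \<Rightarrow> real"
  assumes F: "subalgebra M F" and u: "u \<in> borel_measurable F" and f: "f \<in> borel_measurable M"
    and uf: "integrable M (\<lambda>x. u x * f x)"
    and g: "g \<in> borel_measurable M" and eq: "AE x in M. real_cond_exp M F f x = g x"
  shows "integrable M (\<lambda>x. u x * g x)" "(\<integral>x. u x * f x \<partial>M) = (\<integral>x. u x * g x \<partial>M)"
proof -
  interpret S: sigma_finite_subalgebra M F by (rule sigma_finite_subalgebraI[OF F])
  note [measurable] = g f measurable_from_subalg[OF F u]
  have *: "AE x in M. u x * real_cond_exp M F f x = u x * g x" using eq by auto
  have "integrable M (\<lambda>x. u x * real_cond_exp M F f x)" by (rule S.real_cond_exp_intg[OF uf u f])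
  then show "integrable M (\<lambda>x. u x * g x)"
    by (rule integrable_cong_AE_imp) (use * in \<open>auto elim: eventually_mono\<close>)
  have "(\<integral>x. u x * g x \<partial>M) = (\<integral>x. u x * real_cond_exp M F f x \<partial>M)"
    by (rule integral_cong_AE) (use * in \<open>auto elim: eventually_mono\<close>)
  then show "(\<integral>x. u x * f x \<partial>M) = (\<integral>x. u x * g x \<partial>M)"
    using S.real_cond_exp_intg(2)[OF uf u f] by simp
qed

lemma (in prob_space) real_cond_exp_abs_le:
  fixes f :: "'a \<Rightarrow> real"
  assumes F: "subalgebra M F" and f: "f \<in> borel_measurable M" and b: "\<And>x. x \<in> space M \<Longrightarrow> 0 \<le> f x \<and> f x \<le> 1"
  shows "AE x in M. 0 \<le> real_cond_exp M F f x \<and> real_cond_exp M F f x \<le> 1"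
proof -
  interpret S: sigma_finite_subalgebra M F by (rule sigma_finite_subalgebraI[OF F])
  have i: "integrable M f" by (rule integrable_const_bound[where B=1]) (use f b in auto)
  have "AE x in M. real_cond_exp M F f x \<ge> 0" by (rule S.real_cond_exp_pos[OF _ f]) (use b in auto)
  moreover have "AE x in M. real_cond_exp M F f x \<le> 1"
    by (rule S.real_cond_exp_le_c[OF i]) (use b in auto)
  ultimately show ?thesis by auto
qed

lemma (in prob_space) subalgebra_sigma_Int:
  assumes B: "subalgebra M B" and F: "subalgebra M F"
  shows "subalgebra (sigma (space M) {b \<inter> c | b c. b \<in> sets B \<and> c \<in> sets F}) B"
    "subalgebra (sigma (space M) {b \<inter> c | b c. b \<in> sets B \<and> c \<in> sets F}) F"
proof -
  let ?E = "{b \<inter> c | b c. b \<in> sets B \<and> c \<in> sets F}"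
  have sp: "space B = space M" "space F = space M" using B F by (auto simp: subalgebra_def)
  have E: "?E \<subseteq> Pow (space M)"
    using sets.sets_into_space[of _ B] unfolding sp by blast
  have "b \<in> ?E" if "b \<in> sets B" for b
    using that sets.sets_into_space[OF that] sets.top[of F] unfolding sp
    by (intro CollectI exI[of _ b] exI[of _ "space M"]) auto
  then show "subalgebra (sigma (space M) ?E) B"
    using E by (auto simp: subalgebra_def sp space_measure_of_conv)
  have "c \<in> ?E" if "c \<in> sets F" for c
    using that sets.sets_into_space[OF that] sets.top[of B] unfolding sp
    by (intro CollectI exI[of _ "space M"] exI[of _ c]) auto
  then show "subalgebra (sigma (space M) ?E) F"
    using E by (auto simp: subalgebra_def sp space_measure_of_conv)
qed

text \<open>The sigma-algebras \<open>F\<close>, \<open>A\<close>, \<open>B\<close> play the roles of those generated by the covariates, by the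
  regressor of interest and by the response.\<close>

locale cond_indep_errors = prob_space M for M :: "'a measure" +
  fixes F A B :: "'a measure" and n :: nat and eps :: "nat \<Rightarrow> 'a \<Rightarrow> real"
  assumes F: "subalgebra M F" and A: "subalgebra M A" and B: "subalgebra M B"
    and ci: "cond_indep_alg M F A B"
    and eps: "\<And>i. i < n \<Longrightarrow> eps i \<in> borel_measurable
      (sigma (space M) {b \<inter> c | b c. b \<in> sets B \<and> c \<in> sets F})"
    and eps_indep: "cond_indep_vars M F eps {..<n}"
begin

lemma sets_F: "c \<in> sets F \<Longrightarrow> c \<in> sets M" and space_F: "space F = space M"
  and sets_A: "c \<in> sets A \<Longrightarrow> c \<in> sets M" and space_A: "space A = space M"
  and sets_B: "c \<in> sets B \<Longrightarrow> c \<in> sets M" and space_B: "space B = space M"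
  using F A B by (auto simp: subalgebra_def)

lemma space_in_F: "space M \<in> sets F" and space_in_A: "space M \<in> sets A" and space_in_B: "space M \<in> sets B"
  using sets.top[of F] sets.top[of A] sets.top[of B] by (simp_all add: space_F space_A space_B)

text \<open>The join of \<open>B\<close> and \<open>F\<close>. Intersections rather than unions are
  the generators because they form a \<pi>-system.\<close>

definition BF :: "'a measure" where
  "BF = sigma (space M) {b \<inter> c | b c. b \<in> sets B \<and> c \<in> sets F}"

lemma BF_gen: "{b \<inter> c | b c. b \<in> sets B \<and> c \<in> sets F} \<subseteq> sets M"
  using sets_B sets_F by auto

lemma BF: "subalgebra M BF"
  unfolding BF_def by (rule subalgebra_sigma[OF BF_gen])

lemma F_BF: "subalgebra BF F"
  unfolding BF_def by (rule subalgebra_sigma_Int(2)[OF B F])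

lemma F_imp_BF: "u \<in> borel_measurable F \<Longrightarrow> u \<in> borel_measurable BF"
  by (rule measurable_from_subalg[OF F_BF])

lemma F_imp_M: "u \<in> borel_measurable F \<Longrightarrow> u \<in> borel_measurable M"
  by (rule measurable_from_subalg[OF F])

lemma eps_BF: "i < n \<Longrightarrow> eps i \<in> borel_measurable BF"
  unfolding BF_def by (rule eps)

lemma eps_M: "i < n \<Longrightarrow> eps i \<in> borel_measurable M"
  by (rule measurable_from_subalg[OF BF eps_BF])

lemma ind_cond_exp:
  assumes [measurable]: "f \<in> borel_measurable M" and b: "\<And>x. x \<in> space M \<Longrightarrow> 0 \<le> f x \<and> f x \<le> 1"
  shows "integrable M f" "AE x in M. norm (real_cond_exp M F f x) \<le> 1"
    "real_cond_exp M F f \<in> borel_measurable F" "real_cond_exp M F f \<in> borel_measurable BF"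
    "real_cond_exp M F f \<in> borel_measurable M"
proof -
  show "integrable M f" by (rule integrable_const_bound[where B=1]) (use b in auto)
  show "AE x in M. norm (real_cond_exp M F f x) \<le> 1"
    using real_cond_exp_abs_le[OF F assms] by auto
  show *: "real_cond_exp M F f \<in> borel_measurable F" by simp
  show "real_cond_exp M F f \<in> borel_measurable BF" by (rule F_imp_BF[OF *])
  show "real_cond_exp M F f \<in> borel_measurable M" by simp
qed

text \<open>Doob's form of conditional independence: once \<open>F\<close> is known,
  \<open>B\<close> gives no further information on \<open>A\<close>. On a rectangle
  \<open>b \<inter> c\<close> the product formula for \<open>a\<close> and \<open>b\<close> is
  integrated over \<open>c\<close>.\<close>

lemma cond_exp_A_BF:
  assumes a: "a \<in> sets A"
  shows "AE x in M. real_cond_exp M BF (indicator a) x = real_cond_exp M F (indicator a) x"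
  unfolding BF_def
proof (rule real_cond_exp_sigma_eqI)
  let ?E = "{b \<inter> c | b c. b \<in> sets B \<and> c \<in> sets F}"
  let ?\<alpha> = "real_cond_exp M F (indicator a)"
  interpret S: sigma_finite_subalgebra M F by (rule sigma_finite_subalgebraI[OF F])
  note [measurable] = sets_A[OF a]
  have ia: "indicator a \<in> borel_measurable M" by simp
  note \<alpha> = ind_cond_exp[OF ia]
  show "Int_stable ?E"
  proof (rule Int_stableI, safe)
    fix b c b' c' assume "b \<in> sets B" "c \<in> sets F" "b' \<in> sets B" "c' \<in> sets F"
    then show "\<exists>b'' c''. b \<inter> c \<inter> (b' \<inter> c') = b'' \<inter> c'' \<and> b'' \<in> sets B \<and> c'' \<in> sets F"
      by (intro exI[of _ "b \<inter> b'"] exI[of _ "c \<inter> c'"]) auto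
  qed
  show "?E \<subseteq> sets M" by (rule BF_gen)
  show "space M \<in> ?E" using space_in_B space_in_F by auto
  show "integrable M (indicator a :: 'a \<Rightarrow> real)" by (rule \<alpha>) (auto simp: indicator_def)
  then show i\<alpha>: "integrable M ?\<alpha>" by (rule S.real_cond_exp_int)
  show "?\<alpha> \<in> borel_measurable (sigma (space M) ?E)"
    using \<alpha>(4) unfolding BF_def by (auto simp: indicator_def)
  fix D assume "D \<in> ?E"
  then obtain b c where D: "D = b \<inter> c" and b: "b \<in> sets B" and c: "c \<in> sets F" by auto
  note [measurable] = sets_B[OF b] sets_F[OF c]
  have cF: "(indicator c :: 'a \<Rightarrow> real) \<in> borel_measurable F" using c by simp
  have cab: "integrable M (\<lambda>x. indicator c x * indicator (a \<inter> b) x :: real)"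
    by (rule integrable_const_bound[where B=1]) (auto simp: indicator_def)
  have ci_ab: "AE x in M. real_cond_exp M F (indicator (a \<inter> b)) x = ?\<alpha> x * real_cond_exp M F (indicator b) x"
    using ci a b by (auto simp: cond_indep_alg_def)
  have c\<alpha>b: "integrable M (\<lambda>x. indicator c x * ?\<alpha> x * indicator b x)"
    by (rule Bochner_Integration.integrable_bound[OF i\<alpha>]) (auto simp: indicator_def)
  have "(LINT x:D|M. indicator a x :: real) = (\<integral>x. indicator c x * indicator (a \<inter> b) x \<partial>M)"
    unfolding set_lebesgue_integral_def D by (rule Bochner_Integration.integral_cong) (auto simp: indicator_def)
  also have "\<dots> = (\<integral>x. indicator c x * (?\<alpha> x * real_cond_exp M F (indicator b) x) \<partial>M)"
    by (rule integral_mult_real_cond_exp[OF F cF _ cab _ ci_ab]) auto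
  also have "\<dots> = (\<integral>x. indicator c x * ?\<alpha> x * real_cond_exp M F (indicator b) x \<partial>M)"
    by (simp add: mult.assoc)
  also have "\<dots> = (\<integral>x. indicator c x * ?\<alpha> x * indicator b x \<partial>M)"
    by (rule S.real_cond_exp_intg(2)[OF c\<alpha>b]) (use cF in auto)
  also have "\<dots> = (LINT x:D|M. ?\<alpha> x)"
    unfolding set_lebesgue_integral_def D by (rule Bochner_Integration.integral_cong) (auto simp: indicator_def)
  finally show "(LINT x:D|M. indicator a x :: real) = (LINT x:D|M. ?\<alpha> x)" .
qed

text \<open>An exchange rule, used in both directions below to condition an event of the regressor
  on \<open>F\<close> and to undo this.\<close>

lemma integral_A_cond_exp:
  assumes a: "a \<in> sets A" and u: "u \<in> borel_measurable BF" and b: "AE x in M. norm (u x) \<le> 1"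
  shows "(\<integral>x. u x * indicator a x \<partial>M) = (\<integral>x. u x * real_cond_exp M F (indicator a) x \<partial>M)"
proof (rule integral_mult_real_cond_exp[OF BF u _ _ _ cond_exp_A_BF[OF a]])
  note [measurable] = sets_A[OF a] measurable_from_subalg[OF BF u]
  show "(indicator a :: 'a \<Rightarrow> real) \<in> borel_measurable M" by simp
  show "integrable M (\<lambda>x. u x * indicator a x)"
    by (rule integrable_const_bound[where B=1]) (use b in \<open>auto simp: indicator_def elim: eventually_mono\<close>)
  show "real_cond_exp M F (indicator a) \<in> borel_measurable M" by simp
qed

text \<open>Rectangles generating the join of \<open>A\<close>, \<open>F\<close> and the errors with
  index below \<open>k\<close>. All of \<open>A\<close> and \<open>F\<close> is present already at
  \<open>k = 0\<close>; the product form lets independence act factor by factor.\<close>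

definition past_gen :: "nat \<Rightarrow> 'a set set" where
  "past_gen k = {a \<inter> c \<inter> {x \<in> space M. \<forall>j<k. eps j x \<in> S j} | a c S.
     a \<in> sets A \<and> c \<in> sets F \<and> (\<forall>j. S j \<in> sets borel)}"

definition past :: "nat \<Rightarrow> 'a measure" where
  "past k = sigma (space M) (past_gen k)"

lemma past_gen_sets: "k \<le> n \<Longrightarrow> past_gen k \<subseteq> sets M"
proof
  fix D assume k: "k \<le> n" and "D \<in> past_gen k"
  then obtain a c S where D: "D = a \<inter> c \<inter> {x \<in> space M. \<forall>j<k. eps j x \<in> S j}"
    and ac: "a \<in> sets A" "c \<in> sets F" and S: "\<forall>j. S j \<in> sets borel"
    unfolding past_gen_def by blast
  have *: "{x \<in> space M. \<forall>j\<in>{..<k}. eps j x \<in> S j} \<in> sets M"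
  proof (rule sets.sets_Collect_finite_All)
    fix j assume "j \<in> {..<k}"
    then have [measurable]: "eps j \<in> borel_measurable M" using eps_M k by auto
    have [measurable]: "S j \<in> sets borel" using S by auto
    show "{x \<in> space M. eps j x \<in> S j} \<in> sets M" by measurable
  qed simp
  have "D = a \<inter> c \<inter> {x \<in> space M. \<forall>j\<in>{..<k}. eps j x \<in> S j}" unfolding D by auto
  then show "D \<in> sets M" using sets.Int[OF sets.Int[OF sets_A[OF ac(1)] sets_F[OF ac(2)]] *] by metis
qed

lemma past_gen_Int_stable: "Int_stable (past_gen k)"
  unfolding past_gen_def
proof (rule Int_stableI, safe)
  fix a c a' c' and S S' :: "nat \<Rightarrow> real set"
  assume "a \<in> sets A" "c \<in> sets F" "\<forall>j. S j \<in> sets (borel :: real measure)"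
    "a' \<in> sets A" "c' \<in> sets F" "\<forall>j. S' j \<in> sets (borel :: real measure)"
  then show "\<exists>a'' c'' S''. a \<inter> c \<inter> {x \<in> space M. \<forall>j<k. eps j x \<in> S j} \<inter>
      (a' \<inter> c' \<inter> {x \<in> space M. \<forall>j<k. eps j x \<in> S' j}) =
      a'' \<inter> c'' \<inter> {x \<in> space M. \<forall>j<k. eps j x \<in> S'' j} \<and> a'' \<in> sets A \<and> c'' \<in> sets F \<and> (\<forall>j. S'' j \<in> sets borel)"
    by (intro exI[of _ "a \<inter> a'"] exI[of _ "c \<inter> c'"] exI[of _ "\<lambda>j. S j \<inter> S' j"]) auto
qed

lemma past_genI:
  "a \<in> sets A \<Longrightarrow> c \<in> sets F \<Longrightarrow> (\<And>j. S j \<in> sets borel) \<Longrightarrow>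
    a \<inter> c \<inter> {x \<in> space M. \<forall>j<k. eps j x \<in> S j} \<in> past_gen k"
  unfolding past_gen_def by blast

lemma space_in_past_gen: "space M \<in> past_gen k"
  using past_genI[OF space_in_A space_in_F, of "\<lambda>_. UNIV" k] by simp

lemma past_subalgebra: "k \<le> n \<Longrightarrow> subalgebra M (past k)"
  unfolding past_def by (rule subalgebra_sigma[OF past_gen_sets])

lemma space_past: "space (past k) = space M"
  by (simp add: past_def space_measure_of_conv)

lemma past_gen_in_past: "k \<le> n \<Longrightarrow> D \<in> past_gen k \<Longrightarrow> D \<in> sets (past k)"
  unfolding past_def using past_gen_sets[of k] sets.space_closed[of M] by (subst sets_measure_of) auto

lemma A_past: "k \<le> n \<Longrightarrow> u \<in> borel_measurable A \<Longrightarrow> u \<in> borel_measurable (past k)"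
proof (rule measurable_from_subalg[of "past k" A])
  assume k: "k \<le> n"
  have "a \<in> sets (past k)" if "a \<in> sets A" for a
    using past_gen_in_past[OF k past_genI[OF that space_in_F, of "\<lambda>_. UNIV"]]
      sets.sets_into_space[OF sets_A[OF that]] by (simp add: Int_absorb2)
  then show "subalgebra (past k) A" by (auto simp: subalgebra_def space_past space_A)
qed

lemma F_past: "k \<le> n \<Longrightarrow> u \<in> borel_measurable F \<Longrightarrow> u \<in> borel_measurable (past k)"
proof (rule measurable_from_subalg[of "past k" F])
  assume k: "k \<le> n"
  have "a \<in> sets (past k)" if "a \<in> sets F" for a
    using past_gen_in_past[OF k past_genI[OF space_in_A that, of "\<lambda>_. UNIV"]]
      sets.sets_into_space[OF sets_F[OF that]] by (simp add: Int_absorb1 Int_absorb2)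
  then show "subalgebra (past k) F" by (auto simp: subalgebra_def space_past space_F)
qed

lemma eps_past: "k \<le> n \<Longrightarrow> j < k \<Longrightarrow> eps j \<in> borel_measurable (past k)"
proof (rule measurableI)
  fix S :: "real set" assume k: "k \<le> n" "j < k" and S: "S \<in> sets borel"
  have "(\<forall>i<k. eps i x \<in> (if i = j then S else UNIV)) = (eps j x \<in> S)" for x
    using k(2) by (metis UNIV_I)
  then have "eps j -` S \<inter> space (past k) = space M \<inter> space M \<inter> {x \<in> space M. \<forall>i<k. eps i x \<in> (if i = j then S else UNIV)}"
    by (auto simp: space_past)
  also have "\<dots> \<in> sets (past k)"
    by (rule past_gen_in_past[OF k(1) past_genI[OF space_in_A space_in_F]]) (use S in auto)
  finally show "eps j -` S \<inter> space (past k) \<in> sets (past k)" .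
qed auto

text \<open>On a rectangle the integrand is a product. Conditional independence of \<open>A\<close>
  and \<open>B\<close> replaces the factor from \<open>A\<close> by its conditional expectation,
  independence of the errors then splits off the factor of \<open>eps k\<close>, and afterwards the
  conditioning of the earlier errors and of \<open>a\<close> is undone.\<close>

lemma integral_past_gen_indicator:
  assumes k: "k < n" and D: "D \<in> past_gen k" and T: "T \<in> sets borel"
  shows "(\<integral>x. indicator D x * indicator T (eps k x) \<partial>M) =
    (\<integral>x. indicator D x * real_cond_exp M F (\<lambda>x. indicator T (eps k x)) x \<partial>M)"
proof -
  interpret Q: sigma_finite_subalgebra M F by (rule sigma_finite_subalgebraI[OF F])
  obtain a c S where D: "D = a \<inter> c \<inter> {x \<in> space M. \<forall>j<k. eps j x \<in> S j}"
    and a: "a \<in> sets A" and c: "c \<in> sets F" and S: "\<And>j. S j \<in> sets borel"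
    using D unfolding past_gen_def by blast
  define d :: "'a \<Rightarrow> real" where "d = (\<lambda>x. \<Prod>j<k. indicator (S j) (eps j x))"
  define b :: "'a \<Rightarrow> real" where "b = (\<lambda>x. indicator T (eps k x))"
  define \<alpha> where "\<alpha> = real_cond_exp M F (indicator a)"
  define \<eta> where "\<eta> = real_cond_exp M F b"
  have indD: "indicator D x = indicator a x * indicator c x * d x" for x
  proof -
    have "d x = (if \<forall>j<k. eps j x \<in> S j then 1 else 0)"
      unfolding d_def by (auto simp: indicator_def intro!: prod_zero)
    moreover have "x \<in> a \<Longrightarrow> x \<in> space M" using sets.sets_into_space[OF sets_A[OF a]] by auto
    ultimately show ?thesis unfolding D by (auto simp: indicator_def)
  qed
  have d01: "0 \<le> d x \<and> d x \<le> 1" and b01: "0 \<le> b x \<and> b x \<le> 1" for x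
    unfolding d_def b_def by (auto intro!: prod_nonneg prod_le_1 simp: indicator_def)
  have [measurable]: "eps j \<in> borel_measurable BF" if "j < k" for j using eps_BF that k by auto
  note [measurable] = eps_BF[OF k] S T
  have dBF[measurable]: "d \<in> borel_measurable BF"
    unfolding d_def by (rule borel_measurable_prod) auto
  have bBF[measurable]: "b \<in> borel_measurable BF" unfolding b_def by measurable
  have dM[measurable]: "d \<in> borel_measurable M" by (rule measurable_from_subalg[OF BF dBF])
  have bM[measurable]: "b \<in> borel_measurable M" by (rule measurable_from_subalg[OF BF bBF])
  have cF[measurable]: "(indicator c :: 'a \<Rightarrow> real) \<in> borel_measurable F" using c by simp
  have cBF[measurable]: "(indicator c :: 'a \<Rightarrow> real) \<in> borel_measurable BF" by (rule F_imp_BF[OF cF])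
  have cM[measurable]: "(indicator c :: 'a \<Rightarrow> real) \<in> borel_measurable M" by (rule F_imp_M[OF cF])
  have aM[measurable]: "(indicator a :: 'a \<Rightarrow> real) \<in> borel_measurable M" using sets_A[OF a] by simp
  have \<alpha>: "AE x in M. norm (\<alpha> x) \<le> 1" "\<alpha> \<in> borel_measurable F" "\<alpha> \<in> borel_measurable BF" "\<alpha> \<in> borel_measurable M"
    unfolding \<alpha>_def by (rule ind_cond_exp[OF aM], simp add: indicator_def)+
  have \<eta>: "AE x in M. norm (\<eta> x) \<le> 1" "\<eta> \<in> borel_measurable F" "\<eta> \<in> borel_measurable BF" "\<eta> \<in> borel_measurable M"
    unfolding \<eta>_def by (rule ind_cond_exp[OF bM], simp add: b01)+
  note [measurable] = \<alpha>(2-) \<eta>(2-)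
  have prod_d: "AE x in M. real_cond_exp M F (\<lambda>x. d x * b x) x = real_cond_exp M F d x * \<eta> x"
  proof -
    \<comment> \<open>With a single family of sets, the indices below \<open>k\<close> yield the
      conditional expectation of \<open>d\<close> and those below \<open>Suc k\<close> that of
      \<open>d * b\<close>; comparing the two products gives the factorisation.\<close>
    let ?S = "\<lambda>j. if j = k then T else S j"
    have *: "AE \<omega> in M. real_cond_exp M F (\<lambda>\<omega>. \<Prod>i\<in>J. indicator (?S i) (eps i \<omega>)) \<omega> =
       (\<Prod>i\<in>J. real_cond_exp M F (\<lambda>\<omega>. indicator (?S i) (eps i \<omega>)) \<omega>)" if "J \<subseteq> {..<n}" for J
      using eps_indep that S T finite_subset[OF that] unfolding cond_indep_vars_def by auto
    have 1: "(\<Prod>i<k. indicator (?S i) (eps i \<omega>)) = d \<omega>" for \<omega>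
      unfolding d_def by (rule prod.cong) auto
    have 2: "(\<Prod>i<Suc k. indicator (?S i) (eps i \<omega>)) = d \<omega> * b \<omega>" for \<omega>
      unfolding prod.lessThan_Suc 1 b_def by simp
    have "AE \<omega> in M. real_cond_exp M F d \<omega> = (\<Prod>i<k. real_cond_exp M F (\<lambda>\<omega>. indicator (?S i) (eps i \<omega>)) \<omega>)"
      using *[of "{..<k}"] k unfolding 1 by auto
    moreover have "AE \<omega> in M. real_cond_exp M F (\<lambda>x. d x * b x) \<omega> =
        (\<Prod>i<Suc k. real_cond_exp M F (\<lambda>\<omega>. indicator (?S i) (eps i \<omega>)) \<omega>)"
      using *[of "{..<Suc k}"] k unfolding 2 by auto
    ultimately show ?thesis
      unfolding \<eta>_def b_def by eventually_elim (simp add: prod.lessThan_Suc)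
  qed
  have bound: "integrable M f" if "f \<in> borel_measurable M" "AE x in M. norm (f x) \<le> 1" for f :: "'a \<Rightarrow> real"
    using that by (intro integrable_const_bound[where B=1]) auto
  have c01: "norm (indicator c x :: real) \<le> 1" for x by (simp add: indicator_def)
  have m1: "norm (u * v) \<le> 1" if "norm u \<le> 1" "norm v \<le> 1" for u v :: real
    using mult_mono[OF that] by (simp add: abs_mult)
  have d1: "norm (d x) \<le> 1" and b1: "norm (b x) \<le> 1" for x using d01 b01 by auto
  have "(\<integral>x. indicator D x * b x \<partial>M) = (\<integral>x. (indicator c x * d x * b x) * indicator a x \<partial>M)"
    by (simp add: indD mult_ac)
  also have "\<dots> = (\<integral>x. (indicator c x * d x * b x) * \<alpha> x \<partial>M)"
    unfolding \<alpha>_def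
  proof (rule integral_A_cond_exp[OF a])
    show "AE x in M. norm (indicator c x * d x * b x) \<le> 1" by (intro AE_I2 m1 c01 d1 b1)
  qed measurable
  also have "\<dots> = (\<integral>x. (indicator c x * \<alpha> x) * (d x * b x) \<partial>M)"
    by (simp add: mult_ac)
  also have "\<dots> = (\<integral>x. (indicator c x * \<alpha> x) * (real_cond_exp M F d x * \<eta> x) \<partial>M)"
  proof (rule integral_mult_real_cond_exp[OF F _ _ _ _ prod_d])
    show "integrable M (\<lambda>x. (indicator c x * \<alpha> x) * (d x * b x))"
    proof (rule bound)
      show "AE x in M. norm ((indicator c x * \<alpha> x) * (d x * b x)) \<le> 1"
        using \<alpha>(1) by eventually_elim (intro m1 c01 d1 b1, auto)
    qed measurable
  qed measurable
  also have "\<dots> = (\<integral>x. (indicator c x * \<alpha> x * \<eta> x) * real_cond_exp M F d x \<partial>M)"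
    by (simp add: mult_ac)
  also have "\<dots> = (\<integral>x. (indicator c x * \<alpha> x * \<eta> x) * d x \<partial>M)"
  proof (rule Q.real_cond_exp_intg)
    show "integrable M (\<lambda>x. (indicator c x * \<alpha> x * \<eta> x) * d x)"
    proof (rule bound)
      show "AE x in M. norm ((indicator c x * \<alpha> x * \<eta> x) * d x) \<le> 1"
        using \<alpha>(1) \<eta>(1) by eventually_elim (intro m1 c01 d1, auto)
    qed measurable
  qed measurable
  also have "\<dots> = (\<integral>x. (indicator c x * d x * \<eta> x) * \<alpha> x \<partial>M)"
    by (simp add: mult_ac)
  also have "\<dots> = (\<integral>x. (indicator c x * d x * \<eta> x) * indicator a x \<partial>M)"
    unfolding \<alpha>_def
  proof (rule integral_A_cond_exp[OF a, symmetric])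
    show "AE x in M. norm (indicator c x * d x * \<eta> x) \<le> 1"
      using \<eta>(1) by eventually_elim (intro m1 c01 d1, auto)
  qed measurable
  also have "\<dots> = (\<integral>x. indicator D x * \<eta> x \<partial>M)"
    by (simp add: indD mult_ac)
  finally show ?thesis unfolding b_def \<eta>_def .
qed

text \<open>No approximation of the unbounded \<open>g\<close> is needed: the laws of
  \<open>eps k\<close> under the density \<open>indicator D\<close> and under its
  \<open>F\<close>-conditional expectation agree on Borel sets, so they integrate \<open>g\<close>
  equally.\<close>

lemma integral_past_gen:
  fixes g :: "real \<Rightarrow> real"
  assumes k: "k < n" and D: "D \<in> past_gen k" and g[measurable]: "g \<in> borel_measurable borel"
    and int: "integrable M (\<lambda>x. g (eps k x))"
  shows "(\<integral>x. indicator D x * g (eps k x) \<partial>M) = (\<integral>x. indicator D x * real_cond_exp M F (\<lambda>x. g (eps k x)) x \<partial>M)"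
proof -
  interpret Q: sigma_finite_subalgebra M F by (rule sigma_finite_subalgebraI[OF F])
  note [measurable] = eps_M[OF k]
  have DM[measurable]: "D \<in> sets M" using past_gen_sets[of k] k D by auto
  define \<delta> where "\<delta> = real_cond_exp M F (indicator D)"
  have \<delta>F[measurable]: "\<delta> \<in> borel_measurable F" unfolding \<delta>_def by simp
  have \<delta>M[measurable]: "\<delta> \<in> borel_measurable M" unfolding \<delta>_def by simp
  have \<delta>b: "AE x in M. 0 \<le> \<delta> x \<and> \<delta> x \<le> 1"
    unfolding \<delta>_def by (rule real_cond_exp_abs_le[OF F]) (auto simp: indicator_def)
  define N1 where "N1 = distr (density M (\<lambda>x. ennreal (indicator D x))) borel (eps k)"
  define N2 where "N2 = distr (density M (\<lambda>x. ennreal (\<delta> x))) borel (eps k)"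
  have "N1 = N2"
  proof (rule measure_eqI)
    show "sets N1 = sets N2" by (simp add: N1_def N2_def)
    fix T assume "T \<in> sets N1"
    then have T[measurable]: "T \<in> sets borel" by (simp add: N1_def)
    let ?b = "\<lambda>x. indicator T (eps k x) :: real"
    let ?\<eta> = "real_cond_exp M F ?b"
    have eq: "(\<integral>x. indicator D x * ?b x \<partial>M) = (\<integral>x. \<delta> x * ?b x \<partial>M)"
    proof -
      have \<eta>1: "AE x in M. 0 \<le> ?\<eta> x \<and> ?\<eta> x \<le> 1"
        by (rule real_cond_exp_abs_le[OF F]) (auto simp: indicator_def)
      have "(\<integral>x. indicator D x * ?b x \<partial>M) = (\<integral>x. ?\<eta> x * indicator D x \<partial>M)"
        using integral_past_gen_indicator[OF k D T] by (simp add: mult.commute)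
      also have "\<dots> = (\<integral>x. ?\<eta> x * \<delta> x \<partial>M)"
        unfolding \<delta>_def
      proof (rule Q.real_cond_exp_intg(2)[symmetric])
        show "integrable M (\<lambda>x. ?\<eta> x * indicator D x)"
          by (rule integrable_const_bound[where B=1]) (use \<eta>1 in eventually_elim, auto simp: indicator_def)
      qed auto
      also have "\<dots> = (\<integral>x. \<delta> x * ?\<eta> x \<partial>M)" by (simp add: mult.commute)
      also have "\<dots> = (\<integral>x. \<delta> x * ?b x \<partial>M)"
      proof (rule Q.real_cond_exp_intg(2))
        show "integrable M (\<lambda>x. \<delta> x * ?b x)"
          by (rule integrable_const_bound[where B=1]) (use \<delta>b in eventually_elim, auto simp: indicator_def)
      qed auto
      finally show ?thesis .
    qed
    have e: "emeasure (distr (density M (\<lambda>x. ennreal (h x))) borel (eps k)) T = ennreal (\<integral>x. h x * ?b x \<partial>M)"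
      if [measurable]: "h \<in> borel_measurable M" and h: "AE x in M. 0 \<le> h x \<and> h x \<le> 1" for h :: "'a \<Rightarrow> real"
    proof -
      have "emeasure (distr (density M (\<lambda>x. ennreal (h x))) borel (eps k)) T =
          (\<integral>\<^sup>+x. ennreal (h x) * indicator (eps k -` T \<inter> space M) x \<partial>M)"
        by (simp add: emeasure_distr emeasure_density)
      also have "\<dots> = (\<integral>\<^sup>+x. ennreal (h x * ?b x) \<partial>M)"
        by (rule nn_integral_cong) (auto simp: indicator_def)
      also have "\<dots> = ennreal (\<integral>x. h x * ?b x \<partial>M)"
      proof (rule nn_integral_eq_integral)
        show "integrable M (\<lambda>x. h x * ?b x)"
          by (rule integrable_const_bound[where B=1]) (use h in eventually_elim, auto simp: indicator_def)
        show "AE x in M. 0 \<le> h x * ?b x" using h by eventually_elim (auto simp: indicator_def)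
      qed
      finally show ?thesis .
    qed
    show "emeasure N1 T = emeasure N2 T"
      unfolding N1_def N2_def using e[OF _ \<delta>b] e[of "indicator D"] eq by (simp add: indicator_def)
  qed
  have *: "(\<integral>y. g y \<partial>distr (density M (\<lambda>x. ennreal (h x))) borel (eps k)) = (\<integral>x. h x * g (eps k x) \<partial>M)"
    if [measurable]: "h \<in> borel_measurable M" and h: "AE x in M. 0 \<le> h x \<and> h x \<le> 1" for h :: "'a \<Rightarrow> real"
  proof -
    have "(\<integral>y. g y \<partial>distr (density M (\<lambda>x. ennreal (h x))) borel (eps k)) =
        (\<integral>x. g (eps k x) \<partial>density M (\<lambda>x. ennreal (h x)))"
      by (rule integral_distr) auto
    also have "\<dots> = (\<integral>x. h x * g (eps k x) \<partial>M)"
      by (subst integral_density) (use h in \<open>auto elim!: eventually_mono\<close>)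
    finally show ?thesis .
  qed
  have "(\<integral>x. indicator D x * g (eps k x) \<partial>M) = (\<integral>y. g y \<partial>N1)"
    unfolding N1_def by (subst *) (auto simp: indicator_def)
  also have "\<dots> = (\<integral>x. \<delta> x * g (eps k x) \<partial>M)"
    unfolding \<open>N1 = N2\<close> N2_def by (subst *) (use \<delta>b in auto)
  also have "\<dots> = (\<integral>x. \<delta> x * real_cond_exp M F (\<lambda>x. g (eps k x)) x \<partial>M)"
  proof (rule Q.real_cond_exp_intg(2)[symmetric])
    show "integrable M (\<lambda>x. \<delta> x * g (eps k x))"
    proof (rule Bochner_Integration.integrable_bound[OF int])
      show "AE x in M. norm (\<delta> x * g (eps k x)) \<le> norm (g (eps k x))"
        using \<delta>b by eventually_elim (simp add: abs_mult mult_left_le_one_le)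
    qed auto
  qed auto
  also have "\<dots> = (\<integral>x. real_cond_exp M F (\<lambda>x. g (eps k x)) x * \<delta> x \<partial>M)" by (simp add: mult.commute)
  also have "\<dots> = (\<integral>x. real_cond_exp M F (\<lambda>x. g (eps k x)) x * indicator D x \<partial>M)"
    unfolding \<delta>_def
  proof (rule Q.real_cond_exp_intg(2))
    show "integrable M (\<lambda>x. real_cond_exp M F (\<lambda>x. g (eps k x)) x * indicator D x)"
      using integrable_mult_indicator[OF DM Q.real_cond_exp_int(1)[OF int]] by (simp add: mult.commute)
  qed auto
  finally show ?thesis by (simp add: mult.commute)
qed

text \<open>Applied to the identity, the square and the absolute cube, this carries the moment
  conditions of the model from \<open>F\<close> to the enlarged past.\<close>

lemma real_cond_exp_past:
  fixes g :: "real \<Rightarrow> real"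
  assumes k: "k < n" and g[measurable]: "g \<in> borel_measurable borel"
    and int: "integrable M (\<lambda>x. g (eps k x))"
  shows "AE x in M. real_cond_exp M (past k) (\<lambda>x. g (eps k x)) x = real_cond_exp M F (\<lambda>x. g (eps k x)) x"
  unfolding past_def
proof (rule real_cond_exp_sigma_eqI[OF past_gen_Int_stable past_gen_sets space_in_past_gen int])
  interpret Q: sigma_finite_subalgebra M F by (rule sigma_finite_subalgebraI[OF F])
  show "k \<le> n" using k by simp
  show "integrable M (real_cond_exp M F (\<lambda>x. g (eps k x)))" by (rule Q.real_cond_exp_int[OF int])
  show "real_cond_exp M F (\<lambda>x. g (eps k x)) \<in> borel_measurable (sigma (space M) (past_gen k))"
    using F_past[of k "real_cond_exp M F (\<lambda>x. g (eps k x))"] k unfolding past_def by simp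
  fix D assume "D \<in> past_gen k"
  then show "(LINT x:D|M. g (eps k x)) = (LINT x:D|M. real_cond_exp M F (\<lambda>x. g (eps k x)) x)"
    using integral_past_gen[OF k _ g int] unfolding set_lebesgue_integral_def by simp
qed

end

section \<open>Limit theorems for martingale differences\<close>

text \<open>The upper bound comes from \<open>exp w \<ge> 1 + w + w\<^sup>2 / 2\<close> and from the
  fact that \<open>1 - w + w\<^sup>2 / 2\<close> times \<open>1 + w + w\<^sup>2 / 2\<close> is
  \<open>1 + w ^ 4 / 4\<close>.\<close>

lemma exp_minus_approx: "0 \<le> w \<Longrightarrow> \<bar>exp (- w) - (1 - w)\<bar> \<le> w\<^sup>2 / 2" for w :: real
proof -
  assume w: "0 \<le> w"
  have pos: "0 < 1 + w + w\<^sup>2 / 2" using w by (simp add: add_pos_nonneg)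
  have "exp (- w) \<le> 1 / (1 + w + w\<^sup>2 / 2)"
    using exp_lower_Taylor_quadratic[OF w] pos by (simp add: exp_minus field_simps)
  also have "\<dots> \<le> 1 - w + w\<^sup>2 / 2"
  proof -
    have "(1 - w + w\<^sup>2 / 2) * (1 + w + w\<^sup>2 / 2) = 1 + w ^ 4 / 4"
      by (simp add: power2_eq_square power4_eq_xxxx algebra_simps)
    then show ?thesis using pos by (simp add: divide_le_eq)
  qed
  finally show ?thesis using exp_ge_add_one_self[of "- w"] by simp
qed

text \<open>\<open>H k\<close> is the information just before \<open>eps k\<close>: it contains the
  errors with index below \<open>k\<close>, and the moments of \<open>eps k\<close> are conditional
  on it.\<close>

locale martingale_errors = prob_space M for M :: "'a measure" +
  fixes n :: nat and H :: "nat \<Rightarrow> 'a measure" and eps :: "nat \<Rightarrow> 'a \<Rightarrow> real" and s2 Mb :: real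
  assumes H: "\<And>k. k < n \<Longrightarrow> subalgebra M (H k)"
    and eps_H: "\<And>j k. j < k \<Longrightarrow> k < n \<Longrightarrow> eps j \<in> borel_measurable (H k)"
    and eps1: "\<And>k. k < n \<Longrightarrow> integrable M (eps k)"
    and eps2: "\<And>k. k < n \<Longrightarrow> integrable M (\<lambda>x. (eps k x)\<^sup>2)"
    and eps3: "\<And>k. k < n \<Longrightarrow> integrable M (\<lambda>x. \<bar>eps k x\<bar> ^ 3)"
    and mean0: "\<And>k. k < n \<Longrightarrow> AE x in M. real_cond_exp M (H k) (eps k) x = 0"
    and var: "\<And>k. k < n \<Longrightarrow> AE x in M. real_cond_exp M (H k) (\<lambda>x. (eps k x)\<^sup>2) x = s2"
    and third: "\<And>k. k < n \<Longrightarrow> AE x in M. real_cond_exp M (H k) (\<lambda>x. \<bar>eps k x\<bar> ^ 3) x \<le> Mb"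
    and s2: "0 \<le> s2"
begin

lemma eps_meas: "k < n \<Longrightarrow> eps k \<in> borel_measurable M"
  using eps1 by (rule borel_measurable_integrable)

lemma H_imp_M: "k < n \<Longrightarrow> u \<in> borel_measurable (H k) \<Longrightarrow> u \<in> borel_measurable M"
  by (rule measurable_from_subalg[OF H])

lemma integrable_bounded_mult:
  fixes u :: "'a \<Rightarrow> 'b :: {real_normed_field, second_countable_topology, banach}" and f :: "'a \<Rightarrow> real"
  assumes f: "integrable M f" and u[measurable]: "u \<in> borel_measurable M" and C: "\<And>x. norm (u x) \<le> C"
  shows "integrable M (\<lambda>x. u x * of_real (f x))"
proof (rule Bochner_Integration.integrable_bound)
  note [measurable] = borel_measurable_integrable[OF f]
  show "integrable M (\<lambda>x. C * f x)" using f by simp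
  show "(\<lambda>x. u x * of_real (f x)) \<in> borel_measurable M" by measurable
  have "norm (u x) * \<bar>f x\<bar> \<le> \<bar>C * f x\<bar>" for x
    using mult_right_mono[OF order_trans[OF C abs_ge_self], of "\<bar>f x\<bar>"] by (simp add: abs_mult)
  then show "AE x in M. norm (u x * of_real (f x)) \<le> norm (C * f x)" by (simp add: norm_mult)
qed

lemma integral_mult_eps:
  assumes k: "k < n" and u: "u \<in> borel_measurable (H k)" and i: "integrable M (\<lambda>x. u x * eps k x)"
  shows "(\<integral>x. u x * eps k x \<partial>M) = 0"
  using integral_mult_real_cond_exp(2)[OF H[OF k] u eps_meas[OF k] i _ mean0[OF k]] by simp

lemma integral_mult_eps2:
  assumes k: "k < n" and u: "u \<in> borel_measurable (H k)" and C: "\<And>x. \<bar>u x\<bar> \<le> C"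
  shows "(\<integral>x. u x * ((eps k x)\<^sup>2 - s2) \<partial>M) = 0"
proof -
  have uM: "u \<in> borel_measurable M" by (rule H_imp_M[OF k u])
  have 1: "integrable M (\<lambda>x. u x * (eps k x)\<^sup>2)"
    using integrable_bounded_mult[OF eps2[OF k] uM, of C] C by simp
  have 2: "integrable M (\<lambda>x. u x * s2)"
    using integrable_bounded_mult[of "\<lambda>_. s2" u C] uM C by simp
  have "(\<integral>x. u x * (eps k x)\<^sup>2 \<partial>M) = (\<integral>x. u x * s2 \<partial>M)"
    by (rule integral_mult_real_cond_exp(2)[OF H[OF k] u _ 1 _ var[OF k]]) (use eps_meas[OF k] in auto)
  then show ?thesis using 1 2 by (simp add: right_diff_distrib)
qed

lemma integral_mult_eps3:
  assumes k: "k < n" and u: "u \<in> borel_measurable (H k)" and C: "\<And>x. 0 \<le> u x \<and> u x \<le> C"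
  shows "(\<integral>x. u x * \<bar>eps k x\<bar> ^ 3 \<partial>M) \<le> Mb * (\<integral>x. u x \<partial>M)"
proof -
  interpret S: sigma_finite_subalgebra M "H k" by (rule sigma_finite_subalgebraI[OF H[OF k]])
  have uM[measurable]: "u \<in> borel_measurable M" by (rule H_imp_M[OF k u])
  have C': "norm (u x) \<le> C" for x using C[of x] by simp
  have 1: "integrable M (\<lambda>x. u x * \<bar>eps k x\<bar> ^ 3)"
    using integrable_bounded_mult[OF eps3[OF k] uM C'] by simp
  have 2: "integrable M u"
    using integrable_bounded_mult[of "\<lambda>_. 1" u C] uM C' by simp
  note [measurable] = eps_meas[OF k]
  have "(\<integral>x. u x * \<bar>eps k x\<bar> ^ 3 \<partial>M) = (\<integral>x. u x * real_cond_exp M (H k) (\<lambda>x. \<bar>eps k x\<bar> ^ 3) x \<partial>M)"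
    by (rule S.real_cond_exp_intg(2)[OF 1 u, symmetric]) measurable
  also have "\<dots> \<le> (\<integral>x. Mb * u x \<partial>M)"
  proof (rule integral_mono_AE)
    show "integrable M (\<lambda>x. u x * real_cond_exp M (H k) (\<lambda>x. \<bar>eps k x\<bar> ^ 3) x)"
      by (rule S.real_cond_exp_intg(1)[OF 1 u]) measurable
    show "integrable M (\<lambda>x. Mb * u x)" using 2 by simp
    show "AE x in M. u x * real_cond_exp M (H k) (\<lambda>x. \<bar>eps k x\<bar> ^ 3) x \<le> Mb * u x"
      using third[OF k]
    proof eventually_elim
      case (elim x)
      show ?case using mult_left_mono[OF elim, of "u x"] C[of x] by (simp add: mult.commute)
    qed
  qed
  finally show ?thesis by simp
qed

text \<open>\<open>real_cond_exp\<close> is real-valued, so the complex weights from characteristic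
  functions are treated through real and imaginary parts.\<close>

lemma complex_integral_eq_0:
  fixes u :: "'a \<Rightarrow> complex" and f :: "'a \<Rightarrow> real"
  assumes u: "u \<in> borel_measurable M" and C: "\<And>x. cmod (u x) \<le> C" and f: "integrable M f"
    and re: "(\<integral>x. Re (u x) * f x \<partial>M) = 0" and im: "(\<integral>x. Im (u x) * f x \<partial>M) = 0"
  shows "(\<integral>x. u x * of_real (f x) \<partial>M) = 0"
proof -
  have i: "integrable M (\<lambda>x. u x * complex_of_real (f x))"
    by (rule integrable_bounded_mult[OF f u C])
  show ?thesis
  proof (rule complex_eqI)
    show "Re (\<integral>x. u x * of_real (f x) \<partial>M) = Re 0"
      using integral_Re[OF i] re by simp
    show "Im (\<integral>x. u x * of_real (f x) \<partial>M) = Im 0"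
      using integral_Im[OF i] im by simp
  qed
qed

lemma complex_integral_eps:
  assumes k: "k < n" and u[measurable]: "u \<in> borel_measurable (H k)" and C: "\<And>x. cmod (u x) \<le> C"
  shows "(\<integral>x. u x * of_real (eps k x) \<partial>M) = 0"
proof (rule complex_integral_eq_0[OF H_imp_M[OF k u] C eps1[OF k]])
  have R: "(\<lambda>x. Re (u x)) \<in> borel_measurable (H k)" "(\<lambda>x. Im (u x)) \<in> borel_measurable (H k)" by measurable
  have b: "norm (Re (u x)) \<le> C" "norm (Im (u x)) \<le> C" for x
    using abs_Re_le_cmod[of "u x"] abs_Im_le_cmod[of "u x"] C[of x] by auto
  show "(\<integral>x. Re (u x) * eps k x \<partial>M) = 0"
    by (rule integral_mult_eps[OF k R(1)])
      (use integrable_bounded_mult[OF eps1[OF k] H_imp_M[OF k R(1)] b(1)] in simp)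
  show "(\<integral>x. Im (u x) * eps k x \<partial>M) = 0"
    by (rule integral_mult_eps[OF k R(2)])
      (use integrable_bounded_mult[OF eps1[OF k] H_imp_M[OF k R(2)] b(2)] in simp)
qed

lemma complex_integral_eps2:
  assumes k: "k < n" and u[measurable]: "u \<in> borel_measurable (H k)" and C: "\<And>x. cmod (u x) \<le> C"
  shows "(\<integral>x. u x * of_real ((eps k x)\<^sup>2 - s2) \<partial>M) = 0"
proof (rule complex_integral_eq_0[OF H_imp_M[OF k u] C])
  have R: "(\<lambda>x. Re (u x)) \<in> borel_measurable (H k)" "(\<lambda>x. Im (u x)) \<in> borel_measurable (H k)" by measurable
  have b: "\<bar>Re (u x)\<bar> \<le> C" "\<bar>Im (u x)\<bar> \<le> C" for x
    using abs_Re_le_cmod[of "u x"] abs_Im_le_cmod[of "u x"] C[of x] by auto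
  show "integrable M (\<lambda>x. (eps k x)\<^sup>2 - s2)" using eps2[OF k] by simp
  show "(\<integral>x. Re (u x) * ((eps k x)\<^sup>2 - s2) \<partial>M) = 0" by (rule integral_mult_eps2[OF k R(1) b(1)])
  show "(\<integral>x. Im (u x) * ((eps k x)\<^sup>2 - s2) \<partial>M) = 0" by (rule integral_mult_eps2[OF k R(2) b(2)])
qed

text \<open>Lindeberg's replacement argument: the factors \<open>exp (i t a\<^sub>k \<epsilon>\<^sub>k)\<close> are exchanged one at a time
  for their Gaussian counterparts. As the weights are predictable, the first two moments cancel
  and no conditional distribution is needed.\<close>

lemma char_weighted_sum:
  fixes a :: "nat \<Rightarrow> 'a \<Rightarrow> real"
  assumes a: "\<And>j k. j < n \<Longrightarrow> k < n \<Longrightarrow> a j \<in> borel_measurable (H k)"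
    and C: "\<And>j x. j < n \<Longrightarrow> \<bar>a j x\<bar> \<le> C"
  shows "cmod ((\<integral>x. iexp (t * (\<Sum>j<n. a j x * eps j x)) \<partial>M)
      - (\<integral>x. complex_of_real (exp (- (t\<^sup>2 * (s2 * (\<Sum>j<n. (a j x)\<^sup>2))) / 2)) \<partial>M))
    \<le> (\<bar>t\<bar> ^ 3 * Mb / 6 + t ^ 4 * s2\<^sup>2 * C / 8) * (\<Sum>j<n. \<integral>x. \<bar>a j x\<bar> ^ 3 \<partial>M)"
proof -
  \<comment> \<open>\<open>W k\<close> keeps the first \<open>k\<close> true terms and has Gaussian
    factors for the terms from \<open>k\<close> on, \<open>v k\<close> being their remaining
    variance; \<open>W n\<close> and \<open>W 0\<close> are the two ends of the replacement.\<close>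
  define S where "S = (\<lambda>k x. \<Sum>j<k. a j x * eps j x)"
  define v where "v = (\<lambda>k x. s2 * (\<Sum>j=k..<n. (a j x)\<^sup>2))"
  define W where "W = (\<lambda>k x. iexp (t * S k x) * complex_of_real (exp (- (t\<^sup>2 * v k x) / 2)))"
  define K where "K = \<bar>t\<bar> ^ 3 * Mb / 6 + t ^ 4 * s2\<^sup>2 * C / 8"
  have aM: "a j \<in> borel_measurable M" if "j < n" for j
    using H_imp_M[OF that a[OF that that]] .
  have Wn: "W n x = iexp (t * (\<Sum>j<n. a j x * eps j x))" for x
    by (simp add: W_def S_def v_def)
  have W0: "W 0 x = complex_of_real (exp (- (t\<^sup>2 * (s2 * (\<Sum>j<n. (a j x)\<^sup>2))) / 2))" for x
    by (simp add: W_def S_def v_def atLeast0LessThan)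
  have v0: "0 \<le> v k x" for k x unfolding v_def using s2 by (simp add: sum_nonneg)
  have W1: "cmod (iexp y * complex_of_real (exp (- (t\<^sup>2 * v k x) / 2))) \<le> 1" for y k x
    using v0[of k x] by (simp add: norm_mult)
  have step: "cmod ((\<integral>x. W (Suc k) x \<partial>M) - (\<integral>x. W k x \<partial>M)) \<le> K * (\<integral>x. \<bar>a k x\<bar> ^ 3 \<partial>M)" if k: "k < n" for k
  proof -
    note [measurable] = a[OF _ k] eps_H[OF _ k]
    have [measurable]: "a j \<in> borel_measurable (H k)" "eps j \<in> borel_measurable (H k)" if "j < k" for j
      using that k a eps_H by auto
    have [measurable]: "S k \<in> borel_measurable (H k)"
      unfolding S_def by (rule borel_measurable_sum) auto
    have [measurable]: "v m \<in> borel_measurable (H k)" for m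
      unfolding v_def by (intro borel_measurable_times borel_measurable_sum borel_measurable_power borel_measurable_const) (auto intro: a k)
    \<comment> \<open>The common factor of \<open>W k\<close> and \<open>W (Suc k)\<close>. It
      involves weights with index above \<open>k\<close> and is \<open>H k\<close>-measurable
      because every weight is measurable for every \<open>H k\<close>.\<close>
    define U where "U = (\<lambda>x. iexp (t * S k x) * complex_of_real (exp (- (t\<^sup>2 * v (Suc k) x) / 2)))"
    have UH[measurable]: "U \<in> borel_measurable (H k)"
      unfolding U_def by measurable
    have U1: "cmod (U x) \<le> 1" for x unfolding U_def by (rule W1)
    have UM: "U \<in> borel_measurable M" by (rule H_imp_M[OF k UH])
    have akM: "a k \<in> borel_measurable M" by (rule aM[OF k])
    have akH[measurable]: "a k \<in> borel_measurable (H k)" by (rule a[OF k k])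
    define y where "y = (\<lambda>x. t * (a k x * eps k x))"
    define w where "w = (\<lambda>x. t\<^sup>2 * (s2 * (a k x)\<^sup>2) / 2)"
    define u1 where "u1 = (\<lambda>x. U x * (\<i> * of_real (t * a k x)))"
    define u2 where "u2 = (\<lambda>x. U x * of_real (t\<^sup>2 * (a k x)\<^sup>2 / 2))"
    have u1H: "u1 \<in> borel_measurable (H k)" and u2H: "u2 \<in> borel_measurable (H k)"
      unfolding u1_def u2_def by measurable
    have C0: "0 \<le> C" using C[OF k, of undefined] by linarith
    have u1b: "cmod (u1 x) \<le> \<bar>t\<bar> * C" for x
      unfolding u1_def norm_mult using mult_mono[OF U1[of x] mult_left_mono[OF C[OF k, of x], of "\<bar>t\<bar>"]]
      by (simp add: norm_mult abs_mult)
    have u2b: "cmod (u2 x) \<le> t\<^sup>2 * C\<^sup>2 / 2" for x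
    proof -
      have "(a k x)\<^sup>2 \<le> C\<^sup>2" using C[OF k, of x] by (metis abs_ge_zero power2_abs power_mono)
      then have "t\<^sup>2 * (a k x)\<^sup>2 / 2 \<le> t\<^sup>2 * C\<^sup>2 / 2" by (simp add: mult_left_mono)
      then have "cmod (U x) * (t\<^sup>2 * (a k x)\<^sup>2 / 2) \<le> 1 * (t\<^sup>2 * C\<^sup>2 / 2)"
        by (intro mult_mono U1) auto
      moreover have "cmod (u2 x) = cmod (U x) * (t\<^sup>2 * (a k x)\<^sup>2 / 2)"
        unfolding u2_def norm_mult norm_of_real by simp
      ultimately show ?thesis by simp
    qed
    \<comment> \<open>Removing the first-order and the centred second-order term changes no
      integral: both have mean 0, as \<open>u1\<close> and \<open>u2\<close> are bounded and
      \<open>H k\<close>-measurable. A Taylor remainder is left.\<close>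
    define r where "r = (\<lambda>x. W (Suc k) x - W k x - u1 x * of_real (eps k x) + u2 x * of_real ((eps k x)\<^sup>2 - s2))"
    have WM: "integrable M (W m)" if "m \<le> n" for m
    proof (rule integrable_const_bound[where B=1])
      show "AE x in M. norm (W m x) \<le> 1" unfolding W_def by (rule AE_I2) (rule W1)
      have "S m \<in> borel_measurable M"
        unfolding S_def using that by (intro borel_measurable_sum borel_measurable_times aM eps_meas) auto
      moreover have "v m \<in> borel_measurable M"
        unfolding v_def by (intro borel_measurable_times borel_measurable_sum borel_measurable_power borel_measurable_const aM) auto
      ultimately show "W m \<in> borel_measurable M" unfolding W_def by measurable
    qed
    have i1: "integrable M (\<lambda>x. u1 x * complex_of_real (eps k x))"
      by (rule integrable_bounded_mult[OF eps1[OF k] H_imp_M[OF k u1H] u1b])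
    have i2: "integrable M (\<lambda>x. u2 x * complex_of_real ((eps k x)\<^sup>2 - s2))"
      by (rule integrable_bounded_mult[OF _ H_imp_M[OF k u2H] u2b]) (use eps2[OF k] in simp)
    have ir: "integrable M r"
      unfolding r_def using WM[of "Suc k"] WM[of k] k i1 i2 by (intro Bochner_Integration.integrable_add Bochner_Integration.integrable_diff) auto
    have "(\<integral>x. W (Suc k) x \<partial>M) - (\<integral>x. W k x \<partial>M) = (\<integral>x. r x \<partial>M)"
    proof -
      have "(\<integral>x. r x \<partial>M) = (\<integral>x. W (Suc k) x \<partial>M) - (\<integral>x. W k x \<partial>M)
          - (\<integral>x. u1 x * of_real (eps k x) \<partial>M) + (\<integral>x. u2 x * of_real ((eps k x)\<^sup>2 - s2) \<partial>M)"
        unfolding r_def using WM[of "Suc k"] WM[of k] k i1 i2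
        by (simp only: Bochner_Integration.integral_add Bochner_Integration.integral_diff
            Bochner_Integration.integrable_add Bochner_Integration.integrable_diff Suc_leI less_imp_le)
      then show ?thesis
        using complex_integral_eps[OF k u1H u1b] complex_integral_eps2[OF k u2H u2b] by simp
    qed
    then have "cmod ((\<integral>x. W (Suc k) x \<partial>M) - (\<integral>x. W k x \<partial>M)) \<le> (\<integral>x. cmod (r x) \<partial>M)"
      by (metis integral_norm_bound)
    also have "\<dots> \<le> (\<integral>x. \<bar>t\<bar> ^ 3 / 6 * (\<bar>a k x\<bar> ^ 3 * \<bar>eps k x\<bar> ^ 3) + t ^ 4 * s2\<^sup>2 * C / 8 * \<bar>a k x\<bar> ^ 3 \<partial>M)"
    proof (rule integral_mono)
      show "integrable M (\<lambda>x. cmod (r x))" using ir by simp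
      have b3: "norm (\<bar>a k x\<bar> ^ 3) \<le> C ^ 3" for x using C[OF k, of x] by (simp add: power_mono)
      have m3: "(\<lambda>x. \<bar>a k x\<bar> ^ 3) \<in> borel_measurable M" using akM by measurable
      have "integrable M (\<lambda>x. \<bar>a k x\<bar> ^ 3 * \<bar>eps k x\<bar> ^ 3)"
        using integrable_bounded_mult[OF eps3[OF k] m3 b3] by simp
      moreover have "integrable M (\<lambda>x. \<bar>a k x\<bar> ^ 3)"
        using integrable_bounded_mult[OF _ m3 b3, of "\<lambda>_. 1"] by simp
      ultimately show "integrable M (\<lambda>x. \<bar>t\<bar> ^ 3 / 6 * (\<bar>a k x\<bar> ^ 3 * \<bar>eps k x\<bar> ^ 3) + t ^ 4 * s2\<^sup>2 * C / 8 * \<bar>a k x\<bar> ^ 3)"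
        by (intro Bochner_Integration.integrable_add integrable_mult_right) auto
      fix x
      have vk: "v k x = s2 * (a k x)\<^sup>2 + v (Suc k) x"
        unfolding v_def using k by (simp add: sum.atLeast_Suc_lessThan distrib_left)
      have Wk: "W k x = U x * of_real (exp (- w x))"
      proof -
        have e: "- (t\<^sup>2 * v k x) / 2 = - (t\<^sup>2 * v (Suc k) x) / 2 + - w x"
          unfolding vk w_def by (simp add: field_simps)
        show ?thesis unfolding W_def U_def e exp_add by simp
      qed
      have WS: "W (Suc k) x = U x * iexp (y x)"
      proof -
        have e: "\<i> * complex_of_real (t * S (Suc k) x) = \<i> * complex_of_real (t * S k x) + \<i> * complex_of_real (y x)"
          unfolding y_def S_def by (simp add: distrib_left)
        show ?thesis unfolding W_def U_def e exp_add by simp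
      qed
      have taylor: "(\<Sum>m\<le>2. (\<i> * complex_of_real (y x)) ^ m / fact m) = 1 + \<i> * of_real (y x) - of_real ((y x)\<^sup>2 / 2)"
        by (simp add: eval_nat_numeral power_mult_distrib)
      have rx: "r x = U x * ((iexp (y x) - (\<Sum>m\<le>2. (\<i> * complex_of_real (y x)) ^ m / fact m))
           - of_real (exp (- w x) - (1 - w x)))"
      proof -
        have 1: "u1 x * of_real (eps k x) = U x * (\<i> * of_real (y x))"
          unfolding u1_def y_def by simp
        have 2: "u2 x * of_real ((eps k x)\<^sup>2 - s2) = U x * of_real ((y x)\<^sup>2 / 2 - w x)"
        proof -
          have "t\<^sup>2 * (a k x)\<^sup>2 / 2 * ((eps k x)\<^sup>2 - s2) = (y x)\<^sup>2 / 2 - w x"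
            unfolding y_def w_def by (simp add: power_mult_distrib field_simps)
          then show ?thesis unfolding u2_def mult.assoc of_real_mult[symmetric] by (simp only:)
        qed
        show ?thesis
          unfolding r_def taylor Wk WS 1 2 by (simp add: algebra_simps)
      qed
      have tri: "cmod (A - complex_of_real B) \<le> cmod A + \<bar>B\<bar>" for A B
        by (rule order.trans[OF norm_triangle_ineq4]) simp
      have w0: "0 \<le> w x" unfolding w_def using s2 by simp
      have "cmod (r x) \<le> 1 * (cmod (iexp (y x) - (\<Sum>m\<le>2. (\<i> * complex_of_real (y x)) ^ m / fact m))
           + \<bar>exp (- w x) - (1 - w x)\<bar>)"
        unfolding rx norm_mult
        by (rule mult_mono[OF U1 tri]) (rule zero_le_one, rule norm_ge_zero)
      also have "\<dots> \<le> 1 * (\<bar>y x\<bar> ^ 3 / 6 + (w x)\<^sup>2 / 2)"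
        using iexp_approx1[of "y x" 2] exp_minus_approx[OF w0]
        by (intro mult_left_mono add_mono) (auto simp: eval_nat_numeral)
      also have "\<dots> \<le> \<bar>t\<bar> ^ 3 / 6 * (\<bar>a k x\<bar> ^ 3 * \<bar>eps k x\<bar> ^ 3) + t ^ 4 * s2\<^sup>2 * C / 8 * \<bar>a k x\<bar> ^ 3"
      proof -
        \<comment> \<open>\<open>w\<close> is quadratic in the weight, so its square has order four;
          one factor is bounded by \<open>C\<close> to match the cubic order of the other
          remainder.\<close>
        have "(w x)\<^sup>2 / 2 = t ^ 4 * s2\<^sup>2 / 8 * (\<bar>a k x\<bar> * \<bar>a k x\<bar> ^ 3)"
          unfolding w_def by (simp add: power2_eq_square power4_eq_xxxx power3_eq_cube field_simps)
        also have "\<dots> \<le> t ^ 4 * s2\<^sup>2 / 8 * (C * \<bar>a k x\<bar> ^ 3)"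
          by (intro mult_left_mono mult_right_mono C[OF k]) auto
        finally have "(w x)\<^sup>2 / 2 \<le> t ^ 4 * s2\<^sup>2 * C / 8 * \<bar>a k x\<bar> ^ 3" by simp
        moreover have "\<bar>y x\<bar> ^ 3 / 6 = \<bar>t\<bar> ^ 3 / 6 * (\<bar>a k x\<bar> ^ 3 * \<bar>eps k x\<bar> ^ 3)"
          unfolding y_def by (simp add: abs_mult power_mult_distrib)
        ultimately show ?thesis by simp
      qed
      finally show "cmod (r x) \<le> \<bar>t\<bar> ^ 3 / 6 * (\<bar>a k x\<bar> ^ 3 * \<bar>eps k x\<bar> ^ 3) + t ^ 4 * s2\<^sup>2 * C / 8 * \<bar>a k x\<bar> ^ 3" .
    qed
    also have "\<dots> = \<bar>t\<bar> ^ 3 / 6 * (\<integral>x. \<bar>a k x\<bar> ^ 3 * \<bar>eps k x\<bar> ^ 3 \<partial>M) + t ^ 4 * s2\<^sup>2 * C / 8 * (\<integral>x. \<bar>a k x\<bar> ^ 3 \<partial>M)"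
    proof -
      have b3: "norm (\<bar>a k x\<bar> ^ 3) \<le> C ^ 3" for x using C[OF k, of x] by (simp add: power_mono)
      have m3: "(\<lambda>x. \<bar>a k x\<bar> ^ 3) \<in> borel_measurable M" using akM by measurable
      have "integrable M (\<lambda>x. \<bar>a k x\<bar> ^ 3 * \<bar>eps k x\<bar> ^ 3)"
        using integrable_bounded_mult[OF eps3[OF k] m3 b3] by simp
      moreover have "integrable M (\<lambda>x. \<bar>a k x\<bar> ^ 3)"
        using integrable_bounded_mult[OF _ m3 b3, of "\<lambda>_. 1"] by simp
      ultimately show ?thesis by (subst Bochner_Integration.integral_add) auto
    qed
    also have "\<dots> \<le> \<bar>t\<bar> ^ 3 / 6 * (Mb * (\<integral>x. \<bar>a k x\<bar> ^ 3 \<partial>M)) + t ^ 4 * s2\<^sup>2 * C / 8 * (\<integral>x. \<bar>a k x\<bar> ^ 3 \<partial>M)"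
    proof (intro add_mono mult_left_mono order_refl integral_mult_eps3[OF k])
      show "(\<lambda>x. \<bar>a k x\<bar> ^ 3) \<in> borel_measurable (H k)" by measurable
      show "0 \<le> \<bar>a k x\<bar> ^ 3 \<and> \<bar>a k x\<bar> ^ 3 \<le> C ^ 3" for x
        using C[OF k, of x] by (simp add: power_mono)
    qed (use C0 in simp_all)
    also have "\<dots> = K * (\<integral>x. \<bar>a k x\<bar> ^ 3 \<partial>M)" unfolding K_def by (simp add: algebra_simps)
    finally show ?thesis .
  qed
  have "(\<integral>x. W n x \<partial>M) - (\<integral>x. W 0 x \<partial>M) = (\<Sum>k<n. (\<integral>x. W (Suc k) x \<partial>M) - (\<integral>x. W k x \<partial>M))"
    using sum_lessThan_telescope[of "\<lambda>k. \<integral>x. W k x \<partial>M" n] by simp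
  then have "cmod ((\<integral>x. W n x \<partial>M) - (\<integral>x. W 0 x \<partial>M)) \<le> (\<Sum>k<n. cmod ((\<integral>x. W (Suc k) x \<partial>M) - (\<integral>x. W k x \<partial>M)))"
    by (simp only: norm_sum)
  also have "\<dots> \<le> (\<Sum>k<n. K * (\<integral>x. \<bar>a k x\<bar> ^ 3 \<partial>M))"
    by (rule sum_mono) (simp add: step)
  also have "\<dots> = K * (\<Sum>k<n. \<integral>x. \<bar>a k x\<bar> ^ 3 \<partial>M)" by (simp add: sum_distrib_left)
  finally show ?thesis unfolding Wn W0 K_def .
qed

end

text \<open>The function \<open>x\<^sup>2 / (1 + x\<^sup>2)\<close> replaces \<open>x\<^sup>2\<close> in the weak law below: only moments of order
  \<open>3/2\<close> of \<open>\<epsilon>\<^sub>k\<^sup>2 - \<sigma>\<^sup>2\<close> are available, so Chebyshev's inequality does not apply. The case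
  \<open>|y| \<le> 1\<close> is concavity of \<open>u / (1 + u)\<close>.\<close>

lemma bounded_square_step:
  fixes x y :: real
  shows "(x + y)\<^sup>2 / (1 + (x + y)\<^sup>2) \<le> x\<^sup>2 / (1 + x\<^sup>2) + 2 * x / (1 + x\<^sup>2)\<^sup>2 * y + 2 * (\<bar>y\<bar> * sqrt \<bar>y\<bar>)"
proof (cases "\<bar>y\<bar> \<le> 1")
  case True
  define u v where "u = (x + y)\<^sup>2" and "v = x\<^sup>2"
  have uv: "0 \<le> u" "0 \<le> v" by (auto simp: u_def v_def)
  \<comment> \<open>The right side minus the left is \<open>(u - v)\<^sup>2\<close>; after division
    this is the tangent inequality at \<open>v\<close>.\<close>
  have "u * (1 + v)\<^sup>2 \<le> (v\<^sup>2 + u) * (1 + u)"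
    using zero_le_power2[of "u - v"] by (simp add: power2_eq_square algebra_simps)
  then have "u / (1 + u) \<le> (v\<^sup>2 + u) / (1 + v)\<^sup>2"
    using uv by (simp add: divide_simps add_pos_nonneg)
  also have "\<dots> = v / (1 + v) + (u - v) / (1 + v)\<^sup>2"
    using uv by (simp add: divide_simps add_nonneg_eq_0_iff power2_eq_square) (simp add: algebra_simps)
  also have "(u - v) / (1 + v)\<^sup>2 = 2 * x / (1 + x\<^sup>2)\<^sup>2 * y + y\<^sup>2 / (1 + v)\<^sup>2"
    unfolding u_def v_def by (simp add: power2_sum add_divide_distrib mult_ac)
  also have "y\<^sup>2 / (1 + v)\<^sup>2 \<le> y\<^sup>2 / 1"
    using uv by (intro divide_left_mono) (auto simp: one_le_power)
  also have "y\<^sup>2 / 1 = \<bar>y\<bar> * \<bar>y\<bar>" by (simp add: power2_eq_square)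
  also have "\<dots> \<le> \<bar>y\<bar> * sqrt \<bar>y\<bar>"
  proof (rule mult_left_mono)
    have "\<bar>y\<bar> * \<bar>y\<bar> \<le> \<bar>y\<bar>" by (rule mult_left_le[OF True abs_ge_zero])
    then show "\<bar>y\<bar> \<le> sqrt \<bar>y\<bar>" by (intro real_le_rsqrt) (simp only: power2_eq_square)
  qed simp
  also have "\<dots> \<le> 2 * (\<bar>y\<bar> * sqrt \<bar>y\<bar>)" by simp
  finally show ?thesis unfolding u_def v_def by simp
next
  case False
  have p1: "(x + y)\<^sup>2 / (1 + (x + y)\<^sup>2) \<le> 1"
  proof -
    have "0 < 1 + (x + y)\<^sup>2" by (simp add: add_pos_nonneg)
    then show ?thesis by (simp add: divide_le_eq)
  qed
  have "\<bar>2 * x\<bar> \<le> 1 + x\<^sup>2" using zero_le_power2[of "\<bar>x\<bar> - 1"] by (simp add: power2_diff)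
  also have "\<dots> \<le> (1 + x\<^sup>2)\<^sup>2" by (rule self_le_power) auto
  finally have "\<bar>2 * x / (1 + x\<^sup>2)\<^sup>2\<bar> \<le> 1" by (simp add: divide_le_eq)
  from mult_right_mono[OF this abs_ge_zero[of y]]
  have "\<bar>2 * x / (1 + x\<^sup>2)\<^sup>2 * y\<bar> \<le> \<bar>y\<bar>" by (simp only: abs_mult mult_1)
  then have "- \<bar>y\<bar> \<le> 2 * x / (1 + x\<^sup>2)\<^sup>2 * y" by linarith
  moreover have "\<bar>y\<bar> * 1 \<le> \<bar>y\<bar> * sqrt \<bar>y\<bar>" using False by (intro mult_left_mono) auto
  moreover have "0 \<le> x\<^sup>2 / (1 + x\<^sup>2)" by simp
  ultimately show ?thesis using p1 False by linarith
qed

text \<open>This is the power 3/2 of \<open>|e\<^sup>2 - s| \<le> max (e\<^sup>2) s\<close>; it is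
  controlled by the third absolute moment, the highest one assumed.\<close>

lemma abs_mult_sqrt_diff_le:
  fixes e s :: real
  assumes s: "0 \<le> s"
  shows "\<bar>e\<^sup>2 - s\<bar> * sqrt \<bar>e\<^sup>2 - s\<bar> \<le> \<bar>e\<bar> ^ 3 + s * sqrt s"
proof -
  have e3: "e\<^sup>2 * sqrt (e\<^sup>2) = \<bar>e\<bar> ^ 3" by (simp add: power2_eq_square power3_eq_cube)
  have "\<bar>e\<^sup>2 - s\<bar> * sqrt \<bar>e\<^sup>2 - s\<bar> \<le> max (e\<^sup>2) s * sqrt (max (e\<^sup>2) s)"
    using s by (intro mult_mono) (auto simp: abs_le_iff max_def intro: real_sqrt_le_mono)
  also have "\<dots> \<le> e\<^sup>2 * sqrt (e\<^sup>2) + s * sqrt s" using s by (auto simp: max_def)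
  finally show ?thesis unfolding e3 .
qed

section \<open>Weak law for the squared errors and second moments of weighted sums\<close>

context martingale_errors
begin

text \<open>One use of \<open>bounded_square_step\<close> per summand: the linear term integrates to
  0 because its coefficient is bounded and \<open>H k\<close>-measurable, and the remainder has
  order \<open>c * sqrt c\<close>. For \<open>c = 1 / n\<close> the total has order
  \<open>1 / sqrt n\<close>.\<close>

lemma integral_bounded_square_le:
  assumes c: "0 \<le> c"
  shows "(\<integral>x. (c * (\<Sum>k<n. (eps k x)\<^sup>2 - s2))\<^sup>2 / (1 + (c * (\<Sum>k<n. (eps k x)\<^sup>2 - s2))\<^sup>2) \<partial>M)
    \<le> real n * (2 * (c * sqrt c * (Mb + s2 * sqrt s2)))"
proof -
  define T where "T = (\<lambda>k x. c * (\<Sum>j<k. (eps j x)\<^sup>2 - s2))"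
  define \<phi> where "\<phi> = (\<lambda>x :: real. x\<^sup>2 / (1 + x\<^sup>2))"
  have [measurable]: "\<phi> \<in> borel_measurable borel" unfolding \<phi>_def by measurable
  have \<phi>01: "0 \<le> \<phi> y \<and> \<phi> y \<le> 1" for y
  proof -
    have "0 < 1 + y\<^sup>2" by (simp add: add_pos_nonneg)
    then show ?thesis unfolding \<phi>_def by (simp add: divide_le_eq)
  qed
  define \<psi> where "\<psi> = (\<lambda>x :: real. 2 * x / (1 + x\<^sup>2)\<^sup>2)"
  have [measurable]: "\<psi> \<in> borel_measurable borel" unfolding \<psi>_def by measurable
  have \<psi>1: "\<bar>\<psi> x\<bar> \<le> 1" for x
  proof -
    have "\<bar>2 * x\<bar> \<le> 1 + x\<^sup>2" using zero_le_power2[of "\<bar>x\<bar> - 1"] by (simp add: power2_diff)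
    also have "\<dots> \<le> (1 + x\<^sup>2)\<^sup>2" by (rule self_le_power) auto
    finally show ?thesis unfolding \<psi>_def by (simp add: divide_le_eq)
  qed
  have "(\<integral>x. \<phi> (T k x) \<partial>M) \<le> real k * (2 * (c * sqrt c * (Mb + s2 * sqrt s2)))" if "k \<le> n" for k
    using that
  proof (induction k)
    case 0
    then show ?case by (simp add: T_def \<phi>_def)
  next
    case (Suc k)
    then have k: "k < n" by simp
    define d where "d = (\<lambda>x. (eps k x)\<^sup>2 - s2)"
    have T_Suc: "T (Suc k) x = T k x + c * d x" for x by (simp add: T_def d_def distrib_left)
    have TM: "T m \<in> borel_measurable M" if "m \<le> n" for m
      unfolding T_def using that
      by (intro borel_measurable_times borel_measurable_sum borel_measurable_diff borel_measurable_power borel_measurable_const eps_meas) auto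
    have TH[measurable]: "T k \<in> borel_measurable (H k)"
      unfolding T_def
      by (intro borel_measurable_times borel_measurable_sum borel_measurable_diff borel_measurable_power borel_measurable_const eps_H[OF _ k]) auto
    have i\<phi>: "integrable M (\<lambda>x. \<phi> (T m x))" if "m \<le> n" for m
      by (rule integrable_const_bound[where B=1]) (use TM[OF that] \<phi>01 in auto)
    have \<psi>H: "(\<lambda>x. c * \<psi> (T k x)) \<in> borel_measurable (H k)" by measurable
    have \<psi>b: "\<bar>c * \<psi> (T k x)\<bar> \<le> c" for x
      using mult_left_mono[OF \<psi>1[of "T k x"] c] c by (simp add: abs_mult)
    have id: "integrable M d" unfolding d_def using eps2[OF k] by simp
    have i\<psi>: "integrable M (\<lambda>x. c * \<psi> (T k x) * d x)"
      using integrable_bounded_mult[OF id H_imp_M[OF k \<psi>H], of c] \<psi>b by simp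
    have "(\<integral>x. \<phi> (T (Suc k) x) \<partial>M) \<le> (\<integral>x. \<phi> (T k x) + c * \<psi> (T k x) * d x
        + 2 * (c * sqrt c) * (\<bar>eps k x\<bar> ^ 3 + s2 * sqrt s2) \<partial>M)"
    proof (rule integral_mono)
      show "integrable M (\<lambda>x. \<phi> (T (Suc k) x))" using i\<phi> Suc.prems by simp
      show "integrable M (\<lambda>x. \<phi> (T k x) + c * \<psi> (T k x) * d x + 2 * (c * sqrt c) * (\<bar>eps k x\<bar> ^ 3 + s2 * sqrt s2))"
        using i\<phi>[of k] i\<psi> eps3[OF k] k by simp
      fix x
      have "\<bar>c * d x\<bar> * sqrt \<bar>c * d x\<bar> = (c * sqrt c) * (\<bar>d x\<bar> * sqrt \<bar>d x\<bar>)"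
        using c by (simp add: abs_mult real_sqrt_mult)
      also have "\<dots> \<le> (c * sqrt c) * (\<bar>eps k x\<bar> ^ 3 + s2 * sqrt s2)"
        using abs_mult_sqrt_diff_le[OF s2, of "eps k x"] c unfolding d_def by (intro mult_left_mono) auto
      finally have "2 * (\<bar>c * d x\<bar> * sqrt \<bar>c * d x\<bar>) \<le> 2 * (c * sqrt c) * (\<bar>eps k x\<bar> ^ 3 + s2 * sqrt s2)"
        by simp
      moreover have "\<phi> (T (Suc k) x) \<le> \<phi> (T k x) + \<psi> (T k x) * (c * d x) + 2 * (\<bar>c * d x\<bar> * sqrt \<bar>c * d x\<bar>)"
        unfolding T_Suc \<phi>_def \<psi>_def by (rule bounded_square_step)
      moreover have "\<psi> (T k x) * (c * d x) = c * \<psi> (T k x) * d x" by simp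
      ultimately show "\<phi> (T (Suc k) x) \<le> \<phi> (T k x) + c * \<psi> (T k x) * d x + 2 * (c * sqrt c) * (\<bar>eps k x\<bar> ^ 3 + s2 * sqrt s2)"
        by linarith
    qed
    also have "\<dots> = (\<integral>x. \<phi> (T k x) \<partial>M) + (\<integral>x. c * \<psi> (T k x) * d x \<partial>M)
        + 2 * (c * sqrt c) * ((\<integral>x. \<bar>eps k x\<bar> ^ 3 \<partial>M) + s2 * sqrt s2)"
      using i\<phi>[of k] i\<psi> eps3[OF k] k by (simp add: prob_space distrib_left)
    also have "(\<integral>x. c * \<psi> (T k x) * d x \<partial>M) = 0"
      unfolding d_def by (rule integral_mult_eps2[OF k \<psi>H \<psi>b])
    finally have 1: "(\<integral>x. \<phi> (T (Suc k) x) \<partial>M) \<le> (\<integral>x. \<phi> (T k x) \<partial>M)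
        + 2 * (c * sqrt c) * ((\<integral>x. \<bar>eps k x\<bar> ^ 3 \<partial>M) + s2 * sqrt s2)" by simp
    have "(\<integral>x. \<bar>eps k x\<bar> ^ 3 \<partial>M) \<le> Mb"
      using integral_mult_eps3[OF k, of "\<lambda>_. 1" 1] by (simp add: prob_space)
    then have 2: "2 * (c * sqrt c) * ((\<integral>x. \<bar>eps k x\<bar> ^ 3 \<partial>M) + s2 * sqrt s2) \<le> 2 * (c * sqrt c) * (Mb + s2 * sqrt s2)"
      using c by (intro mult_left_mono) auto
    have 3: "(\<integral>x. \<phi> (T k x) \<partial>M) \<le> real k * (2 * (c * sqrt c * (Mb + s2 * sqrt s2)))"
      using Suc by simp
    have "real (Suc k) * (2 * (c * sqrt c * (Mb + s2 * sqrt s2)))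
        = real k * (2 * (c * sqrt c * (Mb + s2 * sqrt s2))) + 2 * (c * sqrt c) * (Mb + s2 * sqrt s2)"
      by (simp add: algebra_simps)
    then show ?case using 1 2 3 by linarith
  qed
  then show ?thesis unfolding \<phi>_def T_def by simp
qed

text \<open>Orthogonality of martingale differences: each cross term is \<open>eps k\<close> times
  an \<open>H k\<close>-measurable factor and has mean 0. It is applied to the score and to the
  coordinates of the fitted errors.\<close>

lemma second_moment_weighted_sum:
  fixes q :: "nat \<Rightarrow> 'a \<Rightarrow> real"
  assumes q: "\<And>j k. j < n \<Longrightarrow> k < n \<Longrightarrow> q j \<in> borel_measurable (H k)"
    and q1: "\<And>j x. j < n \<Longrightarrow> \<bar>q j x\<bar> \<le> 1"
  shows "integrable M (\<lambda>x. (\<Sum>j<n. q j x * eps j x)\<^sup>2)"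
    "(\<integral>x. (\<Sum>j<n. q j x * eps j x)\<^sup>2 \<partial>M) = s2 * (\<integral>x. (\<Sum>j<n. (q j x)\<^sup>2) \<partial>M)"
proof -
  define S where "S = (\<lambda>k x. \<Sum>j<k. q j x * eps j x)"
  have qM: "q j \<in> borel_measurable M" if "j < n" for j using H_imp_M[OF that q[OF that that]] .
  have q2: "integrable M (\<lambda>x. (q j x)\<^sup>2)" if "j < n" for j
    by (rule integrable_const_bound[where B=1]) (use qM[OF that] q1[OF that] in \<open>auto simp: abs_square_le_1\<close>)
  have "integrable M (\<lambda>x. (S k x)\<^sup>2) \<and> (\<integral>x. (S k x)\<^sup>2 \<partial>M) = s2 * (\<integral>x. (\<Sum>j<k. (q j x)\<^sup>2) \<partial>M)" if "k \<le> n" for k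
    using that
  proof (induction k)
    case 0
    then show ?case by (simp add: S_def)
  next
    case (Suc k)
    then have k: "k < n" and IH: "integrable M (\<lambda>x. (S k x)\<^sup>2)"
      "(\<integral>x. (S k x)\<^sup>2 \<partial>M) = s2 * (\<integral>x. (\<Sum>j<k. (q j x)\<^sup>2) \<partial>M)" by auto
    have SH: "S k \<in> borel_measurable (H k)"
      unfolding S_def using k by (intro borel_measurable_sum borel_measurable_times q eps_H) auto
    note [measurable] = SH q[OF k k]
    have uH: "(\<lambda>x. 2 * S k x * q k x) \<in> borel_measurable (H k)" by measurable
    have qH: "(\<lambda>x. (q k x)\<^sup>2) \<in> borel_measurable (H k)" by measurable
    \<comment> \<open>\<open>S k\<close> need not be bounded, so integrability comes from
      \<open>2 * |a * b| \<le> a\<^sup>2 + b\<^sup>2\<close> instead of a bounded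
      multiplier.\<close>
    have i1: "integrable M (\<lambda>x. 2 * S k x * q k x * eps k x)"
    proof (rule Bochner_Integration.integrable_bound)
      show "integrable M (\<lambda>x. (S k x)\<^sup>2 + (eps k x)\<^sup>2)" using IH(1) eps2[OF k] by simp
      show "(\<lambda>x. 2 * S k x * q k x * eps k x) \<in> borel_measurable M"
        using H_imp_M[OF k uH] eps_meas[OF k] by measurable
      have "\<bar>2 * S k x * q k x * eps k x\<bar> \<le> (S k x)\<^sup>2 + (eps k x)\<^sup>2" for x
      proof -
        have "\<bar>2 * S k x * q k x * eps k x\<bar> = 2 * \<bar>S k x\<bar> * \<bar>eps k x\<bar> * \<bar>q k x\<bar>" by (simp add: abs_mult)
        also have "\<dots> \<le> 2 * \<bar>S k x\<bar> * \<bar>eps k x\<bar> * 1" by (intro mult_left_mono q1[OF k]) auto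
        also have "\<dots> \<le> (S k x)\<^sup>2 + (eps k x)\<^sup>2"
          using zero_le_power2[of "\<bar>S k x\<bar> - \<bar>eps k x\<bar>"] by (simp add: power2_diff)
        finally show ?thesis .
      qed
      then show "AE x in M. norm (2 * S k x * q k x * eps k x) \<le> norm ((S k x)\<^sup>2 + (eps k x)\<^sup>2)" by simp
    qed
    have qb: "\<bar>(q k x)\<^sup>2\<bar> \<le> 1" for x using q1[OF k, of x] by (simp add: abs_square_le_1)
    have i2: "integrable M (\<lambda>x. (q k x)\<^sup>2 * (eps k x)\<^sup>2)"
      using integrable_bounded_mult[OF eps2[OF k] H_imp_M[OF k qH], of 1] qb by simp
    have e: "(S (Suc k) x)\<^sup>2 = (S k x)\<^sup>2 + 2 * S k x * q k x * eps k x + (q k x)\<^sup>2 * (eps k x)\<^sup>2" for x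
      unfolding S_def by (simp add: power2_sum power_mult_distrib)
    have "(\<integral>x. (S (Suc k) x)\<^sup>2 \<partial>M) = (\<integral>x. (S k x)\<^sup>2 \<partial>M) + (\<integral>x. 2 * S k x * q k x * eps k x \<partial>M) + (\<integral>x. (q k x)\<^sup>2 * (eps k x)\<^sup>2 \<partial>M)"
      unfolding e using IH(1) i1 i2 by simp
    also have "(\<integral>x. 2 * S k x * q k x * eps k x \<partial>M) = 0" by (rule integral_mult_eps[OF k uH i1])
    also have "(\<integral>x. (q k x)\<^sup>2 * (eps k x)\<^sup>2 \<partial>M) = s2 * (\<integral>x. (q k x)\<^sup>2 \<partial>M)"
      using integral_mult_eps2[OF k qH qb] i2 q2[OF k] by (simp add: right_diff_distrib)
    also have "(\<integral>x. (S k x)\<^sup>2 \<partial>M) = s2 * (\<integral>x. (\<Sum>j<k. (q j x)\<^sup>2) \<partial>M)" by (rule IH(2))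
    also have "s2 * (\<integral>x. (\<Sum>j<k. (q j x)\<^sup>2) \<partial>M) + 0 + s2 * (\<integral>x. (q k x)\<^sup>2 \<partial>M) = s2 * (\<integral>x. (\<Sum>j<Suc k. (q j x)\<^sup>2) \<partial>M)"
    proof -
      have "integrable M (\<lambda>x. \<Sum>j<k. (q j x)\<^sup>2)" using q2 k by (intro Bochner_Integration.integrable_sum) auto
      then show ?thesis using q2[OF k] by (simp only: sum.lessThan_Suc Bochner_Integration.integral_add distrib_left add_0_right)
    qed
    finally show ?case unfolding e using IH(1) i1 i2 by simp
  qed
  from this[of n] show "integrable M (\<lambda>x. (\<Sum>j<n. q j x * eps j x)\<^sup>2)"
    "(\<integral>x. (\<Sum>j<n. q j x * eps j x)\<^sup>2 \<partial>M) = s2 * (\<integral>x. (\<Sum>j<n. (q j x)\<^sup>2) \<partial>M)"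
    by (simp_all add: S_def)
qed

end

section \<open>Asymptotic normality\<close>

lemma cdf_distr:
  assumes "T \<in> borel_measurable M"
  shows "cdf (distr M borel T) t = measure M {x \<in> space M. T x \<le> t}"
proof -
  have "T -` {..t} \<inter> space M = {x \<in> space M. T x \<le> t}" by auto
  then show ?thesis using assms by (simp add: cdf_def measure_distr)
qed

text \<open>The normal law has a density, hence no atoms; convergence of distribution functions may
  thus be used at every point, including the shifted thresholds below.\<close>

lemma isCont_cdf_std_normal: "isCont (cdf std_normal_distribution) t"
proof -
  interpret real_distribution std_normal_distribution by (rule real_dist_normal_dist)
  have "emeasure std_normal_distribution {t} = (\<integral>\<^sup>+x. ennreal (std_normal_density x) * indicator {t} x \<partial>lborel)"
    by (rule emeasure_density) auto
  also have "\<dots> = 0" by (rule nn_integral_null_set) auto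
  finally show ?thesis by (simp add: isCont_cdf measure_def)
qed

text \<open>Slutsky's theorem for quotients, in a form that allows \<open>T\<close> and \<open>N\<close> to be unrelated on events of
  vanishing probability.\<close>

lemma weak_conv_std_normal_scale:
  fixes M :: "nat \<Rightarrow> 'a measure" and N T :: "nat \<Rightarrow> 'a \<Rightarrow> real"
  assumes prob: "\<And>n. prob_space (M n)"
    and N: "\<And>n. N n \<in> borel_measurable (M n)" and T: "\<And>n. T n \<in> borel_measurable (M n)"
    and conv: "weak_conv_m (\<lambda>n. distr (M n) borel (N n)) std_normal_distribution"
    and close: "\<And>\<delta>. 0 < \<delta> \<Longrightarrow> \<exists>b. b \<longlonglongrightarrow> 0 \<and> (\<forall>\<^sub>F n in sequentially. \<exists>B\<in>sets (M n).
        measure (M n) B \<le> b n \<and> (\<forall>x\<in>space (M n) - B. \<exists>r. N n x = T n x * r \<and> \<bar>r - 1\<bar> \<le> \<delta>))"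
  shows "weak_conv_m (\<lambda>n. distr (M n) borel (T n)) std_normal_distribution"
  unfolding weak_conv_m_def weak_conv_def
proof (intro allI impI)
  fix t :: real
  define F where "F = cdf std_normal_distribution"
  show "(\<lambda>n. cdf (distr (M n) borel (T n)) t) \<longlonglongrightarrow> cdf std_normal_distribution t"
    unfolding F_def[symmetric]
  proof (rule LIMSEQ_I)
    fix e :: real assume e: "0 < e"
    have "isCont F t" unfolding F_def by (rule isCont_cdf_std_normal)
    then obtain d where d: "d > 0" "\<And>s. \<bar>s - t\<bar> < d \<Longrightarrow> \<bar>F s - F t\<bar> < e / 4"
      using e unfolding continuous_at_eps_delta dist_real_def by (metis zero_less_divide_iff zero_less_numeral)
    \<comment> \<open>The first bound keeps the factor \<open>r\<close> positive, so that
      multiplication preserves inequalities; the second gives \<open>|t| * \<delta> < d\<close>. A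
      relative error \<delta> moves the threshold by at most \<open>|t| * \<delta>\<close>, however
      large \<open>T\<close> is.\<close>
    define \<delta> where "\<delta> = min (1 / 2) (d / (2 * (\<bar>t\<bar> + 1)))"
    have \<delta>: "0 < \<delta>" "\<delta> < 1" using d by (auto simp: \<delta>_def)
    have "\<bar>t\<bar> * \<delta> \<le> \<bar>t\<bar> * (d / (2 * (\<bar>t\<bar> + 1)))" by (intro mult_left_mono) (auto simp: \<delta>_def)
    also have "\<dots> = d * (\<bar>t\<bar> / (2 * (\<bar>t\<bar> + 1)))" by simp
    also have "\<dots> < d * 1" using d(1) by (intro mult_strict_left_mono) (simp_all add: divide_less_eq)
    finally have td: "\<bar>t\<bar> * \<delta> < d" by simp
    have Nconv: "(\<lambda>n. cdf (distr (M n) borel (N n)) s) \<longlonglongrightarrow> F s" for s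
      using conv isCont_cdf_std_normal[of s] unfolding weak_conv_m_def weak_conv_def F_def by blast
    have ev: "\<forall>\<^sub>F n in sequentially. \<bar>cdf (distr (M n) borel (N n)) s - F s\<bar> < e / 4" for s
      using tendstoD[OF Nconv[of s], of "e / 4"] e by (simp add: dist_real_def)
    obtain b where b: "b \<longlonglongrightarrow> 0" and bB: "\<forall>\<^sub>F n in sequentially. \<exists>B\<in>sets (M n).
        measure (M n) B \<le> b n \<and> (\<forall>x\<in>space (M n) - B. \<exists>r. N n x = T n x * r \<and> \<bar>r - 1\<bar> \<le> \<delta>)"
      using close[OF \<delta>(1)] by blast
    have bev: "\<forall>\<^sub>F n in sequentially. \<bar>b n\<bar> < e / 4"
      using tendstoD[OF b, of "e / 4"] e by (simp add: dist_real_def)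
    have "\<forall>\<^sub>F n in sequentially. \<bar>cdf (distr (M n) borel (T n)) t - F t\<bar> < e"
      using ev[of "t + \<bar>t\<bar> * \<delta>"] ev[of "t - \<bar>t\<bar> * \<delta>"] bev bB
    proof eventually_elim
      case (elim n)
      interpret prob_space "M n" by (rule prob)
      note [measurable] = N[of n] T[of n]
      obtain B where B: "B \<in> sets (M n)" "prob B \<le> b n"
        and r: "\<And>x. x \<in> space (M n) - B \<Longrightarrow> \<exists>r. N n x = T n x * r \<and> \<bar>r - 1\<bar> \<le> \<delta>"
        using elim(4) by blast
      have up: "N n x \<le> t + \<bar>t\<bar> * \<delta>" if x: "x \<in> space (M n)" "x \<notin> B" and le: "T n x \<le> t" for x
      proof -
        obtain r where r: "N n x = T n x * r" "\<bar>r - 1\<bar> \<le> \<delta>" using r x by blast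
        have "T n x * r \<le> t * r" using le r(2) \<delta> by (intro mult_right_mono) auto
        also have "t * r = t + t * (r - 1)" by (simp add: algebra_simps)
        also have "t * (r - 1) \<le> \<bar>t\<bar> * \<bar>r - 1\<bar>" by (simp add: abs_mult[symmetric])
        also have "\<dots> \<le> \<bar>t\<bar> * \<delta>" using r(2) by (intro mult_left_mono) auto
        finally show ?thesis using r by simp
      qed
      have lo: "T n x \<le> t" if x: "x \<in> space (M n)" "x \<notin> B" and le: "N n x \<le> t - \<bar>t\<bar> * \<delta>" for x
      proof -
        obtain r where r: "N n x = T n x * r" "\<bar>r - 1\<bar> \<le> \<delta>" using r x by blast
        have "- (t * (r - 1)) \<le> \<bar>t\<bar> * \<bar>r - 1\<bar>" by (metis abs_ge_minus_self abs_mult)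
        also have "\<dots> \<le> \<bar>t\<bar> * \<delta>" using r(2) by (intro mult_left_mono) auto
        finally have "t - \<bar>t\<bar> * \<delta> \<le> t * r" by (simp add: algebra_simps)
        then have "T n x * r \<le> t * r" using le r(1) by simp
        moreover have "0 < r" using r(2) \<delta> by auto
        ultimately show ?thesis by simp
      qed
      have "prob {x \<in> space (M n). T n x \<le> t} \<le> prob ({x \<in> space (M n). N n x \<le> t + \<bar>t\<bar> * \<delta>} \<union> B)"
        using up B(1) by (intro finite_measure_mono) auto
      also have "\<dots> \<le> prob {x \<in> space (M n). N n x \<le> t + \<bar>t\<bar> * \<delta>} + prob B"
        using B(1) by (intro measure_Un_le) auto
      finally have 1: "cdf (distr (M n) borel (T n)) t \<le> cdf (distr (M n) borel (N n)) (t + \<bar>t\<bar> * \<delta>) + b n"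
        using B(2) by (simp add: cdf_distr N T)
      have "prob {x \<in> space (M n). N n x \<le> t - \<bar>t\<bar> * \<delta>} \<le> prob ({x \<in> space (M n). T n x \<le> t} \<union> B)"
        using lo B(1) by (intro finite_measure_mono) auto
      also have "\<dots> \<le> prob {x \<in> space (M n). T n x \<le> t} + prob B"
        using B(1) by (intro measure_Un_le) auto
      finally have 2: "cdf (distr (M n) borel (N n)) (t - \<bar>t\<bar> * \<delta>) \<le> cdf (distr (M n) borel (T n)) t + b n"
        using B(2) by (simp add: cdf_distr N T)
      have 3: "\<bar>F (t + \<bar>t\<bar> * \<delta>) - F t\<bar> < e / 4" "\<bar>F (t - \<bar>t\<bar> * \<delta>) - F t\<bar> < e / 4"
        using d(2)[of "t + \<bar>t\<bar> * \<delta>"] d(2)[of "t - \<bar>t\<bar> * \<delta>"] td \<delta> by (simp_all add: abs_mult)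
      show ?case using 1 2 3 elim(1-3) unfolding abs_less_iff by linarith
    qed
    then show "\<exists>n0. \<forall>n\<ge>n0. norm (cdf (distr (M n) borel (T n)) t - F t) < e"
      by (auto simp: eventually_sequentially)
  qed
qed

section \<open>Measurability of residuals, determinants and the statistic\<close>

lemma borel_measurable_ip:
  assumes "\<And>i. i < n \<Longrightarrow> (\<lambda>x. u x i) \<in> borel_measurable K" "\<And>i. i < n \<Longrightarrow> (\<lambda>x. v x i) \<in> borel_measurable K"
  shows "(\<lambda>x. ip n (u x) (v x)) \<in> borel_measurable K"
  unfolding ip_def using assms by (intro borel_measurable_sum borel_measurable_times) auto

lemma borel_measurable_gs:
  assumes Z: "\<And>i j. i < n \<Longrightarrow> j < p \<Longrightarrow> (\<lambda>x. Z x i j) \<in> borel_measurable K"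
  shows "j < p \<Longrightarrow> i < n \<Longrightarrow> (\<lambda>x. gs n (Z x) j i) \<in> borel_measurable K"
proof (induction j arbitrary: i rule: less_induct)
  case (less j)
  have res: "(\<lambda>x. gs_res n (Z x) j i) \<in> borel_measurable K" if "i < n" for i
    unfolding gs_res_def
    using less that Z
    by (intro borel_measurable_diff borel_measurable_sum borel_measurable_times borel_measurable_ip) auto
  have "(\<lambda>x. gs_res n (Z x) j i / sqrt (ip n (gs_res n (Z x) j) (gs_res n (Z x) j))) \<in> borel_measurable K"
    using res less.prems
    by (intro borel_measurable_divide borel_measurable_ip measurable_compose[OF _ borel_measurable_sqrt]) auto
  then show ?case by (simp add: gs_eq)
qed

lemma borel_measurable_pres:
  assumes Z: "\<And>i j. i < n \<Longrightarrow> j < p \<Longrightarrow> (\<lambda>x. Z x i j) \<in> borel_measurable K"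
    and W: "\<And>i. i < n \<Longrightarrow> (\<lambda>x. W x i) \<in> borel_measurable K" and i: "i < n"
  shows "(\<lambda>x. pres n p (Z x) (W x) i) \<in> borel_measurable K"
  unfolding pres_def using i
  by (intro borel_measurable_diff borel_measurable_sum borel_measurable_times borel_measurable_ip W borel_measurable_gs[where p = p] Z) auto

lemma borel_measurable_kdet_gram:
  assumes Z: "\<And>i j. i < n \<Longrightarrow> j < p \<Longrightarrow> (\<lambda>x. Z x i j) \<in> borel_measurable K"
  shows "(\<lambda>x. kdet p (gram n (Z x))) \<in> borel_measurable K"
  unfolding kdet_altdef gram_def
proof (intro borel_measurable_sum borel_measurable_times borel_measurable_prod borel_measurable_const)
  fix \<pi> i r assume "\<pi> \<in> {\<pi>. \<pi> permutes {0..<p}}" and i: "i \<in> {0..<p}" and r: "r \<in> {..<n}"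
  then have "\<pi> i < p" using permutes_in_image[of \<pi> "{0..<p}" i] by auto
  then show "(\<lambda>x. Z x r i) \<in> borel_measurable K" "(\<lambda>x. Z x r (\<pi> i)) \<in> borel_measurable K"
    using Z i r by auto
qed

lemma borel_measurable_t_stat:
  assumes Z: "\<And>i j. i < n \<Longrightarrow> j < p \<Longrightarrow> (\<lambda>x. Z x i j) \<in> borel_measurable K"
    and W: "\<And>i. i < n \<Longrightarrow> (\<lambda>x. W x i) \<in> borel_measurable K"
    and V: "\<And>i. i < n \<Longrightarrow> (\<lambda>x. V x i) \<in> borel_measurable K"
  shows "(\<lambda>x. if invertible_k p (gram n (Z x)) then t_stat n p (pres n p (Z x) (W x)) (pres n p (Z x) (V x)) else 0)
    \<in> borel_measurable K"
proof -
  note [measurable] = borel_measurable_kdet_gram[OF Z]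
    borel_measurable_ip[where u = "\<lambda>x. pres n p (Z x) (W x)" and v = "\<lambda>x. pres n p (Z x) (W x)" and n = n,
      OF borel_measurable_pres[OF Z W] borel_measurable_pres[OF Z W]]
    borel_measurable_ip[where u = "\<lambda>x. pres n p (Z x) (W x)" and v = "\<lambda>x. pres n p (Z x) (V x)" and n = n,
      OF borel_measurable_pres[OF Z W] borel_measurable_pres[OF Z V]]
    borel_measurable_ip[where u = "\<lambda>x. pres n p (Z x) (V x)" and v = "\<lambda>x. pres n p (Z x) (V x)" and n = n,
      OF borel_measurable_pres[OF Z V] borel_measurable_pres[OF Z V]]
  show ?thesis unfolding invertible_k_iff_kdet t_stat_def by measurable
qed

section \<open>From the linear model to a filtration\<close>

lemma (in prob_space) gen_sigma_subalgebra:
  assumes "\<And>i. i \<in> I \<Longrightarrow> f i \<in> borel_measurable M"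
  shows "subalgebra M (gen_sigma M f I)"
  unfolding gen_sigma_def
  by (rule subalgebra_sigma) (use assms in \<open>auto intro: measurable_sets\<close>)

lemma (in prob_space) gen_sigma_measurable:
  assumes "i \<in> I"
  shows "f i \<in> borel_measurable (gen_sigma M f I)"
proof (rule measurableI)
  fix S :: "real set" assume S: "S \<in> sets borel"
  have "{f i -` B \<inter> space M | i B. i \<in> I \<and> B \<in> sets borel} \<subseteq> Pow (space M)" by auto
  then show "f i -` S \<inter> space (gen_sigma M f I) \<in> sets (gen_sigma M f I)"
    unfolding gen_sigma_def using assms S by (auto simp: space_measure_of_conv)
qed auto

text \<open>Here \<open>F\<close>, \<open>A\<close>, \<open>B\<close> come from \<open>Z\<close>,
  \<open>W\<close>, \<open>V\<close>, and \<open>H\<close> is the enlarged past. The errors are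
  functions of \<open>V\<close> and \<open>Z\<close>, as the conditional independence argument
  requires; \<beta> is exported because it links them to \<open>V\<close>.\<close>

lemma (in prob_space) lin_model_martingale_errors:
  fixes V W :: "'a \<Rightarrow> nat \<Rightarrow> real" and Z :: "'a \<Rightarrow> nat \<Rightarrow> nat \<Rightarrow> real"
  assumes V: "\<And>i. i < n \<Longrightarrow> (\<lambda>x. V x i) \<in> borel_measurable M"
    and W: "\<And>i. i < n \<Longrightarrow> (\<lambda>x. W x i) \<in> borel_measurable M"
    and Z: "\<And>i j. i < n \<Longrightarrow> j < p \<Longrightarrow> (\<lambda>x. Z x i j) \<in> borel_measurable M"
    and ci: "cond_indep_alg M (gen_sigma M (\<lambda>(i, j) x. Z x i j) ({..<n} \<times> {..<p}))
      (gen_sigma M (\<lambda>i x. W x i) {..<n}) (gen_sigma M (\<lambda>i x. V x i) {..<n})"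
    and model: "lin_model M n p V Z s2 Mb" and s2: "0 < s2"
  obtains \<beta> H where "martingale_errors M n H (\<lambda>i x. V x i - (\<Sum>j<p. Z x i j * \<beta> j)) s2 Mb"
    "\<And>i k. i < n \<Longrightarrow> k < n \<Longrightarrow> (\<lambda>x. W x i) \<in> borel_measurable (H k)"
    "\<And>i j k. i < n \<Longrightarrow> j < p \<Longrightarrow> k < n \<Longrightarrow> (\<lambda>x. Z x i j) \<in> borel_measurable (H k)"
proof -
  define F where "F = gen_sigma M (\<lambda>(i, j) x. Z x i j) ({..<n} \<times> {..<p})"
  define A where "A = gen_sigma M (\<lambda>i x. W x i) {..<n}"
  define B where "B = gen_sigma M (\<lambda>i x. V x i) {..<n}"
  have sF: "subalgebra M F" unfolding F_def by (rule gen_sigma_subalgebra) (use Z in auto)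
  have sA: "subalgebra M A" unfolding A_def by (rule gen_sigma_subalgebra) (use W in auto)
  have sB: "subalgebra M B" unfolding B_def by (rule gen_sigma_subalgebra) (use V in auto)
  have ZF: "(\<lambda>x. Z x i j) \<in> borel_measurable F" if "i < n" "j < p" for i j
    using gen_sigma_measurable[of "(i, j)" "{..<n} \<times> {..<p}" "\<lambda>(i, j) x. Z x i j"] that unfolding F_def by simp
  have WA: "(\<lambda>x. W x i) \<in> borel_measurable A" if "i < n" for i
    using gen_sigma_measurable[of i "{..<n}" "\<lambda>i x. W x i"] that unfolding A_def by simp
  have VB: "(\<lambda>x. V x i) \<in> borel_measurable B" if "i < n" for i
    using gen_sigma_measurable[of i "{..<n}" "\<lambda>i x. V x i"] that unfolding B_def by simp
  obtain \<beta> where \<beta>: "let eps = (\<lambda>i x. V x i - (\<Sum>j<p. Z x i j * \<beta> j))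
      in (\<forall>i<n. integrable M (eps i) \<and> integrable M (\<lambda>x. (eps i x)\<^sup>2) \<and>
                integrable M (\<lambda>x. \<bar>eps i x\<bar> ^ 3) \<and>
                (AE x in M. real_cond_exp M F (eps i) x = 0) \<and>
                (AE x in M. real_cond_exp M F (\<lambda>x. (eps i x)\<^sup>2) x = s2) \<and>
                (AE x in M. real_cond_exp M F (\<lambda>x. \<bar>eps i x\<bar> ^ 3) x < Mb)) \<and>
         cond_indep_vars M F eps {..<n}"
    using model unfolding lin_model_def Let_def F_def by blast
  define eps where "eps = (\<lambda>i x. V x i - (\<Sum>j<p. Z x i j * \<beta> j))"
  have e: "\<And>i. i < n \<Longrightarrow> integrable M (eps i)" "\<And>i. i < n \<Longrightarrow> integrable M (\<lambda>x. (eps i x)\<^sup>2)"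
    "\<And>i. i < n \<Longrightarrow> integrable M (\<lambda>x. \<bar>eps i x\<bar> ^ 3)"
    "\<And>i. i < n \<Longrightarrow> AE x in M. real_cond_exp M F (eps i) x = 0"
    "\<And>i. i < n \<Longrightarrow> AE x in M. real_cond_exp M F (\<lambda>x. (eps i x)\<^sup>2) x = s2"
    "\<And>i. i < n \<Longrightarrow> AE x in M. real_cond_exp M F (\<lambda>x. \<bar>eps i x\<bar> ^ 3) x < Mb"
    and ind: "cond_indep_vars M F eps {..<n}"
    using \<beta> unfolding Let_def eps_def[symmetric] by auto
  have epsBF: "eps i \<in> borel_measurable (sigma (space M) {b \<inter> c | b c. b \<in> sets B \<and> c \<in> sets F})" if "i < n" for i
  proof -
    note sub = subalgebra_sigma_Int[OF sB sF]
    show ?thesis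
      unfolding eps_def using that
      by (intro borel_measurable_diff borel_measurable_sum borel_measurable_times borel_measurable_const
          measurable_from_subalg[OF sub(1)] measurable_from_subalg[OF sub(2)] VB ZF) auto
  qed
  interpret C: cond_indep_errors M F A B n eps
    by unfold_locales (use sF sA sB ci epsBF ind in \<open>auto simp: F_def A_def B_def\<close>)
  have "martingale_errors M n C.past eps s2 Mb"
  proof unfold_locales
    fix k assume k: "k < n"
    show "subalgebra M (C.past k)" using k by (intro C.past_subalgebra) simp
    show "integrable M (eps k)" "integrable M (\<lambda>x. (eps k x)\<^sup>2)" "integrable M (\<lambda>x. \<bar>eps k x\<bar> ^ 3)"
      using e k by auto
    show "AE x in M. real_cond_exp M (C.past k) (eps k) x = 0"
      using C.real_cond_exp_past[OF k, of "\<lambda>x. x"] e(1)[OF k] e(4)[OF k] by auto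
    show "AE x in M. real_cond_exp M (C.past k) (\<lambda>x. (eps k x)\<^sup>2) x = s2"
      using C.real_cond_exp_past[OF k, of "\<lambda>x. x\<^sup>2"] e(2)[OF k] e(5)[OF k] by auto
    have "AE x in M. real_cond_exp M (C.past k) (\<lambda>x. \<bar>eps k x\<bar> ^ 3) x = real_cond_exp M F (\<lambda>x. \<bar>eps k x\<bar> ^ 3) x"
      by (rule C.real_cond_exp_past[OF k]) (use e(3)[OF k] in auto)
    then show "AE x in M. real_cond_exp M (C.past k) (\<lambda>x. \<bar>eps k x\<bar> ^ 3) x \<le> Mb"
      using e(6)[OF k] by eventually_elim simp
  next
    fix j k assume "j < k" "k < n"
    then show "eps j \<in> borel_measurable (C.past k)" by (intro C.eps_past) auto
  qed (use s2 in simp)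
  moreover have "(\<lambda>x. W x i) \<in> borel_measurable (C.past k)" if "i < n" "k < n" for i k
    using that by (intro C.A_past WA) auto
  moreover have "(\<lambda>x. Z x i j) \<in> borel_measurable (C.past k)" if "i < n" "j < p" "k < n" for i j k
    using that by (intro C.F_past ZF) auto
  ultimately show ?thesis using that[of C.past \<beta>] unfolding eps_def by blast
qed

section \<open>The score and the t-statistic at a fixed sample size\<close>

lemma (in prob_space) prob_le_integral_div:
  assumes f: "integrable M f" and f0: "\<And>x. 0 \<le> f x" and c: "0 < c"
    and B: "B \<in> sets M" and le: "\<And>x. x \<in> B \<Longrightarrow> c \<le> f x"
  shows "prob B \<le> (\<integral>x. f x \<partial>M) / c"
proof -
  have "(\<integral>x. c * indicator B x \<partial>M) \<le> (\<integral>x. f x \<partial>M)"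
  proof (rule integral_mono[OF _ f])
    show "integrable M (\<lambda>x. c * indicator B x)"
      using B by (intro integrable_mult_right integrable_real_indicator) (auto simp: less_top[symmetric])
    show "c * indicator B x \<le> f x" for x using f0[of x] le[of x] by (simp add: indicator_def)
  qed
  then show ?thesis using B c by (simp add: pos_le_divide_eq mult.commute)
qed

definition lyapunov_ratio :: "nat \<Rightarrow> (nat \<Rightarrow> real) \<Rightarrow> real" where
  "lyapunov_ratio n R = (if (\<forall>i<n. R i = 0) then 0
     else ((\<Sum>i<n. \<bar>R i\<bar> ^ 3) / real n) / ((\<Sum>i<n. (R i)\<^sup>2) / real n) powr (3 / 2))"

text \<open>The powers of \<open>n\<close> cancel and leave the sum of cubes of the normalised
  residuals, so the Lyapunov condition controls exactly the error of the replacement argument. For a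
  zero vector both sides are 0.\<close>

lemma lyapunov_ratio_eq:
  assumes n: "0 < n"
  shows "1 / sqrt (real n) * lyapunov_ratio n R = (\<Sum>i<n. (\<bar>R i\<bar> / sqrt (ip n R R)) ^ 3)"
proof (cases "\<forall>i<n. R i = 0")
  case True
  then show ?thesis by (simp add: lyapunov_ratio_def)
next
  case False
  then have "ip n R R \<noteq> 0" unfolding ip_eq_0_iff by simp
  then have pos: "0 < ip n R R" using ip_nonneg[of n R] by simp
  have sq: "(\<Sum>i<n. (R i)\<^sup>2) = ip n R R" by (simp add: ip_def power2_eq_square)
  have n': "0 < real n" using n by simp
  have "(ip n R R / real n) powr (3 / 2) = (ip n R R / real n) powr (1 + 1 / 2)" by simp
  also have "\<dots> = (ip n R R / real n) * sqrt (ip n R R / real n)"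
    unfolding powr_add using pos n' by (simp add: powr_half_sqrt)
  also have "\<dots> = ip n R R * sqrt (ip n R R) / (real n * sqrt (real n))"
    by (simp add: real_sqrt_divide)
  also have "ip n R R * sqrt (ip n R R) = sqrt (ip n R R) ^ 3"
    using pos by (simp add: power3_eq_cube)
  finally have pw: "(ip n R R / real n) powr (3 / 2) = sqrt (ip n R R) ^ 3 / (real n * sqrt (real n))" .
  have "1 / sqrt (real n) * lyapunov_ratio n R = 1 / sqrt (real n) * (((\<Sum>i<n. \<bar>R i\<bar> ^ 3) / real n) / (sqrt (ip n R R) ^ 3 / (real n * sqrt (real n))))"
    using False unfolding lyapunov_ratio_def sq pw by (simp only: if_False)
  also have "\<dots> = (\<Sum>i<n. \<bar>R i\<bar> ^ 3) / sqrt (ip n R R) ^ 3"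
    using n' by (simp add: field_simps)
  finally show ?thesis by (simp add: sum_divide_distrib power_divide)
qed

text \<open>\<open>W\<close> is the variable whose residuals give the weights, \<open>V\<close> the
  one that follows the linear model. All of \<open>W\<close> and \<open>Z\<close> is measurable for
  every \<open>H k\<close>, which makes the weights predictable.\<close>

locale t_stat_model = martingale_errors M n H eps s2 Mb
  for M :: "'a measure" and n H eps s2 Mb +
  fixes p :: nat and W V :: "'a \<Rightarrow> nat \<Rightarrow> real" and Z :: "'a \<Rightarrow> nat \<Rightarrow> nat \<Rightarrow> real" and \<beta> :: "nat \<Rightarrow> real"
  assumes n: "p + 1 < n" and s2pos: "0 < s2"
    and eps_eq: "\<And>i x. i < n \<Longrightarrow> eps i x = V x i - (\<Sum>j<p. Z x i j * \<beta> j)"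
    and W: "\<And>i k. i < n \<Longrightarrow> k < n \<Longrightarrow> (\<lambda>x. W x i) \<in> borel_measurable (H k)"
    and Z: "\<And>i j k. i < n \<Longrightarrow> j < p \<Longrightarrow> k < n \<Longrightarrow> (\<lambda>x. Z x i j) \<in> borel_measurable (H k)"
begin

definition res_W :: "'a \<Rightarrow> nat \<Rightarrow> real" where "res_W x = pres n p (Z x) (W x)"

definition sq_W :: "'a \<Rightarrow> real" where "sq_W x = ip n (res_W x) (res_W x)"

text \<open>If the residual of \<open>W\<close> vanishes then \<open>0 / 0 = 0\<close> makes all weights, and hence the score, zero.\<close>

definition wt :: "nat \<Rightarrow> 'a \<Rightarrow> real" where "wt j x = res_W x j / (sqrt s2 * sqrt (sq_W x))"

definition score :: "'a \<Rightarrow> real" where "score x = (\<Sum>j<n. wt j x * eps j x)"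

lemma n_pos: "0 < n" using n by simp

lemma res_W_H: "i < n \<Longrightarrow> k < n \<Longrightarrow> (\<lambda>x. res_W x i) \<in> borel_measurable (H k)"
  unfolding res_W_def by (rule borel_measurable_pres) (auto intro: W Z)

lemma sq_W_H: "k < n \<Longrightarrow> sq_W \<in> borel_measurable (H k)"
  unfolding sq_W_def[abs_def] by (rule borel_measurable_ip) (auto intro: res_W_H)

lemma wt_H: "j < n \<Longrightarrow> k < n \<Longrightarrow> wt j \<in> borel_measurable (H k)"
  unfolding wt_def[abs_def]
  by (intro borel_measurable_divide borel_measurable_times borel_measurable_const
      measurable_compose[OF _ borel_measurable_sqrt] res_W_H sq_W_H)

lemma sq_W_M: "sq_W \<in> borel_measurable M"
  by (rule H_imp_M[OF n_pos sq_W_H[OF n_pos]])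

lemma wt_M: "j < n \<Longrightarrow> wt j \<in> borel_measurable M"
  by (rule H_imp_M[OF n_pos wt_H[OF _ n_pos]])

lemma score_M: "score \<in> borel_measurable M"
  unfolding score_def[abs_def] by (intro borel_measurable_sum borel_measurable_times wt_M eps_meas) auto

lemma wt_abs: "\<bar>wt j x\<bar> = \<bar>res_W x j\<bar> / sqrt (sq_W x) * (1 / sqrt s2)"
  unfolding wt_def using ip_nonneg[of n "res_W x"] s2 by (simp add: abs_mult sq_W_def mult.commute)

lemma res_W_le: "j < n \<Longrightarrow> \<bar>res_W x j\<bar> / sqrt (sq_W x) \<le> 1"
proof -
  assume j: "j < n"
  have "(res_W x j)\<^sup>2 \<le> sq_W x"
    unfolding sq_W_def ip_def power2_eq_square using j by (intro member_le_sum) auto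
  then have "\<bar>res_W x j\<bar> \<le> sqrt (sq_W x)" by (simp add: real_le_rsqrt)
  then show ?thesis
    using ip_nonneg[of n "res_W x"] by (cases "sq_W x = 0") (simp_all add: divide_le_eq sq_W_def less_le)
qed

lemma wt_le: "j < n \<Longrightarrow> \<bar>wt j x\<bar> \<le> 1 / sqrt s2"
  unfolding wt_abs using mult_right_mono[OF res_W_le, of j "1 / sqrt s2" x] s2 by simp

lemma sum_wt: "(\<Sum>j<n. (wt j x)\<^sup>2) = (if sq_W x = 0 then 0 else 1 / s2)"
proof -
  have "(wt j x)\<^sup>2 = (res_W x j)\<^sup>2 / (s2 * sq_W x)" for j
    unfolding wt_def using s2 ip_nonneg[of n "res_W x"] by (simp add: power_divide power_mult_distrib sq_W_def)
  then have "(\<Sum>j<n. (wt j x)\<^sup>2) = sq_W x / (s2 * sq_W x)"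
    by (simp add: sum_divide_distrib[symmetric] sq_W_def ip_def power2_eq_square)
  then show ?thesis by simp
qed

lemma score_eq: "sq_W x \<noteq> 0 \<Longrightarrow> ip n (res_W x) (\<lambda>i. eps i x) = sqrt s2 * sqrt (sq_W x) * score x"
  using s2pos ip_nonneg[of n "res_W x"]
  by (simp add: score_def ip_def wt_def sum_divide_distrib[symmetric] sq_W_def)

text \<open>The replacement bound with \<open>C = 1 / sqrt s2\<close>, its cubic sum rewritten by
  \<open>lyapunov_ratio_eq\<close>. The last summand is the price of a zero residual: there the
  Gaussian factor is 1 instead of \<open>exp (- t\<^sup>2 / 2)\<close>.\<close>

lemma char_score:
  "cmod (char (distr M borel score) t - complex_of_real (exp (- t\<^sup>2 / 2)))
    \<le> (\<bar>t\<bar> ^ 3 * Mb / 6 + t ^ 4 * s2\<^sup>2 * (1 / sqrt s2) / 8) * (1 / sqrt s2) ^ 3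
        * (1 / sqrt (real n) * (\<integral>x. lyapunov_ratio n (res_W x) \<partial>M))
      + prob {x \<in> space M. sq_W x = 0}"
proof -
  let ?B = "{x \<in> space M. sq_W x = 0}" and ?e = "exp (- t\<^sup>2 / 2)"
  note [measurable] = sq_W_M score_M
  have 1: "char (distr M borel score) t = (\<integral>x. iexp (t * (\<Sum>j<n. wt j x * eps j x)) \<partial>M)"
    unfolding char_def score_def[symmetric] by (rule integral_distr) measurable
  have "(\<integral>x. complex_of_real (exp (- (t\<^sup>2 * (s2 * (\<Sum>j<n. (wt j x)\<^sup>2))) / 2)) \<partial>M)
      = (\<integral>x. complex_of_real (?e + (1 - ?e) * indicator ?B x) \<partial>M)"
    by (rule Bochner_Integration.integral_cong) (auto simp: sum_wt indicator_def s2pos[THEN less_imp_neq[THEN not_sym]])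
  also have "\<dots> = complex_of_real (?e + (1 - ?e) * prob ?B)"
  proof -
    have "integrable M (indicator ?B :: 'a \<Rightarrow> real)"
      by (rule integrable_real_indicator) (auto simp: less_top[symmetric])
    then have "(\<integral>x. ?e + (1 - ?e) * indicator ?B x \<partial>M) = ?e + (1 - ?e) * (\<integral>x. indicator ?B x \<partial>M)"
      by (subst Bochner_Integration.integral_add) (auto simp only: integrable_mult_right integrable_const
          integral_mult_right_zero lebesgue_integral_const prob_space real_scaleR_def mult_1_left)
    then show ?thesis by (simp only: integral_complex_of_real integral_indicator) simp
  qed
  finally have 2: "(\<integral>x. complex_of_real (exp (- (t\<^sup>2 * (s2 * (\<Sum>j<n. (wt j x)\<^sup>2))) / 2)) \<partial>M)
      = complex_of_real (?e + (1 - ?e) * prob ?B)" .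
  have "cmod (complex_of_real (?e + (1 - ?e) * prob ?B) - complex_of_real ?e) = (1 - ?e) * prob ?B"
  proof -
    have "complex_of_real (?e + (1 - ?e) * prob ?B) - complex_of_real ?e = complex_of_real ((1 - ?e) * prob ?B)"
      by simp
    then show ?thesis by (simp only: norm_of_real abs_mult) simp
  qed
  also have "\<dots> \<le> 1 * prob ?B" by (rule mult_right_mono) auto
  finally have 3: "cmod (complex_of_real (?e + (1 - ?e) * prob ?B) - complex_of_real ?e) \<le> prob ?B" by simp
  have i3: "integrable M (\<lambda>x. \<bar>wt j x\<bar> ^ 3)" if "j < n" for j
  proof (rule integrable_const_bound[where B = "(1 / sqrt s2) ^ 3"])
    show "AE x in M. norm (\<bar>wt j x\<bar> ^ 3) \<le> (1 / sqrt s2) ^ 3"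
    proof (rule AE_I2)
      show "norm (\<bar>wt j x\<bar> ^ 3) \<le> (1 / sqrt s2) ^ 3" for x
        using power_mono[OF wt_le[OF that] abs_ge_zero, of x 3] by (simp only: real_norm_def power_abs abs_abs)
    qed
    show "(\<lambda>x. \<bar>wt j x\<bar> ^ 3) \<in> borel_measurable M" using wt_M[OF that] by measurable
  qed
  have "(\<Sum>j<n. \<integral>x. \<bar>wt j x\<bar> ^ 3 \<partial>M) = (\<integral>x. (\<Sum>j<n. \<bar>wt j x\<bar> ^ 3) \<partial>M)"
    using i3 by (subst Bochner_Integration.integral_sum) auto
  also have "\<dots> = (\<integral>x. (1 / sqrt s2) ^ 3 * (1 / sqrt (real n) * lyapunov_ratio n (res_W x)) \<partial>M)"
    unfolding lyapunov_ratio_eq[OF n_pos] wt_abs power_mult_distrib sq_W_def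
    by (simp add: sum_distrib_left mult.commute)
  also have "\<dots> = (1 / sqrt s2) ^ 3 * (1 / sqrt (real n) * (\<integral>x. lyapunov_ratio n (res_W x) \<partial>M))"
    by simp
  finally have 4: "(\<Sum>j<n. \<integral>x. \<bar>wt j x\<bar> ^ 3 \<partial>M)
    = (1 / sqrt s2) ^ 3 * (1 / sqrt (real n) * (\<integral>x. lyapunov_ratio n (res_W x) \<partial>M))" .
  have "cmod (char (distr M borel score) t - complex_of_real (?e + (1 - ?e) * prob ?B))
    \<le> (\<bar>t\<bar> ^ 3 * Mb / 6 + t ^ 4 * s2\<^sup>2 * (1 / sqrt s2) / 8) * (\<Sum>j<n. \<integral>x. \<bar>wt j x\<bar> ^ 3 \<partial>M)"
    using char_weighted_sum[of wt "1 / sqrt s2" t] wt_H wt_le unfolding 1 2 by blast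
  then have 5: "cmod (char (distr M borel score) t - complex_of_real (?e + (1 - ?e) * prob ?B))
    \<le> (\<bar>t\<bar> ^ 3 * Mb / 6 + t ^ 4 * s2\<^sup>2 * (1 / sqrt s2) / 8) * (1 / sqrt s2) ^ 3
        * (1 / sqrt (real n) * (\<integral>x. lyapunov_ratio n (res_W x) \<partial>M))"
    unfolding 4 by (simp only: mult.assoc)
  show ?thesis
    using norm_triangle_le[OF add_mono[OF 5 3]] by (simp only: diff_add_cancel add_diff_eq)
qed

text \<open>Needed for the denominator: the part of the residual sum of squares explained by
  \<open>W\<close> is \<open>s2 * (score x)\<^sup>2\<close>, which must be negligible against
  \<open>n\<close>.\<close>

lemma score_second_moment: "integrable M (\<lambda>x. (score x)\<^sup>2)" "(\<integral>x. (score x)\<^sup>2 \<partial>M) \<le> 1"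
proof -
  define q where "q = (\<lambda>j x. sqrt s2 * wt j x)"
  have q1: "\<bar>q j x\<bar> \<le> 1" if "j < n" for j x
    using mult_left_mono[OF wt_le[OF that, of x], of "sqrt s2"] s2pos by (simp add: q_def abs_mult)
  have qH: "q j \<in> borel_measurable (H k)" if "j < n" "k < n" for j k
    unfolding q_def using wt_H[OF that] by measurable
  have e: "(\<Sum>j<n. q j x * eps j x)\<^sup>2 = s2 * (score x)\<^sup>2" for x
    unfolding q_def score_def using s2
    by (simp add: mult.assoc sum_distrib_left[symmetric] power_mult_distrib)
  have q2: "(\<Sum>j<n. (q j x)\<^sup>2) = (if sq_W x = 0 then 0 else 1)" for x
    unfolding q_def power_mult_distrib sum_distrib_left[symmetric] sum_wt using s2pos by simp
  note sm = second_moment_weighted_sum[of q, OF qH q1, unfolded e q2]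
  show "integrable M (\<lambda>x. (score x)\<^sup>2)" using sm(1) s2pos by simp
  note [measurable] = sq_W_M
  have "(\<integral>x. (if sq_W x = 0 then 0 else 1 :: real) \<partial>M) \<le> (\<integral>x. 1 \<partial>M)"
    by (rule integral_mono) (auto intro!: integrable_const_bound[where B=1])
  then show "(\<integral>x. (score x)\<^sup>2 \<partial>M) \<le> 1" using sm(2) s2pos by (simp add: prob_space)
qed

text \<open>Each \<open>gs\<close> vector is a function of \<open>Z\<close>, hence predictable, and
  has norm at most 1, so one coordinate of the fitted errors has second moment at most
  \<open>s2\<close>.\<close>

lemma fitted_second_moment:
  "integrable M (\<lambda>x. (\<Sum>m<p. (ip n (\<lambda>i. eps i x) (gs n (Z x) m))\<^sup>2))"
  "(\<integral>x. (\<Sum>m<p. (ip n (\<lambda>i. eps i x) (gs n (Z x) m))\<^sup>2) \<partial>M) \<le> real p * s2"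
proof -
  have *: "integrable M (\<lambda>x. (ip n (\<lambda>i. eps i x) (gs n (Z x) m))\<^sup>2) \<and>
      (\<integral>x. (ip n (\<lambda>i. eps i x) (gs n (Z x) m))\<^sup>2 \<partial>M) \<le> s2" if m: "m < p" for m
  proof -
    define q where "q = (\<lambda>j x. gs n (Z x) m j)"
    have qH: "q j \<in> borel_measurable (H k)" if "j < n" "k < n" for j k
      unfolding q_def by (rule borel_measurable_gs[where p = p]) (use Z m that in auto)
    have q2: "(\<Sum>j<n. (q j x)\<^sup>2) \<le> 1" for x
      using ip_gs_le_1[of n "Z x" m] by (simp add: q_def ip_def power2_eq_square)
    have q1: "\<bar>q j x\<bar> \<le> 1" if "j < n" for j x
    proof -
      have "(q j x)\<^sup>2 \<le> (\<Sum>j<n. (q j x)\<^sup>2)" using that by (intro member_le_sum) auto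
      then show ?thesis using q2[of x] by (simp add: abs_square_le_1[symmetric])
    qed
    have e: "(\<Sum>j<n. q j x * eps j x) = ip n (\<lambda>i. eps i x) (gs n (Z x) m)" for x
      by (simp add: q_def ip_def mult.commute)
    note sm = second_moment_weighted_sum[of q, OF qH q1, unfolded e]
    have qM: "q j \<in> borel_measurable M" if "j < n" for j by (rule H_imp_M[OF n_pos qH[OF that n_pos]])
    have "(\<integral>x. (\<Sum>j<n. (q j x)\<^sup>2) \<partial>M) \<le> (\<integral>x. 1 \<partial>M)"
    proof (rule integral_mono)
      show "integrable M (\<lambda>x. \<Sum>j<n. (q j x)\<^sup>2)"
      proof (rule integrable_const_bound[where B=1])
        show "AE x in M. norm (\<Sum>j<n. (q j x)\<^sup>2) \<le> 1" using q2 by (simp add: sum_nonneg)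
        show "(\<lambda>x. \<Sum>j<n. (q j x)\<^sup>2) \<in> borel_measurable M"
          using qM by (intro borel_measurable_sum borel_measurable_power) auto
      qed
    qed (use q2 in auto)
    then have "s2 * (\<integral>x. (\<Sum>j<n. (q j x)\<^sup>2) \<partial>M) \<le> s2 * 1"
      using s2 by (intro mult_left_mono) (auto simp: prob_space)
    then show ?thesis using sm by simp
  qed
  show "integrable M (\<lambda>x. (\<Sum>m<p. (ip n (\<lambda>i. eps i x) (gs n (Z x) m))\<^sup>2))"
    using * by (intro Bochner_Integration.integrable_sum) auto
  have "(\<integral>x. (\<Sum>m<p. (ip n (\<lambda>i. eps i x) (gs n (Z x) m))\<^sup>2) \<partial>M) =
      (\<Sum>m<p. \<integral>x. (ip n (\<lambda>i. eps i x) (gs n (Z x) m))\<^sup>2 \<partial>M)"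
    using * by (subst Bochner_Integration.integral_sum) auto
  also have "\<dots> \<le> (\<Sum>m<p. s2)" using * by (intro sum_mono) auto
  finally show "(\<integral>x. (\<Sum>m<p. (ip n (\<lambda>i. eps i x) (gs n (Z x) m))\<^sup>2) \<partial>M) \<le> real p * s2" by simp
qed

text \<open>A statement about a single outcome. The hypotheses allot an error of at most
  \<open>n * \<delta> * s2 / 8\<close> to each of four terms: the law of large numbers, the fitted
  errors, the score and the lost degrees of freedom.\<close>

lemma t_stat_score:
  assumes sq: "sq_W x \<noteq> 0" and \<delta>: "0 < \<delta>" "\<delta> < 1"
    and n2: "2 * (real p + 1) \<le> real n" and n8: "8 * (real p + 1) \<le> real n * \<delta>"
    and b1: "\<bar>1 / real n * (\<Sum>k<n. (eps k x)\<^sup>2 - s2)\<bar> \<le> \<delta> * s2 / 8"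
    and b2: "(\<Sum>m<p. (ip n (\<lambda>i. eps i x) (gs n (Z x) m))\<^sup>2) \<le> real n * (\<delta> * s2 / 8)"
    and b3: "(score x)\<^sup>2 \<le> real n * (\<delta> / 8)"
  shows "\<exists>r. score x = t_stat n p (res_W x) (pres n p (Z x) (V x)) * r \<and> \<bar>r - 1\<bar> \<le> \<delta>"
proof -
  let ?E = "\<lambda>i. eps i x" and ?Vr = "pres n p (Z x) (V x)"
  let ?P = "\<Sum>m<p. (ip n ?E (gs n (Z x) m))\<^sup>2"
  define m where "m = real n - real p - 1"
  have m: "real n / 2 \<le> m" "0 < m" using n2 n by (auto simp: m_def)
  have npos: "0 < real n" using n by simp
  have Vr: "?Vr i = pres n p (Z x) ?E i" if "i < n" for i
    by (rule pres_diff_column_comb[where e = ?E and b = \<beta>, OF eps_eq that])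
  have RV: "ip n (res_W x) ?Vr = sqrt s2 * sqrt (sq_W x) * score x"
  proof -
    have "ip n (res_W x) ?Vr = ip n (res_W x) (pres n p (Z x) ?E)" by (rule ip_cong) (auto simp: Vr)
    also have "\<dots> = ip n (res_W x) ?E" unfolding res_W_def by (rule ip_pres_pres)
    finally show ?thesis using score_eq[OF sq] by simp
  qed
  have VV: "ip n ?Vr ?Vr = ip n ?E ?E - ?P"
    unfolding ip_pres_self[symmetric] by (rule ip_cong) (auto simp: Vr)
  have sqp: "0 < sq_W x" using sq ip_nonneg[of n "res_W x"] by (simp add: sq_W_def)
  \<comment> \<open>The residual sum of squares of the regression of \<open>V\<close> on
    \<open>W\<close> and \<open>Z\<close>, expressed through the errors.\<close>
  define D where "D = ip n ?E ?E - ?P - s2 * (score x)\<^sup>2"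
  have den: "ip n (res_W x) (res_W x) * ip n ?Vr ?Vr - (ip n (res_W x) ?Vr)\<^sup>2 = sq_W x * D"
    unfolding RV VV D_def sq_W_def[symmetric]
    using s2 sqp by (simp add: power_mult_distrib right_diff_distrib mult_ac)
  have D: "\<bar>D - m * s2\<bar> \<le> m * s2 * \<delta>"
  proof -
    have EE: "ip n ?E ?E = (\<Sum>k<n. (eps k x)\<^sup>2 - s2) + real n * s2"
      by (simp add: ip_def sum_subtractf power2_eq_square)
    have 1: "\<bar>\<Sum>k<n. (eps k x)\<^sup>2 - s2\<bar> \<le> real n * (\<delta> * s2 / 8)"
      using b1 npos by (simp add: abs_mult field_simps)
    have 3: "s2 * (score x)\<^sup>2 \<le> real n * (\<delta> * s2 / 8)"
      using mult_left_mono[OF b3, of s2] s2 by (simp add: mult_ac)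
    have 4: "(real p + 1) * s2 \<le> real n * (\<delta> * s2 / 8)"
    proof -
      have "8 * (real p + 1) * (s2 / 8) \<le> real n * \<delta> * (s2 / 8)" using n8 s2 by (intro mult_right_mono) auto
      then show ?thesis by (simp only: mult.assoc times_divide_eq_right)
    qed
    have "0 \<le> ?P" by (simp add: sum_nonneg)
    moreover have "0 \<le> s2 * (score x)\<^sup>2" using s2 by simp
    moreover have "0 \<le> (real p + 1) * s2" using s2 by simp
    moreover have "D - m * s2 = (\<Sum>k<n. (eps k x)\<^sup>2 - s2) - ?P - s2 * (score x)\<^sup>2 + (real p + 1) * s2"
      unfolding D_def EE m_def by (simp add: algebra_simps)
    \<comment> \<open>Four errors of \<open>n * \<delta> * s2 / 8\<close> make
      \<open>n * \<delta> * s2 / 2\<close>, and \<open>m \<ge> n / 2\<close> turns this into a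
      relative error \<delta>.\<close>
    ultimately have "\<bar>D - m * s2\<bar> \<le> real n * (\<delta> * s2 / 8) * 4" using 1 b2 3 4 by linarith
    also have "\<dots> = (real n / 2) * (s2 * \<delta>)" by simp
    also have "\<dots> \<le> m * (s2 * \<delta>)" using m s2 \<delta> by (intro mult_right_mono) auto
    finally show ?thesis by (simp add: mult.assoc)
  qed
  \<comment> \<open>The ratio of estimated to true standard deviation: the t-statistic divides by
    the former, the score by the latter.\<close>
  define r where "r = sqrt (D / (m * s2))"
  have ms: "0 < m * s2" using m s2pos by simp
  have "m * s2 * \<delta> < m * s2" using mult_strict_left_mono[OF \<delta>(2) ms] by simp
  then have Dpos: "0 < D" using D by linarith
  have "\<bar>D / (m * s2) - 1\<bar> = \<bar>D - m * s2\<bar> / (m * s2)"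
  proof -
    have "D / (m * s2) - 1 = (D - m * s2) / (m * s2)" 
      by (subst diff_divide_distrib) (subst divide_self, use ms in auto)
    then show ?thesis by (simp only: abs_divide abs_of_pos[OF ms])
  qed
  also have "\<dots> \<le> \<delta>" using D ms by (simp add: pos_divide_le_eq mult.commute)
  finally have r2: "\<bar>r\<^sup>2 - 1\<bar> \<le> \<delta>" unfolding r_def using Dpos ms by simp
  have r0: "0 < r" unfolding r_def using Dpos ms by simp
  have "\<bar>r - 1\<bar> * 1 \<le> \<bar>r - 1\<bar> * (r + 1)" using r0 by (intro mult_left_mono) auto
  also have "\<dots> = \<bar>(r - 1) * (r + 1)\<bar>" using r0 by (simp add: abs_mult)
  also have "(r - 1) * (r + 1) = r\<^sup>2 - 1" by (simp add: power2_eq_square algebra_simps)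
  finally have "\<bar>r - 1\<bar> \<le> \<delta>" using r2 by simp
  moreover have "score x = t_stat n p (res_W x) ?Vr * r"
  proof -
    have "t_stat n p (res_W x) ?Vr = sqrt m * (sqrt s2 * sqrt (sq_W x) * score x) / sqrt (sq_W x * D)"
      unfolding t_stat_def den unfolding RV m_def ..
    also have "\<dots> = sqrt (m * s2) / sqrt D * score x"
      using sqp Dpos by (simp add: real_sqrt_mult)
    also have "\<dots> * r = score x"
      unfolding r_def real_sqrt_divide using Dpos m(2) s2pos by simp
    finally show ?thesis by simp
  qed
  ultimately show ?thesis by blast
qed

text \<open>The exceptional set joins a zero residual with three deviation events. Markov's
  inequality bounds each of these from an integral computed above, and for fixed \<delta> the bounds
  tend to 0.\<close>

lemma t_stat_approx:
  assumes \<delta>: "0 < \<delta>" "\<delta> < 1"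
    and n2: "2 * (real p + 1) \<le> real n" and n8: "8 * (real p + 1) \<le> real n * \<delta>"
  shows "\<exists>B\<in>sets M. prob B \<le> prob {x \<in> space M. sq_W x = 0}
      + 2 * (Mb + s2 * sqrt s2) / (sqrt (real n) * ((\<delta> * s2 / 8)\<^sup>2 / (1 + (\<delta> * s2 / 8)\<^sup>2)))
      + real p * 8 / (real n * \<delta>) + 8 / (real n * \<delta>)
    \<and> (\<forall>x\<in>space M - B. \<exists>r. score x = t_stat n p (res_W x) (pres n p (Z x) (V x)) * r \<and> \<bar>r - 1\<bar> \<le> \<delta>)"
proof -
  define T where "T = (\<lambda>x. 1 / real n * (\<Sum>k<n. (eps k x)\<^sup>2 - s2))"
  define P where "P = (\<lambda>x. \<Sum>m<p. (ip n (\<lambda>i. eps i x) (gs n (Z x) m))\<^sup>2)"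
  define \<phi> where "\<phi> = (\<lambda>x :: real. x\<^sup>2 / (1 + x\<^sup>2))"
  define \<eta> where "\<eta> = \<delta> * s2 / 8"
  have \<eta>: "0 < \<eta>" using \<delta> s2pos by (simp add: \<eta>_def)
  have npos: "0 < real n" using n by simp
  have TM[measurable]: "T \<in> borel_measurable M"
    unfolding T_def by (intro borel_measurable_times borel_measurable_sum borel_measurable_diff borel_measurable_power borel_measurable_const eps_meas) auto
  have PM[measurable]: "P \<in> borel_measurable M"
    unfolding P_def using fitted_second_moment(1) by (rule borel_measurable_integrable)
  note [measurable] = sq_W_M score_M
  let ?B1 = "{x \<in> space M. sq_W x = 0}" and ?B2 = "{x \<in> space M. \<eta> < \<bar>T x\<bar>}"
    and ?B3 = "{x \<in> space M. real n * \<eta> < P x}" and ?B4 = "{x \<in> space M. real n * (\<delta> / 8) < (score x)\<^sup>2}"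
  have \<phi>pos: "0 < \<phi> \<eta>" unfolding \<phi>_def using \<eta> by (simp add: add_pos_nonneg)
  have \<phi>M[measurable]: "\<phi> \<in> borel_measurable borel" unfolding \<phi>_def by measurable
  have \<phi>0: "0 \<le> \<phi> y" and \<phi>1: "\<phi> y \<le> 1" for y
  proof -
    have "0 < 1 + y\<^sup>2" by (simp add: add_pos_nonneg)
    then show "0 \<le> \<phi> y" "\<phi> y \<le> 1" unfolding \<phi>_def by (simp_all add: divide_le_eq)
  qed
  \<comment> \<open>\<open>\<phi>\<close> increases with \<open>|x|\<close>, so a large
    \<open>|T x|\<close> forces \<open>\<phi> (T x) \<ge> \<phi> \<eta>\<close>.\<close>
  have "prob ?B2 \<le> (\<integral>x. \<phi> (T x) \<partial>M) / \<phi> \<eta>"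
  proof (rule prob_le_integral_div[OF _ \<phi>0 \<phi>pos])
    show "integrable M (\<lambda>x. \<phi> (T x))"
      by (rule integrable_const_bound[where B=1]) (use \<phi>0 \<phi>1 in auto)
    show "?B2 \<in> sets M" by measurable
    fix x assume "x \<in> ?B2"
    then have "\<eta>\<^sup>2 \<le> (T x)\<^sup>2" using \<eta> by (simp add: abs_le_square_iff[symmetric])
    then have "\<eta>\<^sup>2 * (1 + (T x)\<^sup>2) \<le> (T x)\<^sup>2 * (1 + \<eta>\<^sup>2)" by (simp add: algebra_simps)
    moreover have "0 < 1 + \<eta>\<^sup>2" "0 < 1 + (T x)\<^sup>2" by (simp_all add: add_pos_nonneg)
    ultimately show "\<phi> \<eta> \<le> \<phi> (T x)" unfolding \<phi>_def by (simp add: divide_simps)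
  qed
  also have "\<dots> \<le> (real n * (2 * (1 / real n * sqrt (1 / real n) * (Mb + s2 * sqrt s2)))) / \<phi> \<eta>"
    using integral_bounded_square_le[of "1 / real n"] \<phi>pos unfolding \<phi>_def T_def
    by (intro divide_right_mono) auto
  also have "\<dots> = 2 * (Mb + s2 * sqrt s2) / (sqrt (real n) * \<phi> \<eta>)"
    using npos by (simp add: real_sqrt_divide)
  finally have B2: "prob ?B2 \<le> 2 * (Mb + s2 * sqrt s2) / (sqrt (real n) * \<phi> \<eta>)" .
  have "prob ?B3 \<le> (\<integral>x. P x \<partial>M) / (real n * \<eta>)"
    by (rule prob_le_integral_div) (use fitted_second_moment(1) \<eta> npos in \<open>auto simp: P_def sum_nonneg\<close>)
  also have "\<dots> \<le> real p * s2 / (real n * \<eta>)"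
    using fitted_second_moment(2) \<eta> npos unfolding P_def by (intro divide_right_mono) auto
  also have "\<dots> = real p * 8 / (real n * \<delta>)" using s2pos by (simp add: \<eta>_def)
  finally have B3: "prob ?B3 \<le> real p * 8 / (real n * \<delta>)" .
  have "prob ?B4 \<le> (\<integral>x. (score x)\<^sup>2 \<partial>M) / (real n * (\<delta> / 8))"
    by (rule prob_le_integral_div) (use score_second_moment(1) \<delta> npos in auto)
  also have "\<dots> \<le> 1 / (real n * (\<delta> / 8))"
    using score_second_moment(2) \<delta> npos by (intro divide_right_mono) auto
  finally have B4: "prob ?B4 \<le> 8 / (real n * \<delta>)" by simp
  let ?B = "?B1 \<union> ?B2 \<union> ?B3 \<union> ?B4"
  have sets: "?B1 \<in> sets M" "?B2 \<in> sets M" "?B3 \<in> sets M" "?B4 \<in> sets M" by measurable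
  have "prob ?B \<le> prob ?B1 + prob ?B2 + prob ?B3 + prob ?B4"
    using measure_Un_le[of "?B1 \<union> ?B2 \<union> ?B3" M ?B4] measure_Un_le[of "?B1 \<union> ?B2" M ?B3]
      measure_Un_le[of ?B1 M ?B2] sets[THEN sets.Un] sets by (smt (verit, best) sets.Un)
  then have 1: "prob ?B \<le> prob ?B1 + 2 * (Mb + s2 * sqrt s2) / (sqrt (real n) * \<phi> \<eta>)
      + real p * 8 / (real n * \<delta>) + 8 / (real n * \<delta>)"
    using B2 B3 B4 by linarith
  have 2: "\<exists>r. score x = t_stat n p (res_W x) (pres n p (Z x) (V x)) * r \<and> \<bar>r - 1\<bar> \<le> \<delta>"
    if "x \<in> space M - ?B" for x
    by (rule t_stat_score[OF _ \<delta> n2 n8]) (use that in \<open>auto simp: T_def P_def \<eta>_def not_less\<close>)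
  have \<phi>\<eta>: "\<phi> \<eta> = (\<delta> * s2 / 8)\<^sup>2 / (1 + (\<delta> * s2 / 8)\<^sup>2)" by (simp only: \<phi>_def \<eta>_def)
  show ?thesis
  proof (rule bexI[of _ ?B])
    show "?B \<in> sets M" by (intro sets.Un sets)
  qed (intro conjI 1[unfolded \<phi>\<eta>] ballI 2)
qed

end

text \<open>Invertibility is an open condition at \<Sigma>, so a singular Gram matrix forces one of
  \<open>p\<^sup>2\<close> scaled entries to deviate by more than a fixed \<delta>; a union bound
  and (A1) finish.\<close>

lemma singular_gram_prob_tendsto_0:
  fixes M :: "nat \<Rightarrow> 'a measure" and Z :: "nat \<Rightarrow> 'a \<Rightarrow> nat \<Rightarrow> nat \<Rightarrow> real"
  assumes prob: "\<And>n. prob_space (M n)"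
    and Z: "\<And>n i j. i < n \<Longrightarrow> j < p \<Longrightarrow> (\<lambda>\<omega>. Z n \<omega> i j) \<in> borel_measurable (M n)"
    and pd: "pos_def p \<Sigma>"
    and A1: "\<And>j l. j < p \<Longrightarrow> l < p \<Longrightarrow> conv_prob_const M (\<lambda>n \<omega>. gram n (Z n \<omega>) j l / real n) (\<Sigma> j l)"
  shows "(\<lambda>n. measure (M n) {\<omega> \<in> space (M n). \<not> invertible_k p (gram n (Z n \<omega>))}) \<longlonglongrightarrow> 0"
proof -
  obtain \<delta> where \<delta>: "0 < \<delta>" "\<And>A. (\<forall>i<p. \<forall>j<p. \<bar>A i j - \<Sigma> i j\<bar> \<le> \<delta>) \<Longrightarrow> invertible_k p A"
    using pos_def_perturb[OF pd] by blast
  let ?D = "\<lambda>n j l. {\<omega> \<in> space (M n). \<bar>gram n (Z n \<omega>) j l / real n - \<Sigma> j l\<bar> > \<delta>}"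
  have gM: "(\<lambda>\<omega>. gram n (Z n \<omega>) j l) \<in> borel_measurable (M n)" if "j < p" "l < p" for n j l
    unfolding gram_def using Z that by (intro borel_measurable_sum borel_measurable_times) auto
  have DM: "?D n j l \<in> sets (M n)" if "j < p" "l < p" for n j l
    using gM[OF that] by measurable
  have lim: "(\<lambda>n. \<Sum>j<p. \<Sum>l<p. measure (M n) (?D n j l)) \<longlonglongrightarrow> 0"
  proof -
    have "(\<lambda>n. \<Sum>j<p. \<Sum>l<p. measure (M n) (?D n j l)) \<longlonglongrightarrow> (\<Sum>j<p. \<Sum>l<p. 0)"
      using A1 \<delta>(1) unfolding conv_prob_const_def by (intro tendsto_sum) auto
    then show ?thesis by simp
  qed
  have le: "measure (M n) {\<omega> \<in> space (M n). \<not> invertible_k p (gram n (Z n \<omega>))}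
      \<le> (\<Sum>j<p. \<Sum>l<p. measure (M n) (?D n j l))" if n: "0 < n" for n
  proof -
    interpret prob_space "M n" by (rule prob)
    have "{\<omega> \<in> space (M n). \<not> invertible_k p (gram n (Z n \<omega>))} \<subseteq> (\<Union>j<p. \<Union>l<p. ?D n j l)"
    proof
      fix \<omega> assume w: "\<omega> \<in> {\<omega> \<in> space (M n). \<not> invertible_k p (gram n (Z n \<omega>))}"
      \<comment> \<open>Dividing by \<open>n > 0\<close> does not change the kernel.\<close>
      have "\<not> invertible_k p (\<lambda>i j. gram n (Z n \<omega>) i j / real n)"
      proof -
        have "(\<Sum>j<p. gram n (Z n \<omega>) i j / real n * v j) = (\<Sum>j<p. gram n (Z n \<omega>) i j * v j) / real n" for i v
          by (simp add: sum_divide_distrib)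
        then show ?thesis using w n by (simp add: invertible_k_iff_kdet kdet_eq_0_iff)
      qed
      then have "\<not> (\<forall>i<p. \<forall>j<p. \<bar>gram n (Z n \<omega>) i j / real n - \<Sigma> i j\<bar> \<le> \<delta>)"
        using \<delta>(2)[of "\<lambda>i j. gram n (Z n \<omega>) i j / real n"] by blast
      then show "\<omega> \<in> (\<Union>j<p. \<Union>l<p. ?D n j l)" using w by (auto simp: not_le)
    qed
    then have "prob {\<omega> \<in> space (M n). \<not> invertible_k p (gram n (Z n \<omega>))} \<le> prob (\<Union>j<p. \<Union>l<p. ?D n j l)"
      using DM by (intro finite_measure_mono sets.finite_UN) auto
    also have "\<dots> \<le> (\<Sum>j<p. prob (\<Union>l<p. ?D n j l))"
      using DM by (intro finite_measure_subadditive_finite) (auto intro!: sets.finite_UN)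
    also have "\<dots> \<le> (\<Sum>j<p. \<Sum>l<p. prob (?D n j l))"
      using DM by (intro sum_mono finite_measure_subadditive_finite) auto
    finally show ?thesis .
  qed
  show ?thesis
    by (rule tendsto_sandwich[OF _ _ tendsto_const lim])
      (use le in \<open>auto intro!: eventually_sequentiallyI[of 1]\<close>)
qed

text \<open>Stated for an abstract pair \<open>W\<close>, \<open>V\<close> so that both alternatives
  of the theorem are instances: \<open>V\<close> follows the linear model and \<open>W\<close>
  supplies the residual weights.\<close>

lemma t_stat_weak_conv:
  fixes M :: "nat \<Rightarrow> 'a measure"
    and V W :: "nat \<Rightarrow> 'a \<Rightarrow> nat \<Rightarrow> real"
    and Z :: "nat \<Rightarrow> 'a \<Rightarrow> nat \<Rightarrow> nat \<Rightarrow> real"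
  assumes prob: "\<And>n. prob_space (M n)"
    and V: "\<And>n i. i < n \<Longrightarrow> (\<lambda>\<omega>. V n \<omega> i) \<in> borel_measurable (M n)"
    and W: "\<And>n i. i < n \<Longrightarrow> (\<lambda>\<omega>. W n \<omega> i) \<in> borel_measurable (M n)"
    and Z: "\<And>n i j. i < n \<Longrightarrow> j < p \<Longrightarrow> (\<lambda>\<omega>. Z n \<omega> i j) \<in> borel_measurable (M n)"
    and pd: "pos_def p \<Sigma>"
    and A1: "\<And>j l. j < p \<Longrightarrow> l < p \<Longrightarrow> conv_prob_const M (\<lambda>n \<omega>. gram n (Z n \<omega>) j l / real n) (\<Sigma> j l)"
    and null: "\<And>n. n > p + 1 \<Longrightarrow>
        cond_indep_alg (M n) (gen_sigma (M n) (\<lambda>(i, j) \<omega>. Z n \<omega> i j) ({..<n} \<times> {..<p}))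
          (gen_sigma (M n) (\<lambda>i \<omega>. W n \<omega> i) {..<n}) (gen_sigma (M n) (\<lambda>i \<omega>. V n \<omega> i) {..<n})"
    and s2: "0 < s2" and model: "\<And>n. n > p + 1 \<Longrightarrow> lin_model (M n) n p (V n) (Z n) s2 Mb"
    and lyap: "lyapunov_cond M p W Z"
  shows "weak_conv_m (\<lambda>n. distr (M n) borel (\<lambda>\<omega>. if invertible_k p (gram n (Z n \<omega>))
      then t_stat n p (pres n p (Z n \<omega>) (W n \<omega>)) (pres n p (Z n \<omega>) (V n \<omega>)) else 0)) std_normal_distribution"
proof -
  define R where "R = (\<lambda>n \<omega>. pres n p (Z n \<omega>) (W n \<omega>))"
  define S where "S = (\<lambda>n \<omega>. t_stat n p (R n \<omega>) (pres n p (Z n \<omega>) (V n \<omega>)))"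
  define T where "T = (\<lambda>n \<omega>. if invertible_k p (gram n (Z n \<omega>)) then S n \<omega> else 0)"
  define q where "q = (\<lambda>n. measure (M n) {\<omega> \<in> space (M n). ip n (R n \<omega>) (R n \<omega>) = 0})"
  define s where "s = (\<lambda>n. measure (M n) {\<omega> \<in> space (M n). \<not> invertible_k p (gram n (Z n \<omega>))})"
  define L where "L = (\<lambda>n. 1 / sqrt (real n) * (\<integral>\<omega>. lyapunov_ratio n (R n \<omega>) \<partial>M n))"
  define K where "K = (\<lambda>t. (\<bar>t\<bar> ^ 3 * Mb / 6 + t ^ 4 * s2\<^sup>2 * (1 / sqrt s2) / 8) * (1 / sqrt s2) ^ 3)"
  define c where "c = (\<lambda>\<delta> n. 2 * (Mb + s2 * sqrt s2) / (sqrt (real n) * ((\<delta> * s2 / 8)\<^sup>2 / (1 + (\<delta> * s2 / 8)\<^sup>2)))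
      + real p * 8 / (real n * \<delta>) + 8 / (real n * \<delta>))"
  have res: "resid n p (Z n \<omega>) (W n \<omega>) i = (if i < n then R n \<omega> i else 0)" for n \<omega> i
    unfolding R_def by (rule resid_eq_pres)
  have L: "L \<longlonglongrightarrow> 0"
  proof -
    have "(let R' = resid n p (Z n \<omega>) (W n \<omega>) in if \<forall>i<n. R' i = 0 then 0
       else ((\<Sum>i<n. \<bar>R' i\<bar> ^ 3) / real n) / ((\<Sum>i<n. (R' i)\<^sup>2) / real n) powr (3 / 2)) = lyapunov_ratio n (R n \<omega>)" for n \<omega>
      unfolding Let_def lyapunov_ratio_def res by simp
    then show ?thesis using lyap unfolding lyapunov_cond_def L_def by simp
  qed
  have q: "q \<longlonglongrightarrow> 0"
    using lyap unfolding lyapunov_cond_def res q_def ip_eq_0_iff by simp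
  have s: "s \<longlonglongrightarrow> 0"
    unfolding s_def by (rule singular_gram_prob_tendsto_0[OF prob Z pd A1])
  \<comment> \<open>The model quantifies \<beta> separately for each \<open>n\<close>, so
    coefficients, filtration and score may change with \<open>n\<close>; the existential statement
    keeps only what the limit needs.\<close>
  have approx: "\<exists>N. N \<in> borel_measurable (M n)
      \<and> (\<forall>t. cmod (char (distr (M n) borel N) t - complex_of_real (exp (- t\<^sup>2 / 2))) \<le> K t * L n + q n)
      \<and> (\<forall>\<delta>. 0 < \<delta> \<longrightarrow> \<delta> < 1 \<longrightarrow> 2 * (real p + 1) \<le> real n \<longrightarrow> 8 * (real p + 1) \<le> real n * \<delta> \<longrightarrow>
          (\<exists>B\<in>sets (M n). measure (M n) B \<le> q n + c \<delta> n
            \<and> (\<forall>x\<in>space (M n) - B. \<exists>r. N x = S n x * r \<and> \<bar>r - 1\<bar> \<le> \<delta>)))" if n: "p + 1 < n" for n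
  proof -
    interpret prob_space "M n" by (rule prob)
    show ?thesis
    proof (rule lin_model_martingale_errors[OF V W Z null[OF n] model[OF n] s2])
      fix \<beta> H
      assume mart: "martingale_errors (M n) n H (\<lambda>i x. V n x i - (\<Sum>j<p. Z n x i j * \<beta> j)) s2 Mb"
        and WH: "\<And>i k. i < n \<Longrightarrow> k < n \<Longrightarrow> (\<lambda>x. W n x i) \<in> borel_measurable (H k)"
        and ZH: "\<And>i j k. i < n \<Longrightarrow> j < p \<Longrightarrow> k < n \<Longrightarrow> (\<lambda>x. Z n x i j) \<in> borel_measurable (H k)"
      interpret E: martingale_errors "M n" n H "\<lambda>i x. V n x i - (\<Sum>j<p. Z n x i j * \<beta> j)" s2 Mb by (rule mart)
      interpret E: t_stat_model "M n" n H "\<lambda>i x. V n x i - (\<Sum>j<p. Z n x i j * \<beta> j)" s2 Mb p "W n" "V n" "Z n" \<beta>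
        by unfold_locales (use n s2 WH ZH in auto)
      have res_W: "E.res_W = R n" by (simp add: fun_eq_iff E.res_W_def R_def)
      have sq_W: "E.sq_W x = ip n (R n x) (R n x)" for x by (simp add: E.sq_W_def res_W)
      show ?thesis
      proof (intro exI[of _ E.score] conjI allI impI)
        show "E.score \<in> borel_measurable (M n)" by (rule E.score_M)
        show "cmod (char (distr (M n) borel E.score) t - complex_of_real (exp (- t\<^sup>2 / 2))) \<le> K t * L n + q n" for t
          using E.char_score[of t] unfolding res_W sq_W K_def L_def q_def .
        fix \<delta> :: real assume "0 < \<delta>" "\<delta> < 1" "2 * (real p + 1) \<le> real n" "8 * (real p + 1) \<le> real n * \<delta>"
        from E.t_stat_approx[OF this]
        show "\<exists>B\<in>sets (M n). measure (M n) B \<le> q n + c \<delta> n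
            \<and> (\<forall>x\<in>space (M n) - B. \<exists>r. E.score x = S n x * r \<and> \<bar>r - 1\<bar> \<le> \<delta>)"
          unfolding res_W sq_W q_def c_def S_def by (simp only: add.assoc)
      qed
    qed
  qed
  define good where "good = (\<lambda>n N. N \<in> borel_measurable (M n)
      \<and> (\<forall>t. cmod (char (distr (M n) borel N) t - complex_of_real (exp (- t\<^sup>2 / 2))) \<le> K t * L n + q n)
      \<and> (\<forall>\<delta>. 0 < \<delta> \<longrightarrow> \<delta> < 1 \<longrightarrow> 2 * (real p + 1) \<le> real n \<longrightarrow> 8 * (real p + 1) \<le> real n * \<delta> \<longrightarrow>
          (\<exists>B\<in>sets (M n). measure (M n) B \<le> q n + c \<delta> n
            \<and> (\<forall>x\<in>space (M n) - B. \<exists>r. N x = S n x * r \<and> \<bar>r - 1\<bar> \<le> \<delta>))))"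
  \<comment> \<open>Small \<open>n\<close> gets the zero function, so that every term of the
    sequence is a random variable.\<close>
  define N where "N = (\<lambda>n. if p + 1 < n then (SOME N. good n N) else (\<lambda>_. 0))"
  have N: "good n (N n)" if "p + 1 < n" for n
  proof -
    have "\<exists>N. good n N" using approx[OF that] unfolding good_def .
    from someI_ex[OF this] show ?thesis by (simp only: N_def that if_True)
  qed
  have NM: "N n \<in> borel_measurable (M n)" for n
  proof (cases "p + 1 < n")
    case True
    then show ?thesis using N[OF True] by (simp add: good_def)
  qed (simp add: N_def)
  have TM: "T n \<in> borel_measurable (M n)" for n
    unfolding T_def S_def R_def by (rule borel_measurable_t_stat) (use Z W V in auto)
  have sets_s: "{\<omega> \<in> space (M n). \<not> invertible_k p (gram n (Z n \<omega>))} \<in> sets (M n)" for n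
  proof -
    note [measurable] = borel_measurable_kdet_gram[OF Z]
    show ?thesis unfolding invertible_k_iff_kdet by measurable
  qed
  have Nconv: "weak_conv_m (\<lambda>n. distr (M n) borel (N n)) std_normal_distribution"
  proof (rule levy_continuity)
    show "real_distribution (distr (M n) borel (N n))" for n
      by (rule prob_space.real_distribution_distr[OF prob NM])
    show "real_distribution std_normal_distribution" by (rule real_dist_normal_dist)
    fix t
    have "(\<lambda>n. K t * L n + q n) \<longlonglongrightarrow> K t * 0 + 0" by (intro tendsto_intros L q)
    then have lim: "(\<lambda>n. K t * L n + q n) \<longlonglongrightarrow> 0" by simp
    have "(\<lambda>n. char (distr (M n) borel (N n)) t - complex_of_real (exp (- t\<^sup>2 / 2))) \<longlonglongrightarrow> 0"
    proof (rule Lim_null_comparison[OF _ lim])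
      show "\<forall>\<^sub>F n in sequentially. norm (char (distr (M n) borel (N n)) t - complex_of_real (exp (- t\<^sup>2 / 2))) \<le> K t * L n + q n"
        using eventually_gt_at_top[of "p + 1"] by eventually_elim (use N in \<open>auto simp: good_def\<close>)
    qed
    then show "(\<lambda>n. char (distr (M n) borel (N n)) t) \<longlonglongrightarrow> char std_normal_distribution t"
      unfolding char_std_normal_distribution by (rule LIM_zero_cancel)
  qed
  have "weak_conv_m (\<lambda>n. distr (M n) borel (T n)) std_normal_distribution"
  proof (rule weak_conv_std_normal_scale[OF prob NM TM Nconv])
    fix \<delta> :: real assume \<delta>: "0 < \<delta>"
    \<comment> \<open>\<open>approx\<close> requires a tolerance below 1; the sharper
      \<open>d\<close> serves every \<delta>.\<close>
    define d where "d = min \<delta> (1 / 2)"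
    have d: "0 < d" "d < 1" "d \<le> \<delta>" using \<delta> by (auto simp: d_def)
    have c0: "c d \<longlonglongrightarrow> 0"
    proof -
      define k where "k = (d * s2 / 8)\<^sup>2 / (1 + (d * s2 / 8)\<^sup>2)"
      have k: "0 < k" unfolding k_def using d s2 by (intro divide_pos_pos) (auto simp: add_pos_nonneg)
      have 1: "(\<lambda>n. 2 * (Mb + s2 * sqrt s2) / (sqrt (real n) * k)) \<longlonglongrightarrow> 0"
        using k by real_asymp
      have 2: "(\<lambda>n. real p * 8 / (real n * d)) \<longlonglongrightarrow> 0" using d by real_asymp
      have 3: "(\<lambda>n. 8 / (real n * d)) \<longlonglongrightarrow> 0" using d by real_asymp
      show ?thesis using tendsto_add[OF tendsto_add[OF 1 2] 3] unfolding c_def k_def by simp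
    qed
    show "\<exists>b. b \<longlonglongrightarrow> 0 \<and> (\<forall>\<^sub>F n in sequentially. \<exists>B\<in>sets (M n). measure (M n) B \<le> b n \<and>
        (\<forall>x\<in>space (M n) - B. \<exists>r. N n x = T n x * r \<and> \<bar>r - 1\<bar> \<le> \<delta>))"
    proof (intro exI[of _ "\<lambda>n. (q n + c d n) + s n"] conjI)
      show "(\<lambda>n. (q n + c d n) + s n) \<longlonglongrightarrow> 0" using tendsto_add[OF tendsto_add[OF q c0] s] by simp
      have "\<forall>\<^sub>F n in sequentially. 2 * (real p + 1) \<le> real n" by real_asymp
      moreover have "\<forall>\<^sub>F n in sequentially. 8 * (real p + 1) \<le> real n * d" using d by real_asymp
      ultimately show "\<forall>\<^sub>F n in sequentially. \<exists>B\<in>sets (M n). measure (M n) B \<le> (q n + c d n) + s n \<and>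
        (\<forall>x\<in>space (M n) - B. \<exists>r. N n x = T n x * r \<and> \<bar>r - 1\<bar> \<le> \<delta>)"
        using eventually_gt_at_top[of "p + 1"]
      proof eventually_elim
        case (elim n)
        interpret prob_space "M n" by (rule prob)
        obtain B where B: "B \<in> sets (M n)" "prob B \<le> q n + c d n"
          and r: "\<And>x. x \<in> space (M n) - B \<Longrightarrow> \<exists>r. N n x = S n x * r \<and> \<bar>r - 1\<bar> \<le> d"
          using N[OF elim(3)] d(1,2) elim(1,2) unfolding good_def by blast
        let ?C = "{\<omega> \<in> space (M n). \<not> invertible_k p (gram n (Z n \<omega>))}"
        have "prob (B \<union> ?C) \<le> prob B + prob ?C"
          using B(1) sets_s by (rule measure_Un_le)
        then have 1: "prob (B \<union> ?C) \<le> (q n + c d n) + s n" using B(2) unfolding s_def by simp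
        have 2: "\<exists>r. N n x = T n x * r \<and> \<bar>r - 1\<bar> \<le> \<delta>" if x: "x \<in> space (M n) - (B \<union> ?C)" for x
        proof -
          have "T n x = S n x" using x by (simp add: T_def)
          moreover obtain r where "N n x = S n x * r" "\<bar>r - 1\<bar> \<le> d" using r x by blast
          ultimately show ?thesis using d(3) by (intro exI[of _ r]) auto
        qed
        show ?case
          by (rule bexI[of _ "B \<union> ?C"]) (use 1 2 B(1) sets_s in blast)+
      qed
    qed
  qed
  then show ?thesis unfolding T_def S_def R_def .
qed

lemma cond_indep_alg_commute:
  assumes "cond_indep_alg M F A B"
  shows "cond_indep_alg M F B A"
  unfolding cond_indep_alg_def
proof (intro ballI)
  fix b a assume "b \<in> sets B" "a \<in> sets A"
  then have "AE \<omega> in M. real_cond_exp M F (indicator (a \<inter> b)) \<omega> =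
      real_cond_exp M F (indicator a) \<omega> * real_cond_exp M F (indicator b) \<omega>"
    using assms by (simp add: cond_indep_alg_def)
  then show "AE \<omega> in M. real_cond_exp M F (indicator (b \<inter> a)) \<omega> =
      real_cond_exp M F (indicator b) \<omega> * real_cond_exp M F (indicator a) \<omega>"
    by (simp only: Int_commute[of b a] mult.commute)
qed

theorem theorem1:
  fixes M :: "nat \<Rightarrow> 'a measure"
    and Y X :: "nat \<Rightarrow> 'a \<Rightarrow> nat \<Rightarrow> real"
    and Z :: "nat \<Rightarrow> 'a \<Rightarrow> nat \<Rightarrow> nat \<Rightarrow> real"
    and p :: nat
    and \<Sigma> :: "nat \<Rightarrow> nat \<Rightarrow> real"
  assumes p_pos: "p \<ge> 1"
    and prob: "\<And>n. prob_space (M n)"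
    and meas_Y: "\<And>n i. i < n \<Longrightarrow> (\<lambda>\<omega>. Y n \<omega> i) \<in> borel_measurable (M n)"
    and meas_X: "\<And>n i. i < n \<Longrightarrow> (\<lambda>\<omega>. X n \<omega> i) \<in> borel_measurable (M n)"
    and meas_Z: "\<And>n i j. i < n \<Longrightarrow> j < p \<Longrightarrow> (\<lambda>\<omega>. Z n \<omega> i j) \<in> borel_measurable (M n)"
    and Sigma_pd: "pos_def p \<Sigma>"
    and A1_prob: "\<And>j l. j < p \<Longrightarrow> l < p \<Longrightarrow>
        conv_prob_const M (\<lambda>n \<omega>. gram n (Z n \<omega>) j l / real n) (\<Sigma> j l)"
    and A1_exp: "\<And>j l. j < p \<Longrightarrow> l < p \<Longrightarrow>
        (\<forall>\<^sub>F n in sequentially. integrable (M n) (\<lambda>\<omega>. gram n (Z n \<omega>) j l / real n)) \<and>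
        (\<lambda>n. \<integral>\<omega>. gram n (Z n \<omega>) j l / real n \<partial>M n) \<longlonglongrightarrow> \<Sigma> j l"
    and null: "\<And>n. n > p + 1 \<Longrightarrow>
        cond_indep_alg (M n) (gen_sigma (M n) (\<lambda>(i, j) \<omega>. Z n \<omega> i j) ({..<n} \<times> {..<p}))
          (gen_sigma (M n) (\<lambda>i \<omega>. X n \<omega> i) {..<n}) (gen_sigma (M n) (\<lambda>i \<omega>. Y n \<omega> i) {..<n})"
    and model: "(\<exists>\<sigma>2 Mb. \<sigma>2 > 0 \<and> (\<forall>n > p + 1. lin_model (M n) n p (Y n) (Z n) \<sigma>2 Mb)
                   \<and> lyapunov_cond M p X Z)
              \<or> (\<exists>\<sigma>2 Mb. \<sigma>2 > 0 \<and> (\<forall>n > p + 1. lin_model (M n) n p (X n) (Z n) \<sigma>2 Mb)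
                   \<and> lyapunov_cond M p Y Z)"
  shows "weak_conv_m (\<lambda>n. distr (M n) borel (\<lambda>\<omega>. T_OLS n p (Y n \<omega>) (X n \<omega>) (Z n \<omega>)))
           std_normal_distribution"
proof -
  have T: "T_OLS n p (Y n \<omega>) (X n \<omega>) (Z n \<omega>) = (if invertible_k p (gram n (Z n \<omega>))
      then t_stat n p (pres n p (Z n \<omega>) (X n \<omega>)) (pres n p (Z n \<omega>) (Y n \<omega>)) else 0)" for n \<omega>
    by (rule T_OLS_eq_t_stat)
  from model show ?thesis
  proof (elim disjE exE conjE)
    fix s2 Mb
    assume *: "0 < s2" "\<forall>n>p + 1. lin_model (M n) n p (Y n) (Z n) s2 Mb" "lyapunov_cond M p X Z"
    show ?thesis
      unfolding T
      by (rule t_stat_weak_conv[where ?s2.0 = s2 and Mb = Mb, OF prob meas_Y meas_X meas_Z Sigma_pd A1_prob null])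
        (use * in simp_all)
  next
    fix s2 Mb
    assume *: "0 < s2" "\<forall>n>p + 1. lin_model (M n) n p (X n) (Z n) s2 Mb" "lyapunov_cond M p Y Z"
    have T': "T_OLS n p (Y n \<omega>) (X n \<omega>) (Z n \<omega>) = (if invertible_k p (gram n (Z n \<omega>))
      then t_stat n p (pres n p (Z n \<omega>) (Y n \<omega>)) (pres n p (Z n \<omega>) (X n \<omega>)) else 0)" for n \<omega>
      unfolding T by (simp add: t_stat_commute)
    show ?thesis
      unfolding T'
      by (rule t_stat_weak_conv[where ?s2.0 = s2 and Mb = Mb, OF prob meas_X meas_Y meas_Z Sigma_pd A1_prob cond_indep_alg_commute[OF null]])
        (use * in simp_all)
  qed
qed

end
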